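(* Let $\varphi:\mathbb{R}^d\to\mathbb{R}^d$ be a smooth mapping and let $\psi\in C^\infty(\mathbb{R}^d)$ (complex-valued). (A) The following are equivalent: (i) $C_{\psi,\varphi}$ acts on $\mathscr{S}(\mathbb{R}^d)$ and is topologizable; (ii) for all $\alpha,\lambda\in\mathbb{N}_0^d$ with $|\lambda|\le|\alpha|$ and each $p>0$ there exists $q>0$ such that $$\forall\,n\in\mathbb{N}:\ \sup_{x\in\mathbb{R}^d}\frac{(1+|x|)^p}{(1+|\varphi_n(x)|)^q}\left|F_{\alpha,\lambda}^{\varphi_n,\psi^{n,\varphi}}(x)\right|<\infty.$$ (B) The following are equivalent: (i) $C_{\psi,\varphi}$ acts on $\mathscr{S}(\mathbb{R}^d)$ and is $m$-topologizable; (ii) for all $\alpha,\lambda\in\mathbb{N}_0^d$ with $|\lambda|\le|\alpha|$ and each $p>0$ there exist $q>0$ and $M>0$ such that $$\forall\,n\in\mathbb{N}:\ \sup_{x\in\mathbb{R}^d}\frac{(1+|x|)^p}{(1+|\varphi_n(x)|)^q}\left|F_{\alpha,\lambda}^{\varphi_n,\psi^{n,\varphi}}(x)\right|<M^n.$$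
   Context: $\mathscr{S}(\mathbb{R}^d)$ is the Schwartz space of complex-valued rapidly decreasing smooth functions with its standard Fréchet topology, given by the norms $\|f\|_{p,\alpha}=\sup_x(1+|x|)^p|f^{(\alpha)}(x)|$, $p>0$, $\alpha\in\mathbb{N}_0^d$. $\mathbb{N}=\{1,2,\dots\}$. $C_{\psi,\varphi}f=\psi\cdot(f\circ\varphi)$; it acts on $\mathscr{S}(\mathbb{R}^d)$ if $C_{\psi,\varphi}f\in\mathscr{S}(\mathbb{R}^d)$ for all $f\in\mathscr{S}(\mathbb{R}^d)$ (it is then automatically continuous). A continuous linear operator $T$ on a locally convex Hausdorff space $E$ is topologizable if for every continuous seminorm $r$ on $E$ there are a continuous seminorm $s$ on $E$ and a sequence $(a_n)_{n\in\mathbb{N}}$ of positive numbers such that $r(a_nT^nx)\le s(x)$ for all $n\in\mathbb{N}$, $x\in E$. It is $m$-topologizable if, moreover, the sequence can always be chosen of the form $a_n=M^n$ for some $M>0$ (depending on $r$). Iterates: $\varphi_n=\varphi\circ\cdots\circ\varphi$ ($n$ times), $\varphi_0(x)=x$, and $\psi^{n,\varphi}(x)=\prod_{j=1}^n\psi(\varphi_{j-1}(x))$. Here $|x|$ is the Euclidean norm for $x\in\mathbb{R}^d$, $|\alpha|=\sum_j\alpha_j$ for a multi-index, $f^{(\alpha)}=\partial^\alpha f$. Order on multi-indices: $\alpha\prec\beta$ iff $|\alpha|<|\beta|$, or $|\alpha|=|\beta|$ and $\alpha_1<\beta_1$, or $|\alpha|=|\beta|$, $\alpha_1=\beta_1,\dots,\alpha_k=\beta_k$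 and $\alpha_{k+1}<\beta_{k+1}$ for some $1\le k<d$. As usual $\beta\le\alpha$ means componentwise. For $\beta\in\mathbb{N}_0^d\setminus\{0\}$, $\lambda\in\mathbb{N}_0^d$, let $p(\beta,\lambda)$ be the set of all $(k_1,\dots,k_{|\beta|};\ell_1,\dots,\ell_{|\beta|})\in\mathbb{N}_0^{2|\beta|d}$ (each $k_j,\ell_j\in\mathbb{N}_0^d$) such that for some $1\le s\le|\beta|$: $k_j=\ell_j=0$ for $1\le j\le|\beta|-s$; $|k_j|>0$ for $|\beta|-s+1\le j\le|\beta|$; $0\prec\ell_{|\beta|-s+1}\prec\cdots\prec\ell_{|\beta|}$; $\sum_{j=1}^{|\beta|}k_j=\lambda$ and $\sum_{j=1}^{|\beta|}|k_j|\ell_j=\beta$. Further $p(0,\lambda)=\emptyset$ if $\lambda\ne0$ and $p(0,0)$ is a one-element set. For $\eta\in C^\infty(\mathbb{R}^d)$, a smooth map $\theta=(\theta_1,\dots,\theta_d):\mathbb{R}^d\to\mathbb{R}^d$, and $\alpha,\lambda\in\mathbb{N}_0^d$ with $|\lambda|\le|\alpha|$, $$F_{\alpha,\lambda}^{\theta,\eta}(x)=\sum_{\substack{\beta\in\mathbb{N}_0^d\\ \beta\le\alpha,\ |\lambda|\le|\beta|}}\binom{\alpha}{\beta}\eta^{(\alpha-\beta)}(x)\sum_{p(\beta,\lambda)}\beta!\prod_{j=1}^{|\beta|}\frac{\left(\theta^{(\ell_j)}(x)\right)^{k_j}}{k_j!\,(\ell_j!)^{|k_j|}},$$ where the inner sum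 runs over the elements of $p(\beta,\lambda)$, $\left(\theta^{(\ell)}(x)\right)^{k}=\prod_{i=1}^d\left(\theta_i^{(\ell)}(x)\right)^{k_i}$, $0^0=1$, empty sums are $0$ and empty products are $1$ (so the inner sum for $\beta=\lambda=0$ equals $1$). With this, $(\eta\cdot(f\circ\theta))^{(\alpha)}(x)=\sum_{|\lambda|\le|\alpha|}f^{(\lambda)}(\theta(x))F_{\alpha,\lambda}^{\theta,\eta}(x)$ for all smooth $f$ (Leibniz rule and Faà di Bruno formula). *)

theory Defs
  imports "HOL-Analysis.Analysis" "HOL-Library.Function_Algebras"
begin

text \<open>The index type \<open>'d :: {finite, linorder}\<close> plays the role of \<open>{1, ..., d}\<close>: its linear order
  is needed for the order \<open>\<prec>\<close> on multi-indices. Multi-indices are elements of \<open>nat ^ 'd\<close>, so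
  addition, zero and the componentwise order \<open>\<le>\<close> are those of the type \<open>vec\<close>.\<close>

section \<open>Multi-indices\<close>

definition mabs :: "nat ^ 'd \<Rightarrow> nat" where
  "mabs \<alpha> = (\<Sum>i\<in>UNIV. \<alpha> $ i)"

definition mfact :: "nat ^ 'd \<Rightarrow> nat" where
  "mfact \<alpha> = (\<Prod>i\<in>UNIV. fact (\<alpha> $ i))"

definition mchoose :: "nat ^ 'd \<Rightarrow> nat ^ 'd \<Rightarrow> nat" where
  "mchoose \<alpha> \<beta> = (\<Prod>i\<in>UNIV. (\<alpha> $ i) choose (\<beta> $ i))"

definition mpow :: "real ^ 'd \<Rightarrow> nat ^ 'd \<Rightarrow> real" where
  "mpow x k = (\<Prod>i\<in>UNIV. (x $ i) ^ (k $ i))"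

definition mprec :: "nat ^ 'd::{finite,linorder} \<Rightarrow> nat ^ 'd::_ \<Rightarrow> bool" (infix "\<prec>" 50) where
  "\<alpha> \<prec> \<beta> \<longleftrightarrow> mabs \<alpha> < mabs \<beta> \<or>
     mabs \<alpha> = mabs \<beta> \<and> (\<exists>i. (\<forall>j<i. \<alpha> $ j = \<beta> $ j) \<and> \<alpha> $ i < \<beta> $ i)"


section \<open>Partial derivatives and smooth functions\<close>

definition pderiv_at :: "'d \<Rightarrow> (real ^ 'd \<Rightarrow> 'b::real_normed_vector) \<Rightarrow> real ^ 'd \<Rightarrow> 'b" where
  "pderiv_at i f x = vector_derivative (\<lambda>t. f (x + t *\<^sub>R axis i 1)) (at 0)"

text \<open>The iterated derivative is \<open>\<partial>\<^sub>1\<^bsup>\<alpha>\<^sub>1\<^esup> (\<dots> (\<partial>\<^sub>d\<^bsup>\<alpha>\<^sub>d\<^esup> f))\<close>; for smooth functions the order of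
  differentiation is irrelevant.\<close>

definition mderiv ::
  "nat ^ 'd::{finite,linorder} \<Rightarrow> (real ^ 'd::_ \<Rightarrow> 'b::real_normed_vector) \<Rightarrow> real ^ 'd::_ \<Rightarrow> 'b" where
  "mderiv \<alpha> f = foldr (\<lambda>i. pderiv_at i ^^ (\<alpha> $ i)) (sorted_list_of_set UNIV) f"

primrec C_k :: "nat \<Rightarrow> (real ^ 'd \<Rightarrow> 'b::real_normed_vector) \<Rightarrow> bool" where
  "C_k 0 f \<longleftrightarrow> continuous_on UNIV f"
| "C_k (Suc k) f \<longleftrightarrow> (\<forall>x. f differentiable (at x)) \<and> (\<forall>i. C_k k (pderiv_at i f))"

definition smooth :: "(real ^ 'd \<Rightarrow> 'b::real_normed_vector) \<Rightarrow> bool" where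
  "smooth f \<longleftrightarrow> (\<forall>k. C_k k f)"


section \<open>The Schwartz space\<close>

definition schwartz :: "(real ^ 'd::{finite,linorder} \<Rightarrow> complex) set" where
  "schwartz = {f. smooth f \<and>
     (\<forall>p>0. \<forall>\<alpha>. bdd_above (range (\<lambda>x. (1 + norm x) powr p * cmod (mderiv \<alpha> f x))))}"

definition schwartz_norm ::
  "real \<Rightarrow> nat ^ 'd::{finite,linorder} \<Rightarrow> (real ^ 'd::_ \<Rightarrow> complex) \<Rightarrow> real" where
  "schwartz_norm p \<alpha> f = (SUP x. (1 + norm x) powr p * cmod (mderiv \<alpha> f x))"

text \<open>The locally convex topology generated by the norms, with underlying set \<open>schwartz\<close>.\<close>

definition schwartz_topology :: "(real ^ 'd::{finite,linorder} \<Rightarrow> complex) topology" where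
  "schwartz_topology = topology_generated_by
     {{g \<in> schwartz. schwartz_norm p \<alpha> (g - f) < e} | f p \<alpha> e. f \<in> schwartz \<and> 0 < p \<and> 0 < e}"

definition fscale :: "complex \<Rightarrow> ('a \<Rightarrow> complex) \<Rightarrow> 'a \<Rightarrow> complex" where
  "fscale c f = (\<lambda>x. c * f x)"

lemma mderiv_zero [simp]:
  "mderiv \<alpha> (\<lambda>_. 0 :: 'b::real_normed_vector) = (\<lambda>_::real ^ 'd::{finite,linorder}. 0)"
proof -
  have 1: "pderiv_at i (\<lambda>_. 0 :: 'b) = (\<lambda>_. 0)" for i :: 'd
    by (simp add: pderiv_at_def fun_eq_iff)
  have 2: "(pderiv_at i ^^ n) (\<lambda>_. 0 :: 'b) = (\<lambda>_. 0)" for i :: 'd and n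
    by (induction n) (simp_all add: 1)
  have "foldr (\<lambda>i. pderiv_at i ^^ (\<alpha> $ i)) xs (\<lambda>_. 0 :: 'b) = (\<lambda>_. 0)" for xs
    by (induction xs) (simp_all add: 2)
  thus ?thesis by (simp add: mderiv_def)
qed

lemma topspace_schwartz_topology [simp]:
  "topspace (schwartz_topology :: (real ^ 'd::{finite,linorder} \<Rightarrow> complex) topology) = schwartz"
  unfolding schwartz_topology_def topology_generated_by_topspace
proof (intro equalityI subsetI)
  fix f :: "real ^ 'd::_ \<Rightarrow> complex"
  assume f: "f \<in> schwartz"
  have "f \<in> {g \<in> schwartz. schwartz_norm 1 0 (g - f) < 1}"
    using f by (simp add: schwartz_norm_def zero_fun_def)
  moreover have "\<exists>f' p \<alpha> e. {g \<in> schwartz. schwartz_norm 1 0 (g - f) < 1} =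
      {g \<in> schwartz. schwartz_norm p \<alpha> (g - f') < e} \<and> f' \<in> schwartz \<and> 0 < p \<and> 0 < e"
    by (rule exI[of _ f], rule exI[of _ 1], rule exI[of _ 0], rule exI[of _ 1]) (simp add: f)
  ultimately show "f \<in> \<Union> {{g \<in> schwartz. schwartz_norm p \<alpha> (g - f) < e} | f p \<alpha> e.
      f \<in> schwartz \<and> 0 < p \<and> 0 < e}"
    by (intro UnionI[OF CollectI])
qed auto


section \<open>Topologizable operators\<close>

text \<open>A complex locally convex space \<open>E\<close> is given by a topology \<open>X\<close> on a linear subspace
  \<open>topspace X\<close> of an ambient type, with scalar multiplication \<open>smul\<close>.\<close>

definition continuous_seminorm ::
  "(complex \<Rightarrow> 'v \<Rightarrow> 'v) \<Rightarrow> 'v::ab_group_add topology \<Rightarrow> ('v \<Rightarrow> real) \<Rightarrow> bool" where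
  "continuous_seminorm smul X r \<longleftrightarrow>
     (\<forall>x\<in>topspace X. 0 \<le> r x) \<and>
     (\<forall>x\<in>topspace X. \<forall>y\<in>topspace X. r (x + y) \<le> r x + r y) \<and>
     (\<forall>c. \<forall>x\<in>topspace X. r (smul c x) = cmod c * r x) \<and>
     continuous_map X euclideanreal r"

definition continuous_linear_operator ::
  "(complex \<Rightarrow> 'v \<Rightarrow> 'v) \<Rightarrow> 'v::ab_group_add topology \<Rightarrow> ('v \<Rightarrow> 'v) \<Rightarrow> bool" where
  "continuous_linear_operator smul X T \<longleftrightarrow>
     continuous_map X X T \<and>
     (\<forall>x\<in>topspace X. \<forall>y\<in>topspace X. T (x + y) = T x + T y) \<and>
     (\<forall>c. \<forall>x\<in>topspace X. T (smul c x) = smul c (T x))"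

definition topologizable ::
  "(complex \<Rightarrow> 'v \<Rightarrow> 'v) \<Rightarrow> 'v::ab_group_add topology \<Rightarrow> ('v \<Rightarrow> 'v) \<Rightarrow> bool" where
  "topologizable smul X T \<longleftrightarrow>
     continuous_linear_operator smul X T \<and>
     (\<forall>r. continuous_seminorm smul X r \<longrightarrow>
       (\<exists>s a. continuous_seminorm smul X s \<and> (\<forall>n\<ge>1. 0 < a n) \<and>
         (\<forall>n\<ge>1. \<forall>x\<in>topspace X. r (smul (complex_of_real (a n)) ((T ^^ n) x)) \<le> s x)))"

definition m_topologizable ::
  "(complex \<Rightarrow> 'v \<Rightarrow> 'v) \<Rightarrow> 'v::ab_group_add topology \<Rightarrow> ('v \<Rightarrow> 'v) \<Rightarrow> bool" where
  "m_topologizable smul X T \<longleftrightarrow>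
     continuous_linear_operator smul X T \<and>
     (\<forall>r. continuous_seminorm smul X r \<longrightarrow>
       (\<exists>s M. continuous_seminorm smul X s \<and> 0 < M \<and>
         (\<forall>n\<ge>1. \<forall>x\<in>topspace X. r (smul (complex_of_real (M ^ n)) ((T ^^ n) x)) \<le> s x)))"


section \<open>Weighted composition operators\<close>

definition wcomp :: "('a \<Rightarrow> complex) \<Rightarrow> ('a \<Rightarrow> 'a) \<Rightarrow> ('a \<Rightarrow> complex) \<Rightarrow> 'a \<Rightarrow> complex" where
  "wcomp \<psi> \<phi> f = (\<lambda>x. \<psi> x * f (\<phi> x))"

definition acts_on_schwartz ::
  "(real ^ 'd::{finite,linorder} \<Rightarrow> complex) \<Rightarrow> (real ^ 'd::_ \<Rightarrow> real ^ 'd::_) \<Rightarrow> bool" where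
  "acts_on_schwartz \<psi> \<phi> \<longleftrightarrow> (\<forall>f\<in>schwartz. wcomp \<psi> \<phi> f \<in> schwartz)"

definition iter_weight :: "('a \<Rightarrow> complex) \<Rightarrow> ('a \<Rightarrow> 'a) \<Rightarrow> nat \<Rightarrow> 'a \<Rightarrow> complex" where
  "iter_weight \<psi> \<phi> n x = (\<Prod>j=1..n. \<psi> ((\<phi> ^^ (j - 1)) x))"


section \<open>The coefficients in the formula of Faa di Bruno\<close>

text \<open>Tuples \<open>(k\<^sub>1, \<dots>, k\<^sub>m)\<close> with \<open>m = |\<beta>|\<close> are extensional functions on \<open>{1..m}\<close>. For \<open>m = 0\<close>
  the only such function is \<open>\<lambda>_. undefined\<close>, so the set for \<open>\<beta> = \<mu> = 0\<close> has one element.\<close>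

definition faa_indices ::
  "nat ^ 'd::{finite,linorder} \<Rightarrow> nat ^ 'd::_ \<Rightarrow> ((nat \<Rightarrow> nat ^ 'd::_) \<times> (nat \<Rightarrow> nat ^ 'd::_)) set" where
  "faa_indices \<beta> \<mu> =
     (if \<beta> = 0 then (if \<mu> = 0 then ({1..0} \<rightarrow>\<^sub>E UNIV) \<times> ({1..0} \<rightarrow>\<^sub>E UNIV) else {})
      else {(k, l). k \<in> {1..mabs \<beta>} \<rightarrow>\<^sub>E UNIV \<and> l \<in> {1..mabs \<beta>} \<rightarrow>\<^sub>E UNIV \<and>
        (\<exists>s\<in>{1..mabs \<beta>}.
           (\<forall>j\<in>{1..mabs \<beta> - s}. k j = 0 \<and> l j = 0) \<and>
           (\<forall>j\<in>{mabs \<beta> - s + 1..mabs \<beta>}. mabs (k j) > 0) \<and>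
           0 \<prec> l (mabs \<beta> - s + 1) \<and>
           (\<forall>j\<in>{mabs \<beta> - s + 1..<mabs \<beta>}. l j \<prec> l (j + 1))) \<and>
        (\<Sum>j=1..mabs \<beta>. k j) = \<mu> \<and>
        (\<Sum>j=1..mabs \<beta>. mabs (k j) *s l j) = \<beta>})"

definition faa_coeff ::
  "nat ^ 'd::{finite,linorder} \<Rightarrow> nat ^ 'd::_ \<Rightarrow> (real ^ 'd::_ \<Rightarrow> real ^ 'd::_) \<Rightarrow>
    (real ^ 'd::_ \<Rightarrow> complex) \<Rightarrow> real ^ 'd::_ \<Rightarrow> complex" where
  "faa_coeff \<alpha> \<mu> \<theta> \<eta> x =
     (\<Sum>\<beta> | \<beta> \<le> \<alpha> \<and> mabs \<mu> \<le> mabs \<beta>.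
        of_nat (mchoose \<alpha> \<beta>) * mderiv (\<alpha> - \<beta>) \<eta> x *
        complex_of_real (\<Sum>(k, l)\<in>faa_indices \<beta> \<mu>.
          real (mfact \<beta>) *
          (\<Prod>j=1..mabs \<beta>. mpow (\<chi> i. mderiv (l j) (\<lambda>y. \<theta> y $ i) x) (k j) /
             (real (mfact (k j)) * real (mfact (l j)) ^ mabs (k j)))))"

end

theory Submission
  imports Defs "HOL-Computational_Algebra.Polynomial"
begin

text \<open>
  The formula \<open>(\<eta> \<cdot> (f \<circ> \<theta>))\<^sup>(\<^sup>\<alpha>\<^sup>) = \<Sum>\<^sub>\<mu> f\<^sup>(\<^sup>\<mu>\<^sup>)(\<theta>) F\<^sub>\<alpha>\<^sub>,\<^sub>\<mu>\<close> only involves jets at one point, so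
  \<open>f\<close>, \<open>\<theta>\<close> and \<open>\<eta>\<close> may be replaced by Taylor polynomials; for these it is the multinomial theorem. Applied to the
  iterates \<open>\<phi>\<^sub>n\<close> and their weights, it turns the bounds on the coefficients into bounds
  \<open>\<parallel>T\<^sup>n f\<parallel> \<le> a\<^sub>n \<Sum> \<parallel>f\<parallel>\<close> between Schwartz norms. Conversely, applying topologizability to Schwartz functions
  whose jet at \<open>\<phi>\<^sub>n(x)\<close> is concentrated in one multi-index \<open>\<mu>\<close> isolates a single coefficient; as these functions
  (a polynomial times a Gaussian) are translates of one function, their norms grow polynomially in the base point.
\<close>

section \<open>Calculus of partial derivatives\<close>

text \<open>The Faa di Bruno coefficients never have to be carried through an induction on \<alpha>:
  a derivative of a polynomial at its centre reads off one coefficient, and the only analytic input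
  is that the jet of a product or a composition is determined by the jets of its constituents. The
  remaining difficulty is combinatorial. Expanding a composed polynomial produces maps
  \<open>K\<close> from multi-indices to multi-indices, whereas \<open>faa_indices\<close> consists
  of ordered, zero-padded tuples; identifying the two takes the linear order \<open>\<prec>\<close>.
  In the converse direction the base point varies with n and x, but q has to serve all n. So the
  shape of the test function may depend on \<alpha> and \<mu> only, and q comes from the seminorm
  that topologizability provides. The Gaussian factor is convenient because differentiation acts on
  the polynomial factor alone, and prescribing a jet becomes a triangular linear system. About rates
  of growth only three things are used: they are positive, two of them have a common upper bound,
  and constant factors can be absorbed. This is why (A) and (B) have one proof.\<close>

lemma pderiv_at_eq:
  fixes f :: "real ^ 'd \<Rightarrow> 'b::real_normed_vector"
  assumes "(f has_derivative f') (at x)"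
  shows "pderiv_at i f x = f' (axis i 1)"
proof -
  have "((\<lambda>t. x + t *\<^sub>R axis i 1) has_derivative (\<lambda>t. t *\<^sub>R axis i 1)) (at (0::real))"
    by (auto intro!: derivative_eq_intros)
  moreover have "(f has_derivative f') (at (x + 0 *\<^sub>R axis i 1))"
    using assms by simp
  ultimately have "((\<lambda>t. f (x + t *\<^sub>R axis i 1)) has_derivative (\<lambda>t. f' (t *\<^sub>R axis i 1))) (at 0)"
    by (rule has_derivative_compose)
  moreover have "f' (t *\<^sub>R axis i 1) = t *\<^sub>R f' (axis i 1)" for t
    using assms has_derivative_bounded_linear bounded_linear.linear linear_scale by blast
  ultimately show ?thesis
    unfolding pderiv_at_def by (intro vector_derivative_at) (simp add: has_vector_derivative_def)
qed

lemma sum_axis_scaleR: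
  fixes v :: "'d::finite \<Rightarrow> 'b::real_normed_vector"
  shows "(\<Sum>j\<in>UNIV. (axis i (1::real) $ j) *\<^sub>R v j) = v i"
proof -
  have "(\<Sum>j\<in>UNIV. (axis i (1::real) $ j) *\<^sub>R v j) = (\<Sum>j\<in>UNIV. if j = i then v j else 0)"
    by (intro sum.cong) (auto simp: axis_def)
  then show ?thesis by simp
qed

text \<open>The rules for \<open>pderiv_at\<close> below come from writing a total derivative in
  this explicit form and evaluating it at \<open>axis i 1\<close>.\<close>

lemma has_derivative_pderiv_at:
  fixes f :: "real ^ 'd \<Rightarrow> 'b::real_normed_vector"
  assumes "f differentiable (at x)"
  shows "(f has_derivative (\<lambda>h. \<Sum>i\<in>UNIV. (h $ i) *\<^sub>R pderiv_at i f x)) (at x)"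
proof -
  obtain f' where f': "(f has_derivative f') (at x)"
    using assms by (auto simp: differentiable_def)
  then have lin: "linear f'"
    using has_derivative_bounded_linear bounded_linear.linear by blast
  have "f' h = (\<Sum>i\<in>UNIV. (h $ i) *\<^sub>R pderiv_at i f x)" for h
  proof -
    have "h = (\<Sum>i\<in>UNIV. (h $ i) *\<^sub>R axis i 1)"
      using basis_expansion[of h] by (simp add: scalar_mult_eq_scaleR)
    then have "f' h = f' (\<Sum>i\<in>UNIV. (h $ i) *\<^sub>R axis i 1)" by simp
    then show ?thesis
      by (simp add: linear_sum[OF lin] linear_scale[OF lin] pderiv_at_eq[OF f'])
  qed
  then have "f' = (\<lambda>h. \<Sum>i\<in>UNIV. (h $ i) *\<^sub>R pderiv_at i f x)" by blast
  with f' show ?thesis by simp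
qed

lemma has_vector_derivative_pderiv_at:
  fixes f :: "real ^ 'd \<Rightarrow> 'b::real_normed_vector"
  assumes "f differentiable (at (x + t *\<^sub>R axis i 1))"
  shows "((\<lambda>t. f (x + t *\<^sub>R axis i 1)) has_vector_derivative pderiv_at i f (x + t *\<^sub>R axis i 1)) (at t within S)"
proof -
  have "((\<lambda>t. x + t *\<^sub>R axis i 1) has_derivative (\<lambda>t. t *\<^sub>R axis i 1)) (at t within S)"
    by (auto intro!: derivative_eq_intros)
  from has_derivative_compose[OF this has_derivative_pderiv_at[OF assms]]
  show ?thesis
    by (simp add: has_vector_derivative_def sum_axis_scaleR flip: scaleR_scaleR scaleR_sum_right)
qed

section \<open>Symmetry of second partial derivatives\<close>

lemma increment_linearization:
  fixes g :: "real \<Rightarrow> 'b::real_normed_vector"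
  assumes "\<And>t. t \<in> {0..h} \<Longrightarrow> (g has_vector_derivative g' t) (at t within {0..h})"
    and "\<And>t. t \<in> {0..h} \<Longrightarrow> norm (g' t - L) \<le> B" and "0 \<le> h"
  shows "norm (g h - g 0 - h *\<^sub>R L) \<le> B * h"
proof -
  \<comment> \<open>Mean value inequality for \<open>g t - t *\<^sub>R L\<close>, whose derivative
    is bounded by \<open>B\<close>.\<close>
  have "norm ((g h - h *\<^sub>R L) - (g 0 - 0 *\<^sub>R L)) \<le> B * norm (h - 0)"
  proof (rule differentiable_bound[where S = "{0..h}" and f' = "\<lambda>t k. k *\<^sub>R (g' t - L)"])
    fix t assume t: "t \<in> {0..h}"
    show "((\<lambda>t. g t - t *\<^sub>R L) has_derivative (\<lambda>k. k *\<^sub>R (g' t - L))) (at t within {0..h})"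
      using assms(1)[OF t] unfolding has_vector_derivative_def
      by (auto intro!: derivative_eq_intros simp: algebra_simps)
    show "onorm (\<lambda>k. k *\<^sub>R (g' t - L)) \<le> B"
      using assms(2)[OF t] by (intro onorm_le) (simp add: mult.commute[of B] mult_left_mono)
  qed (use assms in auto)
  then show ?thesis using assms(3) by (simp add: algebra_simps)
qed

text \<open>The mean value estimate is used twice: in direction \<open>j\<close> for
  \<open>pderiv_at i f\<close>, then in direction \<open>i\<close> for the difference of
  \<open>f\<close> along \<open>h *\<^sub>R axis j 1\<close>. Only one order of differentiation
  occurs, while the double difference itself is symmetric in \<open>i\<close> and
  \<open>j\<close>.\<close>

lemma mixed_difference_bound:
  fixes f :: "real ^ 'd \<Rightarrow> 'b::real_normed_vector"
  assumes f: "\<And>y. f differentiable (at y)" and fi: "\<And>y. pderiv_at i f differentiable (at y)"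
    and cont: "continuous (at x) (pderiv_at j (pderiv_at i f))" and "0 < e"
  shows "\<exists>d>0. \<forall>h. 0 < h \<and> h < d \<longrightarrow>
    norm (f (x + h *\<^sub>R axis i 1 + h *\<^sub>R axis j 1) - f (x + h *\<^sub>R axis i 1) - f (x + h *\<^sub>R axis j 1) + f x
      - (h * h) *\<^sub>R pderiv_at j (pderiv_at i f) x) \<le> e * (h * h)"
proof -
  define L where "L = pderiv_at j (pderiv_at i f) x"
  obtain d where d: "0 < d" "\<And>y. dist y x < d \<Longrightarrow> dist (pderiv_at j (pderiv_at i f) y) L < e"
    using cont \<open>0 < e\<close> unfolding continuous_at_eps_delta L_def by blast
  \<comment> \<open>Both increments are at most \<open>h\<close>, so \<open>h < d / 2\<close> keeps
    all intermediate points within \<open>d\<close> of \<open>x\<close>.\<close>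
  have "norm (f (x + h *\<^sub>R axis i 1 + h *\<^sub>R axis j 1) - f (x + h *\<^sub>R axis i 1) - f (x + h *\<^sub>R axis j 1) + f x
      - (h * h) *\<^sub>R L) \<le> e * (h * h)" if h: "0 < h" "h < d / 2" for h
  proof -
    have inner: "norm (pderiv_at i f (x + s *\<^sub>R axis i 1 + h *\<^sub>R axis j 1) - pderiv_at i f (x + s *\<^sub>R axis i 1)
        - h *\<^sub>R L) \<le> e * h" if s: "s \<in> {0..h}" for s
    proof -
      have "norm (pderiv_at i f (x + s *\<^sub>R axis i 1 + h *\<^sub>R axis j 1)
          - pderiv_at i f (x + s *\<^sub>R axis i 1 + 0 *\<^sub>R axis j 1) - h *\<^sub>R L) \<le> e * h"
      proof (rule increment_linearization[OF has_vector_derivative_pderiv_at[OF fi]])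
        fix t assume t: "t \<in> {0..h}"
        have "norm (s *\<^sub>R axis i (1::real) + t *\<^sub>R axis j 1) \<le> s + t"
          using norm_triangle_ineq[of "s *\<^sub>R axis i (1::real)" "t *\<^sub>R axis j 1"] s t by simp
        also have "\<dots> < d" using s t h by auto
        finally have "dist (x + s *\<^sub>R axis i 1 + t *\<^sub>R axis j 1) x < d"
          by (simp add: dist_norm algebra_simps)
        from d(2)[OF this]
        show "norm (pderiv_at j (pderiv_at i f) (x + s *\<^sub>R axis i 1 + t *\<^sub>R axis j 1) - L) \<le> e"
          by (simp add: dist_norm)
      qed (use h in auto)
      then show ?thesis by simp
    qed
    have "norm ((f (x + h *\<^sub>R axis j 1 + h *\<^sub>R axis i 1) - f (x + h *\<^sub>R axis i 1))
        - (f (x + h *\<^sub>R axis j 1 + 0 *\<^sub>R axis i 1) - f (x + 0 *\<^sub>R axis i 1)) - h *\<^sub>R (h *\<^sub>R L)) \<le> e * h * h"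
      by (rule increment_linearization[where g = "\<lambda>s. f (x + h *\<^sub>R axis j 1 + s *\<^sub>R axis i 1) - f (x + s *\<^sub>R axis i 1)",
            OF has_vector_derivative_diff[OF has_vector_derivative_pderiv_at[OF f] has_vector_derivative_pderiv_at[OF f]]])
        (use h inner in \<open>auto simp: add.commute add.left_commute\<close>)
    then show ?thesis by (simp add: algebra_simps)
  qed
  with d(1) show ?thesis unfolding L_def
    by (intro exI[of _ "d/2"]) auto
qed

text \<open>The double difference is the same for both orders; divided by \<open>h * h\<close>, it
  is within \<open>e / 2\<close> of each of the two mixed derivatives.\<close>

lemma pderiv_at_commute_at:
  fixes f :: "real ^ 'd \<Rightarrow> 'b::real_normed_vector"
  assumes f: "\<And>y. f differentiable (at y)" and fi: "\<And>i y. pderiv_at i f differentiable (at y)"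
    and cont: "\<And>i j. continuous (at x) (pderiv_at j (pderiv_at i f))"
  shows "pderiv_at i (pderiv_at j f) x = pderiv_at j (pderiv_at i f) x"
proof -
  let ?L = "pderiv_at j (pderiv_at i f) x" and ?M = "pderiv_at i (pderiv_at j f) x"
  have "norm (?M - ?L) \<le> e" if e: "0 < e" for e
  proof -
    obtain d1 where d1: "d1 > 0" "\<And>h. 0 < h \<and> h < d1 \<Longrightarrow>
      norm (f (x + h *\<^sub>R axis i 1 + h *\<^sub>R axis j 1) - f (x + h *\<^sub>R axis i 1) - f (x + h *\<^sub>R axis j 1) + f x
      - (h * h) *\<^sub>R ?L) \<le> e / 2 * (h * h)"
      using mixed_difference_bound[OF f fi cont, of "e / 2"] e by (meson half_gt_zero)
    obtain d2 where d2: "d2 > 0" "\<And>h. 0 < h \<and> h < d2 \<Longrightarrow>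
      norm (f (x + h *\<^sub>R axis j 1 + h *\<^sub>R axis i 1) - f (x + h *\<^sub>R axis j 1) - f (x + h *\<^sub>R axis i 1) + f x
      - (h * h) *\<^sub>R ?M) \<le> e / 2 * (h * h)"
      using mixed_difference_bound[OF f fi cont, of "e / 2"] e by (meson half_gt_zero)
    define h where "h = min d1 d2 / 2"
    have h: "0 < h" "h < d1" "h < d2" using d1(1) d2(1) by (auto simp: h_def)
    define D where "D = f (x + h *\<^sub>R axis i 1 + h *\<^sub>R axis j 1) - f (x + h *\<^sub>R axis i 1) - f (x + h *\<^sub>R axis j 1) + f x"
    have 1: "norm (D - (h * h) *\<^sub>R ?L) \<le> e / 2 * (h * h)"
      using d1(2) h by (simp add: D_def)
    have 2: "norm (D - (h * h) *\<^sub>R ?M) \<le> e / 2 * (h * h)"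
    proof -
      have "D = f (x + h *\<^sub>R axis j 1 + h *\<^sub>R axis i 1) - f (x + h *\<^sub>R axis j 1) - f (x + h *\<^sub>R axis i 1) + f x"
        by (simp add: D_def add_ac)
      then show ?thesis using d2(2)[of h] h by simp
    qed
    have "(h * h) * norm (?M - ?L) = norm ((h * h) *\<^sub>R (?M - ?L))"
      by simp
    also have "(h * h) *\<^sub>R (?M - ?L) = (D - (h * h) *\<^sub>R ?L) - (D - (h * h) *\<^sub>R ?M)"
      by (simp add: algebra_simps)
    also have "norm \<dots> \<le> e / 2 * (h * h) + e / 2 * (h * h)"
      using norm_triangle_ineq4 1 2 by (meson add_mono order_trans)
    also have "\<dots> = (h * h) * e" by simp
    finally show ?thesis using h by (simp add: mult_le_cancel_left)
  qed
  then have "norm (?M - ?L) \<le> 0" by (metis add_0 field_le_epsilon)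
  then show ?thesis by simp
qed

section \<open>Functions of class \<open>C_k\<close> and smooth functions\<close>

lemma C_k_imp_continuous: "C_k k f \<Longrightarrow> continuous_on UNIV f"
  by (cases k) (simp_all add: differentiable_imp_continuous_within continuous_on_eq_continuous_at)

lemma C_k_Suc_imp: "C_k (Suc k) f \<Longrightarrow> C_k k f"
proof (induction k arbitrary: f)
  case 0
  then show ?case using C_k_imp_continuous[OF 0] by simp
next
  case (Suc k)
  have "C_k k (pderiv_at i f)" for i
    using Suc.prems by (intro Suc.IH) simp
  then show ?case using Suc.prems by simp
qed

text \<open>Removes the order \<open>k\<close>: \<open>smooth\<close> becomes a class closed under
  \<open>pderiv_at\<close>, so later inductions over multi-indices or jet orders keep the same
  smoothness hypothesis at every stage.\<close>

lemma smooth_iff: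
  "smooth f \<longleftrightarrow> (\<forall>x. f differentiable (at x)) \<and> (\<forall>i. smooth (pderiv_at i f))"
proof
  assume "smooth f"
  then have "C_k (Suc k) f" for k by (simp add: smooth_def)
  then show "(\<forall>x. f differentiable (at x)) \<and> (\<forall>i. smooth (pderiv_at i f))"
    by (simp add: smooth_def)
next
  assume "(\<forall>x. f differentiable (at x)) \<and> (\<forall>i. smooth (pderiv_at i f))"
  then have "C_k (Suc k) f" for k by (simp add: smooth_def)
  then show "smooth f" unfolding smooth_def using C_k_Suc_imp by blast
qed

lemma smooth_differentiable: "smooth f \<Longrightarrow> f differentiable (at x)"
  using smooth_iff by blast

lemma smooth_pderiv_at: "smooth f \<Longrightarrow> smooth (pderiv_at i f)"
  using smooth_iff by blast

lemma pderiv_at_commute: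
  fixes f :: "real ^ 'd \<Rightarrow> 'b::real_normed_vector"
  assumes "smooth f"
  shows "pderiv_at i (pderiv_at j f) = pderiv_at j (pderiv_at i f)"
proof
  fix x
  have "smooth (pderiv_at i (pderiv_at j f))" for i j using assms by (intro smooth_pderiv_at)
  then show "pderiv_at i (pderiv_at j f) x = pderiv_at j (pderiv_at i f) x"
    by (intro pderiv_at_commute_at smooth_differentiable smooth_pderiv_at assms
        differentiable_imp_continuous_within)
qed

lemma pderiv_at_const: "pderiv_at i (\<lambda>_. c) = (\<lambda>_. 0)"
  by (simp add: pderiv_at_def fun_eq_iff)

lemma C_k_const: "C_k k (\<lambda>_. c)"
  by (induction k arbitrary: c) (auto simp: pderiv_at_const)

lemma smooth_const: "smooth (\<lambda>_. c)"
  by (simp add: smooth_def C_k_const)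

lemma pderiv_at_add:
  assumes "f differentiable (at x)" "g differentiable (at x)"
  shows "pderiv_at i (\<lambda>x. f x + g x) x = pderiv_at i f x + pderiv_at i g x"
  using pderiv_at_eq[OF has_derivative_add[OF has_derivative_pderiv_at[OF assms(1)] has_derivative_pderiv_at[OF assms(2)]], of i]
  by (simp add: sum_axis_scaleR)

lemma pderiv_at_diff:
  assumes "f differentiable (at x)" "g differentiable (at x)"
  shows "pderiv_at i (\<lambda>x. f x - g x) x = pderiv_at i f x - pderiv_at i g x"
  using pderiv_at_eq[OF has_derivative_diff[OF has_derivative_pderiv_at[OF assms(1)] has_derivative_pderiv_at[OF assms(2)]], of i]
  by (simp add: sum_axis_scaleR)

lemma pderiv_at_bilinear:
  assumes "bounded_bilinear mul" "f differentiable (at x)" "g differentiable (at x)"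
  shows "pderiv_at i (\<lambda>x. mul (f x) (g x)) x = mul (f x) (pderiv_at i g x) + mul (pderiv_at i f x) (g x)"
  using pderiv_at_eq[OF bounded_bilinear.FDERIV[OF assms(1) has_derivative_pderiv_at[OF assms(2)] has_derivative_pderiv_at[OF assms(3)]], of i]
  by (simp add: sum_axis_scaleR)

lemma pderiv_at_linear:
  assumes "bounded_linear L" "f differentiable (at x)"
  shows "pderiv_at i (\<lambda>x. L (f x)) x = L (pderiv_at i f x)"
  using pderiv_at_eq[OF bounded_linear.has_derivative[OF assms(1) has_derivative_pderiv_at[OF assms(2)]], of i]
  by (simp add: sum_axis_scaleR)

lemma C_k_add: "C_k k f \<Longrightarrow> C_k k g \<Longrightarrow> C_k k (\<lambda>x. f x + g x)"
proof (induction k arbitrary: f g)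
  case (Suc k)
  then have "pderiv_at i (\<lambda>x. f x + g x) = (\<lambda>x. pderiv_at i f x + pderiv_at i g x)" for i
    by (intro ext pderiv_at_add) auto
  with Suc show ?case by (simp add: differentiable_add)
qed (simp add: continuous_on_add)

lemma C_k_sum: "(\<And>i. i \<in> I \<Longrightarrow> C_k k (f i)) \<Longrightarrow> C_k k (\<lambda>x. \<Sum>i\<in>I. f i x)"
  by (induction I rule: infinite_finite_induct) (auto simp: C_k_const C_k_add)

lemma C_k_linear: "bounded_linear L \<Longrightarrow> C_k k f \<Longrightarrow> C_k k (\<lambda>x. L (f x))"
proof (induction k arbitrary: f)
  case 0
  then show ?case by (auto intro: bounded_linear.continuous_on)
next
  case (Suc k)
  then have "pderiv_at i (\<lambda>x. L (f x)) = (\<lambda>x. L (pderiv_at i f x))" for i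
    by (intro ext pderiv_at_linear) auto
  moreover have "(\<lambda>x. L (f x)) differentiable (at x)" for x
    using bounded_linear.has_derivative[OF Suc.prems(1) has_derivative_pderiv_at[of f x]] Suc.prems(2)
    by (auto simp: differentiable_def)
  ultimately show ?case using Suc by auto
qed

lemma bilinear_differentiable:
  assumes "bounded_bilinear mul" "f differentiable (at x)" "g differentiable (at x)"
  shows "(\<lambda>x. mul (f x) (g x)) differentiable (at x)"
  using bounded_bilinear.FDERIV[OF assms(1)] assms(2,3) unfolding differentiable_def by blast

lemma C_k_bilinear: 
  assumes "bounded_bilinear mul"
  shows "C_k k f \<Longrightarrow> C_k k g \<Longrightarrow> C_k k (\<lambda>x. mul (f x) (g x))"
proof (induction k arbitrary: f g)
  case 0
  then show ?case by (auto intro: bounded_bilinear.continuous_on[OF assms])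
next
  case (Suc k)
  then have "pderiv_at i (\<lambda>x. mul (f x) (g x)) = (\<lambda>x. mul (f x) (pderiv_at i g x) + mul (pderiv_at i f x) (g x))" for i
    by (intro ext pderiv_at_bilinear assms) auto
  moreover have "C_k k f" "C_k k g" using Suc.prems C_k_Suc_imp by blast+
  ultimately show ?case using Suc by (auto intro!: C_k_add bilinear_differentiable[OF assms])
qed

text \<open>Phrased through the real-valued components because \<open>faa_coeff\<close>
  differentiates the components of the map.\<close>

lemma has_derivative_componentwise:
  fixes \<theta> :: "real ^ 'e \<Rightarrow> real ^ 'd"
  assumes "\<And>j. (\<lambda>y. \<theta> y $ j) differentiable (at x)"
  shows "(\<theta> has_derivative (\<lambda>h. \<Sum>i\<in>UNIV. (h $ i) *\<^sub>R (\<chi> j. pderiv_at i (\<lambda>y. \<theta> y $ j) x))) (at x)"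
proof (subst has_derivative_componentwise_within, rule ballI)
  fix b :: "real ^ 'd" assume "b \<in> Basis"
  then obtain j where b: "b = axis j 1" by (auto simp: Basis_vec_def)
  show "((\<lambda>x. \<theta> x \<bullet> b) has_derivative (\<lambda>h. (\<Sum>i\<in>UNIV. (h $ i) *\<^sub>R (\<chi> j. pderiv_at i (\<lambda>y. \<theta> y $ j) x)) \<bullet> b)) (at x)"
    using has_derivative_pderiv_at[OF assms[of j]] by (simp add: b inner_axis)
qed

lemma pderiv_at_compose:
  fixes \<theta> :: "real ^ 'e \<Rightarrow> real ^ 'd"
  assumes "f differentiable (at (\<theta> x))" "\<And>j. (\<lambda>y. \<theta> y $ j) differentiable (at x)"
  shows "pderiv_at i (\<lambda>x. f (\<theta> x)) x = (\<Sum>j\<in>UNIV. pderiv_at i (\<lambda>y. \<theta> y $ j) x *\<^sub>R pderiv_at j f (\<theta> x))"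
  using pderiv_at_eq[OF has_derivative_compose[OF has_derivative_componentwise[OF assms(2)] has_derivative_pderiv_at[OF assms(1)]], of i]
  by (simp add: sum_axis_scaleR)

lemma C_k_compose:
  fixes \<theta> :: "real ^ 'e \<Rightarrow> real ^ 'd"
  shows "C_k k f \<Longrightarrow> (\<And>j. C_k k (\<lambda>y. \<theta> y $ j)) \<Longrightarrow> C_k k (\<lambda>x. f (\<theta> x))"
proof (induction k arbitrary: f)
  case 0
  then have "continuous_on UNIV \<theta>" using continuous_on_vec_lambda[of UNIV "\<lambda>j y. \<theta> y $ j"] by simp
  with 0 show ?case using continuous_on_compose2 by fastforce
next
  case (Suc k)
  then have "pderiv_at i (\<lambda>x. f (\<theta> x)) = (\<lambda>x. \<Sum>j\<in>UNIV. pderiv_at i (\<lambda>y. \<theta> y $ j) x *\<^sub>R pderiv_at j f (\<theta> x))" for i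
    by (intro ext pderiv_at_compose) auto
  moreover have "(\<lambda>x. f (\<theta> x)) differentiable (at x)" for x
  proof -
    have "f differentiable (at (\<theta> x))" "\<And>j. (\<lambda>y. \<theta> y $ j) differentiable (at x)" using Suc.prems by auto
    then show ?thesis
      using has_derivative_compose[OF has_derivative_componentwise has_derivative_pderiv_at]
      unfolding differentiable_def by fast
  qed
  ultimately show ?case
    using Suc C_k_Suc_imp[OF Suc.prems(2)]
    by (auto intro!: C_k_sum C_k_bilinear[OF bounded_bilinear_scaleR])
qed

lemma smooth_add: "smooth f \<Longrightarrow> smooth g \<Longrightarrow> smooth (\<lambda>x. f x + g x)"
  by (simp add: smooth_def C_k_add)

lemma smooth_sum: "(\<And>i. i \<in> I \<Longrightarrow> smooth (f i)) \<Longrightarrow> smooth (\<lambda>x. \<Sum>i\<in>I. f i x)"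
  by (simp add: smooth_def C_k_sum)

lemma smooth_linear: "bounded_linear L \<Longrightarrow> smooth f \<Longrightarrow> smooth (\<lambda>x. L (f x))"
  by (simp add: smooth_def C_k_linear)

lemma smooth_bilinear: "bounded_bilinear mul \<Longrightarrow> smooth f \<Longrightarrow> smooth g \<Longrightarrow> smooth (\<lambda>x. mul (f x) (g x))"
  by (simp add: smooth_def C_k_bilinear)

lemma smooth_diff: "smooth f \<Longrightarrow> smooth g \<Longrightarrow> smooth (\<lambda>x. f x - g x)"
  using smooth_add[of f "\<lambda>x. - g x"] smooth_linear[of uminus g] by (simp add: bounded_linear_minus[OF bounded_linear_ident])

lemma smooth_nth: "smooth f \<Longrightarrow> smooth (\<lambda>x. f x $ j)"
  by (rule smooth_linear[OF bounded_linear_vec_nth])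

lemma smooth_compose:
  fixes \<theta> :: "real ^ 'e \<Rightarrow> real ^ 'd"
  shows "smooth f \<Longrightarrow> (\<And>j. smooth (\<lambda>y. \<theta> y $ j)) \<Longrightarrow> smooth (\<lambda>x. f (\<theta> x))"
  by (simp add: smooth_def C_k_compose)

section \<open>Multi-indices and jets\<close>

lemma mabs_0 [simp]: "mabs 0 = 0"
  by (simp add: mabs_def)

lemma mabs_add [simp]: "mabs (\<alpha> + \<beta>) = mabs \<alpha> + mabs \<beta>"
  by (simp add: mabs_def sum.distrib)

lemma mabs_axis [simp]: "mabs (axis i n) = n"
  by (simp add: mabs_def axis_def)

lemma mabs_eq_0_iff [simp]: "mabs \<alpha> = 0 \<longleftrightarrow> \<alpha> = 0"
  by (auto simp: mabs_def vec_eq_iff)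

lemma mabs_sum: "mabs (\<Sum>i\<in>I. f i) = (\<Sum>i\<in>I. mabs (f i))"
  by (induction I rule: infinite_finite_induct) auto

lemma nth_le_mabs: "\<alpha> $ i \<le> mabs \<alpha>"
  unfolding mabs_def by (rule member_le_sum) auto

lemma finite_vec_bounded: "finite {\<alpha> :: nat ^ 'd. \<forall>i. \<alpha> $ i \<le> N i}"
proof -
  have "{\<alpha> :: nat ^ 'd. \<forall>i. \<alpha> $ i \<le> N i} \<subseteq> vec_lambda ` (UNIV \<rightarrow>\<^sub>E {..Max (range N)})"
  proof
    fix \<alpha> :: "nat ^ 'd" assume *: "\<alpha> \<in> {\<alpha>. \<forall>i. \<alpha> $ i \<le> N i}"
    have "\<alpha> $ i \<le> Max (range N)" for i
      using * by (auto intro: order_trans[OF _ Max_ge])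
    then have "vec_nth \<alpha> \<in> (UNIV \<rightarrow>\<^sub>E {..Max (range N)})" by auto
    then show "\<alpha> \<in> vec_lambda ` (UNIV \<rightarrow>\<^sub>E {..Max (range N)})"
      by (metis image_eqI vec_nth_inverse)
  qed
  then show ?thesis by (rule finite_subset) (intro finite_imageI finite_PiE; simp)
qed

lemma finite_mabs_le [simp, intro]: "finite {\<alpha> :: nat ^ 'd. mabs \<alpha> \<le> N}"
  by (rule finite_subset[OF _ finite_vec_bounded[of "\<lambda>_. N"]]) (auto intro: order_trans[OF nth_le_mabs])

lemma finite_le_mindex [simp, intro]: "finite {\<alpha> :: nat ^ 'd. \<alpha> \<le> \<beta>}"
  by (rule finite_subset[OF _ finite_vec_bounded[of "\<lambda>i. \<beta> $ i"]]) (auto simp: less_eq_vec_def)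

text \<open>Adding a single unit corresponds to one further partial derivative, the recursion that
  \<open>mderiv_add_axis\<close> supplies.\<close>

lemma mindex_induct [case_names zero step]:
  fixes \<alpha> :: "nat ^ 'd"
  assumes "P 0" "\<And>\<gamma> i. P \<gamma> \<Longrightarrow> P (\<gamma> + axis i (Suc 0))"
  shows "P \<alpha>"
proof (induction "mabs \<alpha>" arbitrary: \<alpha>)
  case 0
  then have "\<alpha> = 0" by (metis mabs_eq_0_iff)
  then show ?case using assms(1) by simp
next
  case (Suc n)
  then have "\<alpha> \<noteq> 0" by auto
  then obtain i where "\<alpha> $ i \<noteq> 0" by (auto simp: vec_eq_iff)
  then have eq: "\<alpha> = (\<alpha> - axis i (Suc 0)) + axis i (Suc 0)"
    by (auto simp: vec_eq_iff axis_def)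
  then have "mabs \<alpha> = mabs (\<alpha> - axis i (Suc 0)) + Suc 0" by (metis mabs_add mabs_axis)
  with Suc have "P (\<alpha> - axis i (Suc 0))" by simp
  then show ?case using assms(2) eq by metis
qed

lemma mfact_pos: "mfact \<alpha> > 0"
  by (simp add: mfact_def prod_pos)

lemma mfact_nonzero [simp]: "mfact \<alpha> \<noteq> 0"
  using mfact_pos[of \<alpha>] by simp

lemma mpow_add: "mpow x (\<alpha> + \<beta>) = mpow x \<alpha> * mpow x \<beta>"
  by (simp add: mpow_def power_add prod.distrib)

lemma mpow_zero [simp]: "mpow x 0 = 1"
  by (simp add: mpow_def)

lemma mpow_scaleR: "mpow (c *\<^sub>R x) k = c ^ mabs k * mpow x k"
  by (simp add: mpow_def mabs_def power_mult_distrib prod.distrib power_sum)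

lemma mpow_sum: "mpow x (\<Sum>i\<in>I. f i) = (\<Prod>i\<in>I. mpow x (f i))"
  by (induction I rule: infinite_finite_induct) (auto simp: mpow_add)

lemma mpow_smult: "mpow x (n *s \<alpha>) = mpow x \<alpha> ^ n"
  by (simp add: mpow_def prod_power_distrib mult.commute flip: power_mult)

text \<open>The jet of order \<open>N\<close> of \<open>f\<close> at \<open>x\<close> is zero.
  Recursion on first partial derivatives lets the product and chain rules be applied once per step;
  \<open>vanish_iff_mderiv\<close> connects this with the iterated derivatives.\<close>

primrec vanish :: "nat \<Rightarrow> (real ^ 'd \<Rightarrow> 'b::real_normed_vector) \<Rightarrow> real ^ 'd \<Rightarrow> bool" where
  "vanish 0 f x \<longleftrightarrow> f x = 0"
| "vanish (Suc N) f x \<longleftrightarrow> f x = 0 \<and> (\<forall>i. vanish N (pderiv_at i f) x)"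

lemma vanish_at: "vanish N f x \<Longrightarrow> f x = 0"
  by (cases N) auto

lemma vanish_Suc_imp: "vanish (Suc N) f x \<Longrightarrow> vanish N f x"
proof (induction N arbitrary: f)
  case (Suc N)
  then have "vanish N (pderiv_at i f) x" for i by (metis vanish.simps(2))
  then show ?case using Suc.prems by simp
qed auto

lemma vanish_zero: "vanish N (\<lambda>_. 0) x"
  by (induction N) (auto simp: pderiv_at_const)

lemma vanish_add:
  "smooth f \<Longrightarrow> smooth g \<Longrightarrow> vanish N f x \<Longrightarrow> vanish N g x \<Longrightarrow> vanish N (\<lambda>y. f y + g y) x"
proof (induction N arbitrary: f g)
  case (Suc N)
  have "pderiv_at i (\<lambda>y. f y + g y) = (\<lambda>y. pderiv_at i f y + pderiv_at i g y)" for i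
    by (intro ext pderiv_at_add smooth_differentiable Suc)
  then show ?case using Suc.prems by (auto intro!: Suc.IH smooth_pderiv_at)
qed auto

lemma vanish_sum:
  "(\<And>i. i \<in> I \<Longrightarrow> smooth (f i)) \<Longrightarrow> (\<And>i. i \<in> I \<Longrightarrow> vanish N (f i) x) \<Longrightarrow> vanish N (\<lambda>y. \<Sum>i\<in>I. f i y) x"
  by (induction I rule: infinite_finite_induct) (auto simp: vanish_zero smooth_sum intro!: vanish_add)

text \<open>Functions with vanishing jet form an ideal: each term of the product rule contains
  \<open>f\<close> or a first derivative of \<open>f\<close>, and both vanish to order
  \<open>N\<close>.\<close>

lemma vanish_bilinear:
  assumes "bounded_bilinear mul"
  shows "smooth f \<Longrightarrow> smooth g \<Longrightarrow> vanish N f x \<Longrightarrow> vanish N (\<lambda>y. mul (f y) (g y)) x"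
proof (induction N arbitrary: f g)
  case 0
  then show ?case using bounded_bilinear.zero_left[OF assms] by simp
next
  case (Suc N)
  have "pderiv_at i (\<lambda>y. mul (f y) (g y)) = (\<lambda>y. mul (f y) (pderiv_at i g y) + mul (pderiv_at i f y) (g y))" for i
    by (intro ext pderiv_at_bilinear assms smooth_differentiable Suc)
  moreover have "vanish N (\<lambda>y. mul (f y) (pderiv_at i g y) + mul (pderiv_at i f y) (g y)) x" for i
    using Suc.prems vanish_Suc_imp[OF Suc.prems(3)]
    by (intro vanish_add smooth_bilinear[OF assms] Suc.IH smooth_pderiv_at) auto
  ultimately show ?case using Suc.prems bounded_bilinear.zero_left[OF assms] by simp
qed

lemma vanish_bilinear_right:
  assumes "bounded_bilinear mul"
  shows "smooth f \<Longrightarrow> smooth g \<Longrightarrow> vanish N g x \<Longrightarrow> vanish N (\<lambda>y. mul (f y) (g y)) x"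
  using vanish_bilinear[OF bounded_bilinear.flip[OF assms], of g f N x] by simp

text \<open>The jet of a product depends only on the jets of its factors, since the difference
  splits into \<open>mul (f - f') g\<close> and \<open>mul f' (g - g')\<close>.\<close>

lemma vanish_mult_diff:
  assumes "bounded_bilinear mul" "smooth f" "smooth f'" "smooth g" "smooth g'"
    "vanish N (\<lambda>y. f y - f' y) x" "vanish N (\<lambda>y. g y - g' y) x"
  shows "vanish N (\<lambda>y. mul (f y) (g y) - mul (f' y) (g' y)) x"
proof -
  have "vanish N (\<lambda>y. mul (f y - f' y) (g y) + mul (f' y) (g y - g' y)) x"
    by (intro vanish_add smooth_bilinear[OF assms(1)] vanish_bilinear[OF assms(1)]
        vanish_bilinear_right[OF assms(1)] smooth_diff assms)
  moreover have "mul (f y - f' y) (g y) + mul (f' y) (g y - g' y) = mul (f y) (g y) - mul (f' y) (g' y)" for y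
    by (simp add: bounded_bilinear.diff_left[OF assms(1)] bounded_bilinear.diff_right[OF assms(1)])
  ultimately show ?thesis by simp
qed

lemma vanish_compose:
  fixes \<theta> :: "real ^ 'e \<Rightarrow> real ^ 'd"
  assumes \<theta>: "\<And>j. smooth (\<lambda>y. \<theta> y $ j)"
  shows "smooth f \<Longrightarrow> vanish N f (\<theta> x) \<Longrightarrow> vanish N (\<lambda>y. f (\<theta> y)) x"
proof (induction N arbitrary: f)
  case (Suc N)
  have "pderiv_at i (\<lambda>x. f (\<theta> x)) = (\<lambda>x. \<Sum>j\<in>UNIV. pderiv_at i (\<lambda>y. \<theta> y $ j) x *\<^sub>R pderiv_at j f (\<theta> x))" for i
    by (intro ext pderiv_at_compose smooth_differentiable Suc \<theta>)
  moreover have "vanish N (\<lambda>x. \<Sum>j\<in>UNIV. pderiv_at i (\<lambda>y. \<theta> y $ j) x *\<^sub>R pderiv_at j f (\<theta> x)) x" for i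
    using Suc.prems by (intro vanish_sum smooth_bilinear[OF bounded_bilinear_scaleR] smooth_pderiv_at \<theta>
        smooth_compose[of "pderiv_at j f" for j] vanish_bilinear_right[OF bounded_bilinear_scaleR] Suc.IH) auto
  ultimately show ?case using Suc.prems by simp
qed auto

text \<open>The jet of a composition depends only on the jet of the inner map: after the chain rule
  each summand is a product of factors whose jets agree, for \<open>pderiv_at j f\<close> by the
  induction hypothesis, where \<open>f\<close> is arbitrary.\<close>

lemma vanish_compose_diff:
  fixes \<theta> \<theta>' :: "real ^ 'e \<Rightarrow> real ^ 'd"
  assumes \<theta>: "\<And>j. smooth (\<lambda>y. \<theta> y $ j)" "\<And>j. smooth (\<lambda>y. \<theta>' y $ j)"
  shows "smooth f \<Longrightarrow> (\<And>j. vanish N (\<lambda>y. \<theta> y $ j - \<theta>' y $ j) x) \<Longrightarrow>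
    vanish N (\<lambda>y. f (\<theta> y) - f (\<theta>' y)) x"
proof (induction N arbitrary: f)
  case 0
  then have "\<theta> x = \<theta>' x" by (simp add: vec_eq_iff)
  then show ?case by simp
next
  case (Suc N)
  have eq: "\<theta> x = \<theta>' x" using vanish_at[OF Suc.prems(2)] by (simp add: vec_eq_iff)
  have chain: "pderiv_at i (\<lambda>x. f (\<theta> x) - f (\<theta>' x)) = (\<lambda>x. \<Sum>j\<in>UNIV.
      pderiv_at i (\<lambda>y. \<theta> y $ j) x *\<^sub>R pderiv_at j f (\<theta> x) - pderiv_at i (\<lambda>y. \<theta>' y $ j) x *\<^sub>R pderiv_at j f (\<theta>' x))" for i
  proof
    fix x
    have "pderiv_at i (\<lambda>x. f (\<theta> x) - f (\<theta>' x)) x = pderiv_at i (\<lambda>x. f (\<theta> x)) x - pderiv_at i (\<lambda>x. f (\<theta>' x)) x"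
      using smooth_compose[of f \<theta>] smooth_compose[of f \<theta>'] Suc.prems(1) \<theta>
      by (intro pderiv_at_diff smooth_differentiable) simp_all
    then show "pderiv_at i (\<lambda>x. f (\<theta> x) - f (\<theta>' x)) x = (\<Sum>j\<in>UNIV.
      pderiv_at i (\<lambda>y. \<theta> y $ j) x *\<^sub>R pderiv_at j f (\<theta> x) - pderiv_at i (\<lambda>y. \<theta>' y $ j) x *\<^sub>R pderiv_at j f (\<theta>' x))"
      by (simp add: sum_subtractf pderiv_at_compose[OF smooth_differentiable smooth_differentiable] Suc.prems(1) \<theta>)
  qed
  have diff: "pderiv_at i (\<lambda>y. \<theta> y $ j - \<theta>' y $ j) = (\<lambda>y. pderiv_at i (\<lambda>y. \<theta> y $ j) y - pderiv_at i (\<lambda>y. \<theta>' y $ j) y)" for i j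
    by (intro ext pderiv_at_diff smooth_differentiable \<theta>)
  have "vanish N (\<lambda>y. pderiv_at i (\<lambda>y. \<theta> y $ j) y - pderiv_at i (\<lambda>y. \<theta>' y $ j) y) x" for i j
    using Suc.prems(2)[of j] unfolding diff[symmetric] by simp
  moreover have "vanish N (\<lambda>y. pderiv_at j f (\<theta> y) - pderiv_at j f (\<theta>' y)) x" for j
    using Suc.prems vanish_Suc_imp by (intro Suc.IH smooth_pderiv_at) blast+
  ultimately have "vanish N (\<lambda>x. \<Sum>j\<in>UNIV.
      pderiv_at i (\<lambda>y. \<theta> y $ j) x *\<^sub>R pderiv_at j f (\<theta> x) - pderiv_at i (\<lambda>y. \<theta>' y $ j) x *\<^sub>R pderiv_at j f (\<theta>' x)) x" for i
    by (intro vanish_sum vanish_mult_diff[OF bounded_bilinear_scaleR] smooth_diff smooth_bilinear[OF bounded_bilinear_scaleR]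
         smooth_pderiv_at smooth_compose[of "pderiv_at j f" for j] \<theta> Suc.prems)
  then show ?case using eq chain by simp
qed

section \<open>Iterated derivatives by multi-indices\<close>

lemma smooth_funpow_pderiv_at: "smooth f \<Longrightarrow> smooth ((pderiv_at i ^^ n) f)"
  by (induction n) (auto intro: smooth_pderiv_at)

lemma funpow_pderiv_at_commute:
  "smooth f \<Longrightarrow> (pderiv_at j ^^ n) (pderiv_at i f) = pderiv_at i ((pderiv_at j ^^ n) f)"
  by (induction n) (auto simp: pderiv_at_commute smooth_funpow_pderiv_at)

lemma smooth_foldr_pderiv_at:
  "smooth f \<Longrightarrow> smooth (foldr (\<lambda>i. pderiv_at i ^^ (\<alpha> $ i)) is f)"
  by (induction "is") (auto intro: smooth_funpow_pderiv_at)

lemma foldr_pderiv_at_commute: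
  "smooth f \<Longrightarrow> foldr (\<lambda>i. pderiv_at i ^^ (\<alpha> $ i)) is (pderiv_at j f) =
    pderiv_at j (foldr (\<lambda>i. pderiv_at i ^^ (\<alpha> $ i)) is f)"
  by (induction "is") (auto simp: funpow_pderiv_at_commute smooth_foldr_pderiv_at)

text \<open>By distinctness the extra derivative is met at most once, and symmetry of derivatives
  moves it to the innermost position.\<close>

lemma foldr_pderiv_at_axis:
  assumes "smooth f" "distinct is"
  shows "foldr (\<lambda>i. pderiv_at i ^^ ((\<alpha> + axis j (Suc 0)) $ i)) is f =
    (if j \<in> set is then foldr (\<lambda>i. pderiv_at i ^^ (\<alpha> $ i)) is (pderiv_at j f)
     else foldr (\<lambda>i. pderiv_at i ^^ (\<alpha> $ i)) is f)"
  using assms(2)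
proof (induction "is")
  case (Cons i "is")
  then show ?case
    by (auto simp: axis_def foldr_pderiv_at_commute[OF assms(1)] funpow_swap1)
qed auto

lemma mderiv_0 [simp]: "mderiv 0 f = f"
proof -
  have "foldr (\<lambda>i. pderiv_at i ^^ ((0 :: nat ^ 'a::_) $ i)) is f = f" for "is" :: "('a::_) list"
    by (induction "is") auto
  then show ?thesis by (simp add: mderiv_def)
qed

lemma mderiv_add_axis: "smooth f \<Longrightarrow> mderiv (\<alpha> + axis i (Suc 0)) f = mderiv \<alpha> (pderiv_at i f)"
  unfolding mderiv_def by (subst foldr_pderiv_at_axis) auto

lemma mderiv_add:
  "smooth f \<Longrightarrow> smooth g \<Longrightarrow> mderiv \<alpha> (\<lambda>x. f x + g x) = (\<lambda>x. mderiv \<alpha> f x + mderiv \<alpha> g x)"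
proof (induction \<alpha> arbitrary: f g rule: mindex_induct)
  case (step \<gamma> i)
  have "pderiv_at i (\<lambda>y. f y + g y) = (\<lambda>y. pderiv_at i f y + pderiv_at i g y)"
    by (intro ext pderiv_at_add smooth_differentiable step)
  then show ?case
    using step.IH[OF smooth_pderiv_at[OF step.prems(1)] smooth_pderiv_at[OF step.prems(2)], of i i]
    by (simp add: mderiv_add_axis step.prems smooth_add)
qed auto

lemma mderiv_linear:
  assumes "bounded_linear L"
  shows "smooth f \<Longrightarrow> mderiv \<alpha> (\<lambda>x. L (f x)) = (\<lambda>x. L (mderiv \<alpha> f x))"
proof (induction \<alpha> arbitrary: f rule: mindex_induct)
  case (step \<gamma> i)
  have "pderiv_at i (\<lambda>y. L (f y)) = (\<lambda>y. L (pderiv_at i f y))"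
    by (intro ext pderiv_at_linear[OF assms] smooth_differentiable step)
  then show ?case
    using step.IH[OF smooth_pderiv_at[OF step.prems(1)], of i]
    by (simp add: mderiv_add_axis step.prems smooth_linear[OF assms])
qed auto

lemma mderiv_diff:
  assumes "smooth f" "smooth g"
  shows "mderiv \<alpha> (\<lambda>x. f x - g x) = (\<lambda>x. mderiv \<alpha> f x - mderiv \<alpha> g x)"
proof -
  have L: "bounded_linear (uminus :: 'b \<Rightarrow> 'b)" by (rule bounded_linear_minus[OF bounded_linear_ident])
  have "mderiv \<alpha> (\<lambda>x. f x + - g x) = (\<lambda>x. mderiv \<alpha> f x + - mderiv \<alpha> g x)"
    using assms by (simp add: mderiv_add smooth_linear[OF L] mderiv_linear[OF L] del: add_uminus_conv_diff)
  then show ?thesis by simp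
qed

lemma mderiv_sum:
  "(\<And>i. i \<in> I \<Longrightarrow> smooth (f i)) \<Longrightarrow> mderiv \<alpha> (\<lambda>x. \<Sum>i\<in>I. f i x) = (\<lambda>x. \<Sum>i\<in>I. mderiv \<alpha> (f i) x)"
proof (induction I rule: infinite_finite_induct)
  case (insert i I)
  then show ?case
    using mderiv_add[of "f i" "\<lambda>x. \<Sum>i\<in>I. f i x"] by (simp add: smooth_sum)
qed auto

lemma vanish_iff_mderiv:
  fixes f :: "real ^ 'd::{finite,linorder} \<Rightarrow> 'b::real_normed_vector"
  shows "smooth f \<Longrightarrow> vanish N f x \<longleftrightarrow> (\<forall>\<gamma>. mabs \<gamma> \<le> N \<longrightarrow> mderiv \<gamma> f x = 0)"
proof (induction N arbitrary: f)
  case 0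
  then show ?case by auto
next
  case (Suc N)
  have IH: "vanish N (pderiv_at i f) x \<longleftrightarrow> (\<forall>\<gamma>. mabs \<gamma> \<le> N \<longrightarrow> mderiv (\<gamma> + axis i (Suc 0)) f x = 0)" for i
    using Suc.IH[OF smooth_pderiv_at[OF Suc.prems]] by (simp add: mderiv_add_axis Suc.prems)
  show ?case
  proof
    assume v: "vanish (Suc N) f x"
    have "mderiv \<gamma> f x = 0" if "mabs \<gamma> \<le> Suc N" for \<gamma>
    proof -
      \<comment> \<open>The induction serves as a case distinction: a nonzero multi-index contains a
        unit step, to which \<open>IH\<close> applies.\<close>
      have "\<gamma> = 0 \<or> (\<exists>\<gamma>' i. \<gamma> = \<gamma>' + axis i (Suc 0))"
        by (induction \<gamma> rule: mindex_induct) auto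
      then show ?thesis using v IH that by auto
    qed
    then show "\<forall>\<gamma>. mabs \<gamma> \<le> Suc N \<longrightarrow> mderiv \<gamma> f x = 0" by blast
  next
    assume *: "\<forall>\<gamma>. mabs \<gamma> \<le> Suc N \<longrightarrow> mderiv \<gamma> f x = 0"
    then have "f x = 0" using mderiv_0[of f] by (metis mabs_0 le0)
    with * show "vanish (Suc N) f x" by (simp add: IH)
  qed
qed

lemma mderiv_eq_if_vanish:
  assumes "smooth f" "smooth g" "vanish N (\<lambda>y. f y - g y) x" "mabs \<gamma> \<le> N"
  shows "mderiv \<gamma> f x = mderiv \<gamma> g x"
  using assms by (simp add: vanish_iff_mderiv smooth_diff mderiv_diff)

section \<open>Taylor polynomials and the Leibniz rule\<close>

context
  fixes G :: "'s \<Rightarrow> real \<Rightarrow> real" and D :: "'s \<Rightarrow> 's"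
  assumes G: "\<And>u t. (G u has_real_derivative G (D u) t) (at t)"
begin

lemma separable_differentiable:
  fixes a :: "real ^ 'd"
  shows "(\<lambda>y. \<Prod>i\<in>I. G (u i) (y $ i - a $ i)) differentiable (at x)"
proof (induction I rule: infinite_finite_induct)
  case (insert j I)
  have "(\<lambda>y. y $ j - a $ j) differentiable (at x)"
    by (rule differentiable_diff[OF bounded_linear_imp_differentiable[OF bounded_linear_vec_nth] differentiable_const])
  moreover have "G (u j) differentiable (at (x $ j - a $ j))"
    using G real_differentiable_def by blast
  ultimately have "(\<lambda>y. G (u j) (y $ j - a $ j)) differentiable (at x)"
    using differentiable_chain_at[of "\<lambda>y. y $ j - a $ j" x "G (u j)"] by (simp add: o_def)
  with insert show ?case by (simp add: differentiable_mult)
qed auto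

text \<open>\<open>u\<close> holds one symbol per coordinate and \<open>D\<close> is differentiation
  on symbols, so a partial derivative is again separable, with one symbol updated. The instances are
  \<open>poly\<close> with \<open>pderiv\<close> for monomials and \<open>gauss\<close> with
  \<open>gauss_deriv\<close> for test functions.\<close>

lemma separable_pderiv_at:
  fixes a :: "real ^ 'd"
  shows "pderiv_at j (\<lambda>y. \<Prod>i\<in>UNIV. G (u i) (y $ i - a $ i)) =
    (\<lambda>y. \<Prod>i\<in>UNIV. G ((u(j := D (u j))) i) (y $ i - a $ i))"
proof
  fix y :: "real ^ 'd"
  let ?c = "\<Prod>i\<in>UNIV - {j}. G (u i) (y $ i - a $ i)"
  have "(\<Prod>i\<in>UNIV. G (u i) ((y + t *\<^sub>R axis j 1) $ i - a $ i)) = G (u j) (y $ j - a $ j + t) * ?c" for t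
  proof -
    have "(\<Prod>i\<in>UNIV. G (u i) ((y + t *\<^sub>R axis j 1) $ i - a $ i)) =
      G (u j) (y $ j - a $ j + t) * (\<Prod>i\<in>UNIV - {j}. G (u i) ((y + t *\<^sub>R axis j 1) $ i - a $ i))"
      by (subst prod.remove[of UNIV j]) (auto simp: axis_def algebra_simps)
    also have "(\<Prod>i\<in>UNIV - {j}. G (u i) ((y + t *\<^sub>R axis j 1) $ i - a $ i)) = ?c"
      by (intro prod.cong) (auto simp: axis_def)
    finally show ?thesis .
  qed
  moreover have "((\<lambda>t. G (u j) (y $ j - a $ j + t) * ?c) has_real_derivative G (D (u j)) (y $ j - a $ j + 0) * ?c) (at 0)"
    using G[of "u j" "y $ j - a $ j + 0"] DERIV_shift[of "G (u j)" _ 0 "y $ j - a $ j"]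
    by (intro DERIV_cmult_right) (simp add: add.commute)
  ultimately have "pderiv_at j (\<lambda>y. \<Prod>i\<in>UNIV. G (u i) (y $ i - a $ i)) y = G (D (u j)) (y $ j - a $ j) * ?c"
    unfolding pderiv_at_def
    by (intro vector_derivative_at) (simp add: has_real_derivative_iff_has_vector_derivative)
  also have "?c = (\<Prod>i\<in>UNIV - {j}. G ((u(j := D (u j))) i) (y $ i - a $ i))"
    by (intro prod.cong) auto
  also have "G (D (u j)) (y $ j - a $ j) * \<dots> = (\<Prod>i\<in>UNIV. G ((u(j := D (u j))) i) (y $ i - a $ i))"
    by (subst prod.remove[of UNIV j]) auto
  finally show "pderiv_at j (\<lambda>y. \<Prod>i\<in>UNIV. G (u i) (y $ i - a $ i)) y = \<dots>" .
qed

lemma separable_C_k: "C_k k (\<lambda>y::real ^ 'd. \<Prod>i\<in>UNIV. G (u i) (y $ i - a $ i))"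
proof (induction k arbitrary: u)
  case 0
  then show ?case
    by (simp add: continuous_on_eq_continuous_at differentiable_imp_continuous_within separable_differentiable)
qed (simp add: separable_differentiable separable_pderiv_at del: fun_upd_apply)

lemma separable_smooth: "smooth (\<lambda>y::real ^ 'd. \<Prod>i\<in>UNIV. G (u i) (y $ i - a $ i))"
  by (simp add: smooth_def separable_C_k)

lemma separable_mderiv:
  "mderiv \<gamma> (\<lambda>y::real ^ 'd::{finite,linorder}. \<Prod>i\<in>UNIV. G (u i) (y $ i - a $ i)) =
    (\<lambda>y. \<Prod>i\<in>UNIV. G ((D ^^ (\<gamma> $ i)) (u i)) (y $ i - a $ i))"
proof (induction \<gamma> arbitrary: u rule: mindex_induct)
  case (step \<gamma> j)
  have "(D ^^ (\<gamma> $ i)) ((u(j := D (u j))) i) = (D ^^ ((\<gamma> + axis j (Suc 0)) $ i)) (u i)" for i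
    by (simp add: axis_def funpow_swap1)
  then show ?case
    by (simp add: mderiv_add_axis separable_smooth separable_pderiv_at step del: fun_upd_apply)
qed simp

end

lemma mpow_separable: "mpow (y - a) \<mu> = (\<Prod>i\<in>UNIV. poly (monom 1 (\<mu> $ i)) (y $ i - a $ i))"
  by (simp add: mpow_def poly_monom)

lemma smooth_mpow: "smooth (\<lambda>y. mpow (y - a) \<mu>)"
  unfolding mpow_separable by (rule separable_smooth[of poly pderiv, OF poly_DERIV])

text \<open>Monomials centred at \<open>a\<close> are, up to factorials, dual to the derivatives at
  \<open>a\<close>. This is what turns differentiation of a polynomial at its centre into extraction
  of a coefficient.\<close>

lemma mderiv_mpow: "mderiv \<beta> (\<lambda>y. mpow (y - a) \<mu>) a = (if \<beta> = \<mu> then real (mfact \<beta>) else 0)"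
proof -
  have "poly ((pderiv ^^ m) (monom 1 n)) 0 = (if m = n then fact m else (0::real))" for m n
    by (simp add: poly_0_coeff_0 coeff_higher_pderiv pochhammer_fact[symmetric])
  then have "mderiv \<beta> (\<lambda>y. mpow (y - a) \<mu>) a = (\<Prod>i\<in>UNIV. if \<beta> $ i = \<mu> $ i then fact (\<beta> $ i) else 0)"
    unfolding mpow_separable separable_mderiv[of poly pderiv, OF poly_DERIV] by simp
  also have "\<dots> = (if \<beta> = \<mu> then real (mfact \<beta>) else 0)"
    by (auto simp: mfact_def vec_eq_iff)
  finally show ?thesis .
qed

definition taylor where
  "taylor N f a y = (\<Sum>\<mu> | mabs \<mu> \<le> N. (mpow (y - a) \<mu> / real (mfact \<mu>)) *\<^sub>R mderiv \<mu> f a)"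

lemma smooth_mpow_scaleR: "smooth (\<lambda>y. (mpow (y - a) \<mu> / c) *\<^sub>R v)"
proof -
  have "smooth (\<lambda>y. mpow (y - a) \<mu> *\<^sub>R ((1 / c) *\<^sub>R v))"
    by (intro smooth_bilinear[OF bounded_bilinear_scaleR] smooth_mpow smooth_const)
  then show ?thesis by simp
qed

lemma mderiv_mpow_scaleR:
  "mderiv \<beta> (\<lambda>y. (mpow (y - a) \<mu> / c) *\<^sub>R v) a = (if \<beta> = \<mu> then (real (mfact \<beta>) / c) *\<^sub>R v else 0)"
proof -
  have "mderiv \<beta> (\<lambda>y. mpow (y - a) \<mu> *\<^sub>R ((1 / c) *\<^sub>R v)) = (\<lambda>y. mderiv \<beta> (\<lambda>y. mpow (y - a) \<mu>) y *\<^sub>R ((1 / c) *\<^sub>R v))"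
    by (rule mderiv_linear[OF bounded_linear_scaleR_left smooth_mpow])
  then show ?thesis by (simp add: mderiv_mpow fun_eq_iff)
qed

lemma smooth_taylor: "smooth (taylor N f a)"
proof -
  have "taylor N f a = (\<lambda>y. \<Sum>\<mu> | mabs \<mu> \<le> N. (mpow (y - a) \<mu> / real (mfact \<mu>)) *\<^sub>R mderiv \<mu> f a)"
    by (simp add: taylor_def fun_eq_iff)
  then show ?thesis by (simp add: smooth_sum smooth_mpow_scaleR)
qed

lemma vanish_taylor:
  assumes "smooth f"
  shows "vanish N (\<lambda>y. f y - taylor N f a y) a"
proof -
  have "mderiv \<gamma> (\<lambda>y. f y - taylor N f a y) a = 0" if \<gamma>: "mabs \<gamma> \<le> N" for \<gamma>
  proof -
    have "mderiv \<gamma> (taylor N f a) a = (\<Sum>\<mu> | mabs \<mu> \<le> N. if \<gamma> = \<mu> then (real (mfact \<gamma>) / real (mfact \<mu>)) *\<^sub>R mderiv \<mu> f a else 0)"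
      unfolding taylor_def[abs_def] by (simp add: mderiv_sum smooth_mpow_scaleR mderiv_mpow_scaleR)
    also have "\<dots> = (\<Sum>\<mu> | mabs \<mu> \<le> N. if \<gamma> = \<mu> then mderiv \<mu> f a else 0)"
      by (intro sum.cong) auto
    also have "\<dots> = mderiv \<gamma> f a" using \<gamma> by simp
    finally show ?thesis by (simp add: mderiv_diff assms smooth_taylor)
  qed
  then show ?thesis by (simp add: vanish_iff_mderiv smooth_diff assms smooth_taylor)
qed

lemma mchoose_eq: "\<beta> \<le> \<alpha> \<Longrightarrow> real (mchoose \<alpha> \<beta>) = real (mfact \<alpha>) / (real (mfact (\<alpha> - \<beta>)) * real (mfact \<beta>))"
  by (simp add: mchoose_def mfact_def less_eq_vec_def binomial_fact flip: prod.distrib prod_dividef)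
     (simp add: mult.commute)

text \<open>With Taylor polynomials of order \<open>mabs \<alpha>\<close> the product is a finite
  sum of monomials in \<open>y - x\<close>, and the derivative at \<open>x\<close> keeps the pairs
  with \<open>\<alpha> = \<mu> + \<nu>\<close>; their factorials combine to
  \<open>mchoose\<close>.\<close>

theorem mderiv_bilinear:
  fixes f :: "real ^ 'd::{finite,linorder} \<Rightarrow> 'a::real_normed_vector" and g :: "real ^ 'd::_ \<Rightarrow> 'b::real_normed_vector"
  assumes mul: "bounded_bilinear mul" and f: "smooth f" and g: "smooth g"
  shows "mderiv \<alpha> (\<lambda>y. mul (f y) (g y)) x =
    (\<Sum>\<beta> | \<beta> \<le> \<alpha>. real (mchoose \<alpha> \<beta>) *\<^sub>R mul (mderiv (\<alpha> - \<beta>) f x) (mderiv \<beta> g x))"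
proof -
  define N where "N = mabs \<alpha>"
  define S where "S = {\<mu> :: nat ^ 'd::_. mabs \<mu> \<le> N}"
  have S: "finite S" by (simp add: S_def)
  have "mderiv \<alpha> (\<lambda>y. mul (f y) (g y)) x = mderiv \<alpha> (\<lambda>y. mul (taylor N f x y) (taylor N g x y)) x"
    by (rule mderiv_eq_if_vanish[where N = N])
       (simp_all add: N_def smooth_bilinear[OF mul] f g smooth_taylor vanish_mult_diff[OF mul] vanish_taylor)
  also have "(\<lambda>y. mul (taylor N f x y) (taylor N g x y)) = (\<lambda>y. \<Sum>\<nu>\<in>S. \<Sum>\<mu>\<in>S.
      (mpow (y - x) (\<mu> + \<nu>) / (real (mfact \<mu>) * real (mfact \<nu>))) *\<^sub>R mul (mderiv \<mu> f x) (mderiv \<nu> g x))"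
    by (simp add: fun_eq_iff taylor_def S_def bounded_bilinear.sum_left[OF mul] bounded_bilinear.sum_right[OF mul]
        bounded_bilinear.scaleR_left[OF mul] bounded_bilinear.scaleR_right[OF mul] mpow_add scaleR_sum_right mult.commute)
  also have "mderiv \<alpha> \<dots> x = (\<Sum>\<nu>\<in>S. \<Sum>\<mu>\<in>S. if \<alpha> = \<mu> + \<nu> then
      (real (mfact \<alpha>) / (real (mfact \<mu>) * real (mfact \<nu>))) *\<^sub>R mul (mderiv \<mu> f x) (mderiv \<nu> g x) else 0)"
    by (simp add: mderiv_sum smooth_sum smooth_mpow_scaleR mderiv_mpow_scaleR)
  also have "\<dots> = (\<Sum>\<nu>\<in>S. if \<nu> \<le> \<alpha> then real (mchoose \<alpha> \<nu>) *\<^sub>R mul (mderiv (\<alpha> - \<nu>) f x) (mderiv \<nu> g x) else 0)"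
  proof (rule sum.cong[OF refl])
    fix \<nu> assume "\<nu> \<in> S"
    show "(\<Sum>\<mu>\<in>S. if \<alpha> = \<mu> + \<nu> then
      (real (mfact \<alpha>) / (real (mfact \<mu>) * real (mfact \<nu>))) *\<^sub>R mul (mderiv \<mu> f x) (mderiv \<nu> g x) else 0) =
      (if \<nu> \<le> \<alpha> then real (mchoose \<alpha> \<nu>) *\<^sub>R mul (mderiv (\<alpha> - \<nu>) f x) (mderiv \<nu> g x) else 0)"
    proof (cases "\<nu> \<le> \<alpha>")
      case True
      then have eq: "\<alpha> = \<mu> + \<nu> \<longleftrightarrow> \<mu> = \<alpha> - \<nu>" for \<mu>
        by (auto simp: vec_eq_iff less_eq_vec_def)
      have "\<alpha> = (\<alpha> - \<nu>) + \<nu>" using eq by simp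
      then have "mabs \<alpha> = mabs (\<alpha> - \<nu>) + mabs \<nu>" by (metis mabs_add)
      then have "\<alpha> - \<nu> \<in> S" by (simp add: S_def N_def)
      then show ?thesis using True S by (simp add: eq mchoose_eq)
    next
      case False
      then have "\<alpha> \<noteq> \<mu> + \<nu>" for \<mu> by (auto simp: less_eq_vec_def)
      then show ?thesis using False by simp
    qed
  qed
  also have "\<dots> = (\<Sum>\<nu> | \<nu> \<in> S \<and> \<nu> \<le> \<alpha>. real (mchoose \<alpha> \<nu>) *\<^sub>R mul (mderiv (\<alpha> - \<nu>) f x) (mderiv \<nu> g x))"
    using S by (simp add: sum.If_cases Int_def)
  \<comment> \<open>The Taylor order cuts nothing off: \<open>\<nu> \<le> \<alpha>\<close> implies
    \<open>mabs \<nu> \<le> N\<close>.\<close>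
  also have "{\<nu>. \<nu> \<in> S \<and> \<nu> \<le> \<alpha>} = {\<nu>. \<nu> \<le> \<alpha>}"
    by (auto simp: S_def N_def mabs_def less_eq_vec_def intro!: sum_mono)
  finally show ?thesis .
qed

section \<open>The formula of Faa di Bruno\<close>

lemma mpow_add_binomial:
  "mpow (u + v) \<mu> / real (mfact \<mu>) =
    (\<Sum>\<kappa> | \<kappa> \<le> \<mu>. (mpow u \<kappa> / real (mfact \<kappa>)) * (mpow v (\<mu> - \<kappa>) / real (mfact (\<mu> - \<kappa>))))"
proof -
  \<comment> \<open>Divided powers make the binomial formula free of coefficients, and the product
    over the coordinates keeps that form.\<close>
  have binom: "(a + b) ^ n / fact n = (\<Sum>k\<le>n. (a ^ k / fact k) * (b ^ (n - k) / fact (n - k)))" for a b :: real and n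
    by (simp add: binomial_ring sum_divide_distrib binomial_fact)
  have "mpow (u + v) \<mu> / real (mfact \<mu>) = (\<Prod>i\<in>UNIV. (u $ i + v $ i) ^ (\<mu> $ i) / fact (\<mu> $ i))"
    by (simp add: mpow_def mfact_def prod_dividef)
  \<comment> \<open>A product of sums is expanded over choice functions, which are then read as
    multi-indices \<open>\<kappa> \<le> \<mu>\<close>.\<close>
  also have "\<dots> = (\<Sum>h\<in>(\<Pi>\<^sub>E i\<in>UNIV. {..\<mu> $ i}). \<Prod>i\<in>UNIV.
      ((u $ i) ^ h i / fact (h i)) * ((v $ i) ^ (\<mu> $ i - h i) / fact (\<mu> $ i - h i)))"
    unfolding binom by (rule prod_sum_PiE) auto
  also have "\<dots> = (\<Sum>\<kappa> | \<kappa> \<le> \<mu>. \<Prod>i\<in>UNIV. ((u $ i) ^ (\<kappa> $ i) / fact (\<kappa> $ i)) *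
      ((v $ i) ^ (\<mu> $ i - \<kappa> $ i) / fact (\<mu> $ i - \<kappa> $ i)))"
    by (rule sum.reindex_bij_witness[of _ vec_nth vec_lambda]) (auto simp: less_eq_vec_def PiE_def Pi_def)
  also have "\<dots> = (\<Sum>\<kappa> | \<kappa> \<le> \<mu>. (mpow u \<kappa> / real (mfact \<kappa>)) * (mpow v (\<mu> - \<kappa>) / real (mfact (\<mu> - \<kappa>))))"
    by (simp add: mpow_def mfact_def prod_dividef prod.distrib)
  finally show ?thesis .
qed

text \<open>Extensionality makes a decomposition of \<open>\<mu>\<close> indexed by \<open>A\<close>
  a single function, so that sums over this set count it once.\<close>

definition msplits :: "'a set \<Rightarrow> nat ^ 'd \<Rightarrow> ('a \<Rightarrow> nat ^ 'd) set" where
  "msplits A \<mu> = {K \<in> A \<rightarrow>\<^sub>E UNIV. (\<Sum>a\<in>A. K a) = \<mu>}"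

lemma finite_msplits:
  assumes "finite A"
  shows "finite (msplits A \<mu>)"
proof (rule finite_subset)
  show "msplits A \<mu> \<subseteq> A \<rightarrow>\<^sub>E {\<kappa>. \<kappa> \<le> \<mu>}"
  proof
    fix K assume K: "K \<in> msplits A \<mu>"
    have "K a $ i \<le> \<mu> $ i" if "a \<in> A" for a i
    proof -
      have "K a $ i \<le> (\<Sum>a\<in>A. K a $ i)" using that assms by (intro member_le_sum) auto
      then show ?thesis using K by (auto simp: msplits_def)
    qed
    then show "K \<in> A \<rightarrow>\<^sub>E {\<kappa>. \<kappa> \<le> \<mu>}" using K by (auto simp: msplits_def less_eq_vec_def PiE_def Pi_def)
  qed
qed (use assms in \<open>auto intro: finite_PiE\<close>)

text \<open>Splitting off one summand at a time reduces this to the binomial case. The index type is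
  left general because \<open>A\<close> is later a set of multi-indices, labelling the Taylor terms
  of the inner map.\<close>

lemma mpow_sum_multinomial:
  fixes A :: "'a set"
  assumes "finite A"
  shows "mpow (\<Sum>a\<in>A. v a) \<mu> / real (mfact \<mu>) =
    (\<Sum>K\<in>msplits A \<mu>. \<Prod>a\<in>A. mpow (v a) (K a) / real (mfact (K a)))"
  using assms
proof (induction A arbitrary: \<mu> rule: finite_induct)
  case empty
  have "mpow 0 \<mu> / real (mfact \<mu>) = (if \<mu> = 0 then 1 else 0)"
    by (auto simp: mpow_def mfact_def vec_eq_iff)
  moreover have "(msplits {} \<mu> :: ('a \<Rightarrow> _) set) = (if \<mu> = 0 then {\<lambda>_. undefined} else {})"
    by (auto simp: msplits_def)
  ultimately show ?case by (cases "\<mu> = 0") simp_all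
next
  case (insert b A)
  have "mpow (\<Sum>a\<in>insert b A. v a) \<mu> / real (mfact \<mu>) =
    (\<Sum>\<kappa> | \<kappa> \<le> \<mu>. (mpow (v b) \<kappa> / real (mfact \<kappa>)) *
       (\<Sum>K\<in>msplits A (\<mu> - \<kappa>). \<Prod>a\<in>A. mpow (v a) (K a) / real (mfact (K a))))"
    using insert by (simp add: mpow_add_binomial)
  also have "\<dots> = (\<Sum>(\<kappa>, K)\<in>(SIGMA \<kappa>:{\<kappa>. \<kappa> \<le> \<mu>}. msplits A (\<mu> - \<kappa>)).
       (mpow (v b) \<kappa> / real (mfact \<kappa>)) * (\<Prod>a\<in>A. mpow (v a) (K a) / real (mfact (K a))))"
    unfolding sum_distrib_left by (rule sum.Sigma) (use insert in \<open>auto intro: finite_msplits\<close>)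
  also have "\<dots> = (\<Sum>K\<in>msplits (insert b A) \<mu>. \<Prod>a\<in>insert b A. mpow (v a) (K a) / real (mfact (K a)))"
  \<comment> \<open>When the value at \<open>b\<close> is removed it must be reset to
    \<open>undefined\<close>, since the remaining function has to be extensional on
    \<open>A\<close>.\<close>
  proof (rule sum.reindex_bij_witness[of _ "\<lambda>K. (K b, K(b := undefined))" "\<lambda>(\<kappa>, K). K(b := \<kappa>)"], goal_cases)
    case (1 p)
    then show ?case using insert.hyps by (auto simp: msplits_def PiE_def extensional_def fun_eq_iff)
  next
    case (2 p)
    then obtain \<kappa> K where p: "p = (\<kappa>, K)" and \<kappa>: "\<kappa> \<le> \<mu>" and K: "K \<in> msplits A (\<mu> - \<kappa>)" by auto
    have "(\<Sum>a\<in>A. (K(b := \<kappa>)) a) = (\<Sum>a\<in>A. K a)"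
      using insert.hyps by (intro sum.cong) auto
    then have "(\<Sum>a\<in>A. (K(b := \<kappa>)) a) = \<mu> - \<kappa>"
      using K by (simp add: msplits_def)
    moreover have "\<kappa> + (\<mu> - \<kappa>) = \<mu>" using \<kappa> by (simp add: vec_eq_iff less_eq_vec_def)
    ultimately have "(\<Sum>a\<in>insert b A. (K(b := \<kappa>)) a) = \<mu>"
      using insert.hyps by (simp add: fun_upd_same del: fun_upd_apply)
    then show ?case using K by (auto simp: p msplits_def PiE_def extensional_def)
  next
    case (3 K)
    then show ?case by simp
  next
    case (4 K)
    then have *: "K b + (\<Sum>a\<in>A. K a) = \<mu>" using insert.hyps by (simp add: msplits_def)
    have "(\<Sum>a\<in>A. (K(b := undefined)) a) = (\<Sum>a\<in>A. K a)"
      using insert.hyps by (intro sum.cong) auto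
    also have "\<dots> = \<mu> - K b" using * by auto
    finally show ?case using 4 * by (auto simp: msplits_def PiE_def extensional_def less_eq_vec_def)
  next
    case (5 p)
    then obtain \<kappa> K where p: "p = (\<kappa>, K)" by (cases p)
    have "(\<Prod>a\<in>A. mpow (v a) ((K(b := \<kappa>)) a) / real (mfact ((K(b := \<kappa>)) a))) =
       (\<Prod>a\<in>A. mpow (v a) (K a) / real (mfact (K a)))"
      using insert.hyps by (intro prod.cong) auto
    then show ?case using insert.hyps by (simp add: p fun_upd_same del: fun_upd_apply) 
  qed
  finally show ?case .
qed

section \<open>The linear order on multi-indices\<close>

lemma mprec_irrefl: "\<not> mprec \<alpha> \<alpha>"
  by (simp add: mprec_def)

lemma mprec_trans:
  assumes "mprec \<alpha> \<beta>" "mprec \<beta> \<gamma>"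
  shows "mprec \<alpha> \<gamma>"
proof (cases "mabs \<alpha> < mabs \<gamma>")
  case False
  then have eq: "mabs \<alpha> = mabs \<beta>" "mabs \<beta> = mabs \<gamma>" using assms by (auto simp: mprec_def)
  then obtain i j where ij: "\<forall>k<i. \<alpha> $ k = \<beta> $ k" "\<alpha> $ i < \<beta> $ i" "\<forall>k<j. \<beta> $ k = \<gamma> $ k" "\<beta> $ j < \<gamma> $ j"
    using assms by (auto simp: mprec_def)
  have "\<forall>k<min i j. \<alpha> $ k = \<gamma> $ k" using ij by simp
  moreover have "\<alpha> $ min i j < \<gamma> $ min i j"
    using ij by (cases i j rule: linorder_cases) (auto simp: min_def)
  ultimately show ?thesis unfolding mprec_def using eq by (intro disjI2 conjI exI[of _ "min i j"]) auto
qed (simp add: mprec_def)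

text \<open>Between distinct multi-indices of equal length the first coordinate in which they differ
  decides.\<close>

lemma mprec_total: "mprec \<alpha> \<beta> \<or> \<alpha> = \<beta> \<or> mprec \<beta> \<alpha>"
proof (cases "mabs \<alpha> = mabs \<beta> \<and> \<alpha> \<noteq> \<beta>")
  case True
  define i where "i = Min {i. \<alpha> $ i \<noteq> \<beta> $ i}"
  have ne: "{i. \<alpha> $ i \<noteq> \<beta> $ i} \<noteq> {}" using True by (auto simp: vec_eq_iff)
  then have "i \<in> {i. \<alpha> $ i \<noteq> \<beta> $ i}" unfolding i_def by (intro Min_in) auto
  moreover have "\<alpha> $ j = \<beta> $ j" if "j < i" for j
    using that ne Min_le[of "{i. \<alpha> $ i \<noteq> \<beta> $ i}" j] by (auto simp: i_def)
  ultimately show ?thesis using True by (fastforce simp: mprec_def)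
qed (auto simp: mprec_def)

text \<open>In this form the library facts on strictly sorted lists become available for
  \<open>\<prec>\<close>, which is not the order instance of the vector type.\<close>

lemma mprec_linorder: "class.linorder (\<lambda>\<alpha> \<beta>. mprec \<alpha> \<beta> \<or> \<alpha> = \<beta>) mprec"
  by (unfold_locales; metis mprec_irrefl mprec_trans mprec_total)

lemma zero_mprec_iff: "mprec 0 \<alpha> \<longleftrightarrow> \<alpha> \<noteq> 0"
  using mprec_irrefl[of "0 :: nat ^ 'a::_"] by (auto simp: mprec_def)

text \<open>A tuple \<open>(k, l)\<close> in \<open>faa_indices\<close> lists, in increasing order and padded with zeros in front, the
  support of a map \<open>K\<close> sending \<open>l j\<close> to \<open>k j\<close>.\<close>

definition faa_lists :: "nat \<Rightarrow> (nat \<Rightarrow> nat ^ 'd::{finite,linorder}) \<Rightarrow> (nat \<Rightarrow> nat ^ 'd::_) \<Rightarrow> (nat ^ 'd::_ \<Rightarrow> nat ^ 'd::_) \<Rightarrow> bool" where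
  "faa_lists N k l K \<longleftrightarrow> (\<exists>s\<le>N. k \<in> {1..N} \<rightarrow>\<^sub>E UNIV \<and> l \<in> {1..N} \<rightarrow>\<^sub>E UNIV \<and>
     (\<forall>j\<in>{1..N - s}. k j = 0 \<and> l j = 0) \<and>
     sorted_wrt mprec (map l [Suc (N - s)..<Suc N]) \<and>
     (\<forall>j\<in>{Suc (N - s)..N}. K (l j) = k j) \<and>
     l ` {Suc (N - s)..N} = {a. 0 < mabs a \<and> mabs a \<le> N \<and> K a \<noteq> 0})"

lemma set_map_upt_Suc: "set (map l [Suc (N - s)..<Suc N]) = l ` {Suc (N - s)..N}"
  by (simp only: set_map set_upt atLeastLessThanSuc_atLeastAtMost)

text \<open>A finite set has only one strictly increasing enumeration. Its length fixes
  \<open>s\<close>, and with it the padding.\<close>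

lemma faa_lists_unique:
  assumes "faa_lists N k l K" "faa_lists N k' l' K"
  shows "k = k' \<and> l = l'"
proof -
  let ?S = "{a. 0 < mabs a \<and> mabs a \<le> N \<and> K a \<noteq> 0}"
  obtain s where s: "s \<le> N" "k \<in> {1..N} \<rightarrow>\<^sub>E UNIV" "l \<in> {1..N} \<rightarrow>\<^sub>E UNIV"
     "\<forall>j\<in>{1..N - s}. k j = 0 \<and> l j = 0"
     "sorted_wrt mprec (map l [Suc (N - s)..<Suc N])"
     "\<forall>j\<in>{Suc (N - s)..N}. K (l j) = k j" "l ` {Suc (N - s)..N} = ?S"
    using assms(1) unfolding faa_lists_def by blast
  obtain s' where s': "s' \<le> N" "k' \<in> {1..N} \<rightarrow>\<^sub>E UNIV" "l' \<in> {1..N} \<rightarrow>\<^sub>E UNIV"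
     "\<forall>j\<in>{1..N - s'}. k' j = 0 \<and> l' j = 0"
     "sorted_wrt mprec (map l' [Suc (N - s')..<Suc N])"
     "\<forall>j\<in>{Suc (N - s')..N}. K (l' j) = k' j" "l' ` {Suc (N - s')..N} = ?S"
    using assms(2) unfolding faa_lists_def by blast
  have eq: "map l [Suc (N - s)..<Suc N] = map l' [Suc (N - s')..<Suc N]"
    by (rule linorder.strict_sorted_equal[OF mprec_linorder s'(5) s(5)])
       (simp only: set_map_upt_Suc s(7) s'(7))
  then have "length (map l [Suc (N - s)..<Suc N]) = length (map l' [Suc (N - s')..<Suc N])" by (rule arg_cong)
  then have ss: "s = s'" using s(1) s'(1) by (simp del: upt_Suc)
  have "\<forall>j\<in>{Suc (N - s)..N}. l j = l' j"
    using eq unfolding ss map_eq_conv set_upt atLeastLessThanSuc_atLeastAtMost .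
  then have l: "l j = l' j" if "j \<in> {Suc (N - s)..N}" for j
    using that by blast
  have k: "k j = k' j" if "j \<in> {Suc (N - s)..N}" for j
    using l[OF that] s(6) s'(6) that unfolding ss by metis
  have "k j = k' j \<and> l j = l' j" for j
  proof (cases "j \<in> {1..N}")
    case True
    then show ?thesis using l k s(4) s'(4) unfolding ss by (cases "j \<le> N - s'") auto
  next
    case False
    then show ?thesis using s(2,3) s'(2,3) by (auto simp: PiE_def extensional_def)
  qed
  then show ?thesis by blast
qed

text \<open>The cardinality bound ensures that the sorted support fits into \<open>N\<close>
  positions.\<close>

lemma faa_lists_exists:
  assumes "card {a. 0 < mabs a \<and> mabs a \<le> N \<and> K a \<noteq> 0} \<le> N"
  shows "\<exists>k l. faa_lists N k l K"
proof -
  let ?S = "{a. 0 < mabs a \<and> mabs a \<le> N \<and> K a \<noteq> 0}"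
  have "finite ?S" by (rule finite_subset[OF _ finite_mabs_le[of N]]) auto
  then obtain xs where xs: "sorted_wrt mprec xs" "set xs = ?S" "length xs = card ?S"
    using linorder.finite_set_strict_sorted[OF mprec_linorder] by blast
  define s where "s = length xs"
  \<comment> \<open>The sorted list occupies the last \<open>s\<close> positions, starting at
    \<open>Suc (N - s)\<close>; earlier positions are zero, and outside \<open>{1..N}\<close>
    extensionality demands \<open>undefined\<close>.\<close>
  define l where "l j = (if j \<in> {Suc (N - s)..N} then xs ! (j - Suc (N - s)) else if j \<in> {1..N} then 0 else undefined)" for j
  define k where "k j = (if j \<in> {Suc (N - s)..N} then K (l j) else if j \<in> {1..N} then 0 else undefined)" for j
  have s: "s \<le> N" using assms xs(3) by (simp add: s_def)
  have map: "map l [Suc (N - s)..<Suc N] = xs"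
    by (rule nth_equalityI) (use s in \<open>auto simp: s_def[symmetric] l_def simp del: upt_Suc\<close>)
  have "faa_lists N k l K"
    unfolding faa_lists_def
  proof (intro exI[of _ s] conjI)
    show "k \<in> {1..N} \<rightarrow>\<^sub>E UNIV" "l \<in> {1..N} \<rightarrow>\<^sub>E UNIV" by (auto simp: k_def l_def)
    show "\<forall>j\<in>{1..N - s}. k j = 0 \<and> l j = 0" by (auto simp: k_def l_def)
    show "\<forall>j\<in>{Suc (N - s)..N}. K (l j) = k j" by (auto simp: k_def)
    show "sorted_wrt mprec (map l [Suc (N - s)..<Suc N])" unfolding map by (rule xs)
    show "l ` {Suc (N - s)..N} = ?S" using xs(2) map set_map_upt_Suc by metis
  qed (rule s)
  then show ?thesis by blast
qed

text \<open>Placed in \<open>comm_monoid_set\<close> because it is used for sums (the two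
  constraints on a tuple) and for products (the terms of the formula). The condition on
  \<open>g\<close> makes the padding and the multi-indices outside the support of \<open>K\<close>
  neutral.\<close>

lemma (in comm_monoid_set) faa_lists_reindex:
  fixes g :: "nat ^ 'd::{finite,linorder} \<Rightarrow> nat ^ 'd::_ \<Rightarrow> 'a"
  assumes "faa_lists N k l K" and g: "\<And>a. g a 0 = \<^bold>1"
  shows "F (\<lambda>j. g (l j) (k j)) {1..N} = F (\<lambda>a. g a (K a)) {a. 0 < mabs a \<and> mabs a \<le> N}"
proof -
  let ?S = "{a. 0 < mabs a \<and> mabs a \<le> N \<and> K a \<noteq> 0}"
  obtain s where s: "s \<le> N" 
     "\<forall>j\<in>{1..N - s}. k j = 0 \<and> l j = 0"
     "sorted_wrt mprec (map l [Suc (N - s)..<Suc N])"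
     "\<forall>j\<in>{Suc (N - s)..N}. K (l j) = k j" "l ` {Suc (N - s)..N} = ?S"
    using assms(1) unfolding faa_lists_def by blast
  have "distinct (map l [Suc (N - s)..<Suc N])"
    using linorder.strict_sorted_iff[OF mprec_linorder] s(3) by blast
  then have inj: "inj_on l {Suc (N - s)..N}"
    by (simp only: distinct_map set_upt atLeastLessThanSuc_atLeastAtMost)
  have "F (\<lambda>j. g (l j) (k j)) {1..N} = F (\<lambda>j. g (l j) (k j)) {Suc (N - s)..N}"
    by (rule mono_neutral_right) (use s(2) g in \<open>auto simp: not_le\<close>)
  also have "\<dots> = F (\<lambda>j. g (l j) (K (l j))) {Suc (N - s)..N}"
    using s(4) by (intro cong) auto
  also have "\<dots> = F (\<lambda>a. g a (K a)) ?S"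
    unfolding s(5)[symmetric] by (simp add: reindex[OF inj])
  also have "\<dots> = F (\<lambda>a. g a (K a)) {a. 0 < mabs a \<and> mabs a \<le> N}"
    by (rule mono_neutral_left) (use g in \<open>auto intro: finite_subset[OF _ finite_mabs_le[of N]]\<close>)
  finally show ?thesis .
qed

text \<open>The two maps could a priori belong to different values of \<open>s\<close>. Where
  \<open>K\<close> is nonzero, the matching position carries a nonzero \<open>k j\<close>, hence
  lies outside the padding for \<open>K'\<close> as well, so \<open>K'\<close> takes the same value
  there; then the roles are exchanged.\<close>

lemma faa_lists_determine:
  assumes "faa_lists N k l K" "faa_lists N k l K'"
    "K \<in> {a. 0 < mabs a \<and> mabs a \<le> N} \<rightarrow>\<^sub>E UNIV" "K' \<in> {a. 0 < mabs a \<and> mabs a \<le> N} \<rightarrow>\<^sub>E UNIV"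
  shows "K = K'"
proof -
  have *: "K' a = K a" if L: "faa_lists N k l K" and L': "faa_lists N k l K'"
    and a: "0 < mabs a" "mabs a \<le> N" "K a \<noteq> 0" for K K' a
  proof -
    obtain s where s: "s \<le> N" "\<forall>j\<in>{Suc (N - s)..N}. K (l j) = k j"
        "l ` {Suc (N - s)..N} = {a. 0 < mabs a \<and> mabs a \<le> N \<and> K a \<noteq> 0}"
      using L unfolding faa_lists_def by blast
    obtain s' where s': "s' \<le> N" "\<forall>j\<in>{1..N - s'}. k j = 0 \<and> l j = 0"
       "\<forall>j\<in>{Suc (N - s')..N}. K' (l j) = k j"
      using L' unfolding faa_lists_def by blast
    have "a \<in> l ` {Suc (N - s)..N}" using a unfolding s(3) by simp
    then obtain j where j: "a = l j" "j \<in> {Suc (N - s)..N}" by blast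
    then have "k j = K a" using s(2) by auto
    moreover have "j \<in> {Suc (N - s')..N}"
    proof (rule ccontr)
      assume "j \<notin> {Suc (N - s')..N}"
      then have "j \<in> {1..N - s'}" using j(2) by auto
      then show False using s'(2) \<open>k j = K a\<close> a(3) by simp
    qed
    ultimately show ?thesis using s'(3) j(1) by auto
  qed
  show ?thesis
  proof
    fix a
    show "K a = K' a"
    proof (cases "0 < mabs a \<and> mabs a \<le> N")
      case True
      then show ?thesis using *[OF assms(1,2), of a] *[OF assms(2,1), of a] by fastforce
    next
      case False
      then show ?thesis using assms(3,4) by (auto simp: PiE_def extensional_def)
    qed
  qed
qed

text \<open>Links the ordered tuples to maps on multi-indices, the form in which the multinomial
  theorem produces its terms.\<close>

lemma faa_indices_iff:
  fixes \<beta> \<mu> :: "nat ^ 'd::{finite,linorder}"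
  assumes "\<beta> \<noteq> 0"
  defines "A \<equiv> {a. 0 < mabs a \<and> mabs a \<le> mabs \<beta>}"
  shows "(k, l) \<in> faa_indices \<beta> \<mu> \<longleftrightarrow>
    (\<exists>K\<in>msplits A \<mu>. (\<Sum>a\<in>A. mabs (K a) *s a) = \<beta> \<and> faa_lists (mabs \<beta>) k l K)"
proof
  define N where "N = mabs \<beta>"
  have N: "N > 0" using assms(1) by (metis N_def mabs_eq_0_iff neq0_conv)
  assume kl: "(k, l) \<in> faa_indices \<beta> \<mu>"
  then have ext: "k \<in> {1..N} \<rightarrow>\<^sub>E UNIV" "l \<in> {1..N} \<rightarrow>\<^sub>E UNIV"
    and k_sum: "(\<Sum>j=1..N. k j) = \<mu>" and l_sum: "(\<Sum>j=1..N. mabs (k j) *s l j) = \<beta>"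
    unfolding faa_indices_def using assms(1) by (simp_all add: N_def split_beta)
  obtain s where "s \<in> {1..N}" and zero: "\<forall>j\<in>{1..N - s}. k j = 0 \<and> l j = 0"
    and pos: "\<forall>j\<in>{N - s + 1..N}. mabs (k j) > 0" and first: "mprec 0 (l (N - s + 1))"
    and succ: "\<forall>j\<in>{N - s + 1..<N}. mprec (l j) (l (j + 1))"
    using kl unfolding faa_indices_def using assms(1) by (auto simp: N_def split_beta)
  then have s: "1 \<le> s" "s \<le> N" by auto
  define J where "J = {Suc (N - s)..N}"
  \<comment> \<open>Only neighbours are compared in \<open>faa_indices\<close>; transitivity extends
    this to the whole list.\<close>
  have sorted: "sorted_wrt mprec (map l [Suc (N - s)..<Suc N])"
  proof (subst sorted_wrt_iff_nth_Suc_transp)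
    show "transp mprec" by (rule transpI) (rule mprec_trans)
    show "\<forall>i. Suc i < length (map l [Suc (N - s)..<Suc N]) \<longrightarrow>
       mprec (map l [Suc (N - s)..<Suc N] ! i) (map l [Suc (N - s)..<Suc N] ! Suc i)"
    proof (intro allI impI)
      fix i assume "Suc i < length (map l [Suc (N - s)..<Suc N])"
      then have i: "Suc i < s" using s by (simp del: upt_Suc)
      then have "mprec (l (Suc (N - s) + i)) (l (Suc (N - s) + i + 1))"
        using s by (intro succ[rule_format]) auto
      then show "mprec (map l [Suc (N - s)..<Suc N] ! i) (map l [Suc (N - s)..<Suc N] ! Suc i)"
        using i s by (simp del: upt_Suc)
    qed
  qed
  then have "distinct (map l [Suc (N - s)..<Suc N])"
    using linorder.strict_sorted_iff[OF mprec_linorder] by blast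
  then have inj: "inj_on l J"
    unfolding J_def by (simp only: distinct_map set_upt atLeastLessThanSuc_atLeastAtMost)
  have nonzero: "l j \<noteq> 0" if j: "j \<in> J" for j
  proof (cases "j = Suc (N - s)")
    case True
    then show ?thesis using first by (simp add: zero_mprec_iff)
  next
    case False
    then have "mprec (map l [Suc (N - s)..<Suc N] ! 0) (map l [Suc (N - s)..<Suc N] ! (j - Suc (N - s)))"
      using j s by (intro sorted_wrt_nth_less[OF sorted]) (auto simp: J_def simp del: upt_Suc)
    then have "mprec (l (Suc (N - s))) (l j)" using j s by (auto simp: J_def simp del: upt_Suc)
    then have "mprec 0 (l j)" using first mprec_trans by simp blast
    then show ?thesis by (simp add: zero_mprec_iff)
  qed
  \<comment> \<open>Each \<open>l j\<close> enters the sum for \<open>\<beta>\<close> with weight at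
    least 1, so it cannot be longer than \<open>\<beta>\<close>.\<close>
  have in_A: "l j \<in> A" if j: "j \<in> J" for j
  proof -
    have "mabs (l j) \<le> mabs (k j) * mabs (l j)" using pos j by (auto simp: J_def Suc_le_eq)
    also have "\<dots> \<le> (\<Sum>j=1..N. mabs (k j) * mabs (l j))"
      using j by (intro member_le_sum) (auto simp: J_def)
    also have "\<dots> = mabs (\<Sum>j=1..N. mabs (k j) *s l j)"
      by (simp add: mabs_sum) (simp add: mabs_def sum_distrib_left)
    also have "\<dots> = N" unfolding l_sum by (simp add: N_def)
    finally show ?thesis using nonzero[OF j] by (metis (mono_tags, lifting) A_def N_def mabs_eq_0_iff mem_Collect_eq neq0_conv)
  qed
  \<comment> \<open>The sum over the fibre inverts \<open>l\<close>: by injectivity it has at most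
    one term, and it is 0 where \<open>l\<close> takes no value.\<close>
  define K where "K a = (if a \<in> A then \<Sum>j | j \<in> J \<and> l j = a. k j else undefined)" for a
  have Kl: "K (l j) = k j" if j: "j \<in> J" for j
  proof -
    have "{i. i \<in> J \<and> l i = l j} = {j}" using inj j by (auto simp: inj_on_def)
    then show ?thesis using in_A[OF j] by (simp add: K_def)
  qed
  have supp: "l ` J = {a. 0 < mabs a \<and> mabs a \<le> N \<and> K a \<noteq> 0}"
  proof (intro equalityI subsetI)
    fix a assume "a \<in> l ` J"
    then obtain j where j: "j \<in> J" "a = l j" by blast
    have "0 < mabs (k j)" using pos j(1) by (simp add: J_def)
    then have "K a \<noteq> 0" using Kl[OF j(1)] j(2) by auto
    then show "a \<in> {a. 0 < mabs a \<and> mabs a \<le> N \<and> K a \<noteq> 0}"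
      using in_A[OF j(1)] j(2) by (simp add: A_def N_def)
  next
    fix a assume a: "a \<in> {a. 0 < mabs a \<and> mabs a \<le> N \<and> K a \<noteq> 0}"
    then have "(\<Sum>j | j \<in> J \<and> l j = a. k j) \<noteq> 0" by (auto simp: K_def A_def N_def)
    then have "{j. j \<in> J \<and> l j = a} \<noteq> {}" by (metis sum.empty)
    then show "a \<in> l ` J" by auto
  qed
  have L: "faa_lists N k l K"
    unfolding faa_lists_def
    using s(2) ext zero sorted Kl supp[unfolded J_def] by (intro exI[of _ s] conjI ballI) (simp_all add: J_def del: upt_Suc)
  have "(\<Sum>a\<in>A. K a) = \<mu>"
    using sum.faa_lists_reindex[OF L, of "\<lambda>_ \<kappa>. \<kappa>"] k_sum by (simp add: A_def N_def)
  moreover have "(\<Sum>a\<in>A. mabs (K a) *s a) = \<beta>"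
    using sum.faa_lists_reindex[OF L, of "\<lambda>a \<kappa>. mabs \<kappa> *s a"] l_sum by (simp add: A_def N_def)
  moreover have "K \<in> A \<rightarrow>\<^sub>E UNIV" by (auto simp: K_def)
  ultimately show "\<exists>K\<in>msplits A \<mu>. (\<Sum>a\<in>A. mabs (K a) *s a) = \<beta> \<and> faa_lists (mabs \<beta>) k l K"
    using L by (auto simp: msplits_def N_def)
next
  define N where "N = mabs \<beta>"
  assume "\<exists>K\<in>msplits A \<mu>. (\<Sum>a\<in>A. mabs (K a) *s a) = \<beta> \<and> faa_lists (mabs \<beta>) k l K"
  then obtain K where K: "K \<in> msplits A \<mu>" "(\<Sum>a\<in>A. mabs (K a) *s a) = \<beta>" and L: "faa_lists N k l K"
    by (auto simp: N_def)
  obtain s where s: "s \<le> N" and ext: "k \<in> {1..N} \<rightarrow>\<^sub>E UNIV" "l \<in> {1..N} \<rightarrow>\<^sub>E UNIV"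
    and zero: "\<forall>j\<in>{1..N - s}. k j = 0 \<and> l j = 0"
    and sorted: "sorted_wrt mprec (map l [Suc (N - s)..<Suc N])"
    and Kl: "\<forall>j\<in>{Suc (N - s)..N}. K (l j) = k j"
    and supp: "l ` {Suc (N - s)..N} = {a. 0 < mabs a \<and> mabs a \<le> N \<and> K a \<noteq> 0}"
    using L unfolding faa_lists_def by blast
  have k_sum: "(\<Sum>j=1..N. k j) = \<mu>"
    using sum.faa_lists_reindex[OF L, of "\<lambda>_ \<kappa>. \<kappa>"] K by (simp add: A_def N_def msplits_def)
  have l_sum: "(\<Sum>j=1..N. mabs (k j) *s l j) = \<beta>"
    using sum.faa_lists_reindex[OF L, of "\<lambda>a \<kappa>. mabs \<kappa> *s a"] K by (simp add: A_def N_def)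
  have lj: "0 < mabs (l j)" "k j \<noteq> 0" if "j \<in> {Suc (N - s)..N}" for j
  proof -
    have "l j \<in> {a. 0 < mabs a \<and> mabs a \<le> N \<and> K a \<noteq> 0}" using that supp by blast
    then show "0 < mabs (l j)" "k j \<noteq> 0" using Kl that by auto
  qed
  \<comment> \<open>With \<open>s = 0\<close> every entry is padding and the weighted sum is 0,
    contrary to \<open>\<beta> \<noteq> 0\<close>.\<close>
  have "s \<noteq> 0"
  proof
    assume "s = 0"
    then have "(\<Sum>j=1..N. mabs (k j) *s l j) = 0" using zero by (intro sum.neutral) auto
    then show False using l_sum assms(1) by simp
  qed
  then have s1: "s \<in> {1..N}" using s by simp
  have "mprec (l j) (l (j + 1))" if "j \<in> {N - s + 1..<N}" for j
  proof -
    have "mprec (map l [Suc (N - s)..<Suc N] ! (j - Suc (N - s))) (map l [Suc (N - s)..<Suc N] ! (j - (N - s)))"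
      using that by (intro sorted_wrt_nth_less[OF sorted]) (auto simp del: upt_Suc)
    then show ?thesis using that by (auto simp del: upt_Suc)
  qed
  moreover have "mprec 0 (l (N - s + 1))"
  proof -
    have "Suc (N - s) \<in> {Suc (N - s)..N}" using s1 by auto
    from lj(1)[OF this] show ?thesis unfolding zero_mprec_iff by auto
  qed
  moreover have "\<forall>j\<in>{N - s + 1..N}. mabs (k j) > 0"
  proof
    fix j assume "j \<in> {N - s + 1..N}"
    then have "mabs (k j) \<noteq> 0" using lj(2)[of j] by simp
    then show "0 < mabs (k j)" by blast
  qed
  ultimately show "(k, l) \<in> faa_indices \<beta> \<mu>"
    unfolding faa_indices_def using assms(1) s1 ext zero k_sum l_sum by (auto simp: N_def[symmetric])
qed

text \<open>The correspondence between maps and tuples is made into a bijection \<open>h\<close>,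
  along which the sum is reindexed.\<close>

lemma sum_faa_indices:
  fixes g :: "nat ^ 'd::{finite,linorder} \<Rightarrow> nat ^ 'd::_ \<Rightarrow> real"
  assumes g: "\<And>a. g a 0 = 1"
  defines "A \<equiv> \<lambda>\<beta> :: nat ^ 'd::_. {a :: nat ^ 'd::_. 0 < mabs a \<and> mabs a \<le> mabs \<beta>}"
  shows "(\<Sum>(k, l)\<in>faa_indices \<beta> \<mu>. \<Prod>j=1..mabs \<beta>. g (l j) (k j)) =
    (\<Sum>K | K \<in> msplits (A \<beta>) \<mu> \<and> (\<Sum>a\<in>A \<beta>. mabs (K a) *s a) = \<beta>. \<Prod>a\<in>A \<beta>. g a (K a))"
proof (cases "\<beta> = 0")
  case True
  \<comment> \<open>For \<open>\<beta> = 0\<close> both index sets are singletons if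
    \<open>\<mu> = 0\<close> and empty otherwise, and all products are empty.\<close>
  then have "A \<beta> = {}" by (auto simp: A_def)
  then have "{K. K \<in> msplits (A \<beta>) \<mu> \<and> (\<Sum>a\<in>A \<beta>. mabs (K a) *s a) = \<beta>} = (if \<mu> = 0 then {\<lambda>_. undefined} else {})"
    using True by (auto simp: msplits_def)
  then show ?thesis using True \<open>A \<beta> = {}\<close> by (auto simp: faa_indices_def)
next
  case False
  define N where "N = mabs \<beta>"
  define Q where "Q = {K. K \<in> msplits (A \<beta>) \<mu> \<and> (\<Sum>a\<in>A \<beta>. mabs (K a) *s a) = \<beta>}"
  define h where "h K = (SOME p. faa_lists N (fst p) (snd p) K)" for K :: "nat ^ 'd::_ \<Rightarrow> nat ^ 'd::_"
  have h: "faa_lists N (fst (h K)) (snd (h K)) K" if K: "K \<in> Q" for K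
  proof -
    let ?S = "{a. 0 < mabs a \<and> mabs a \<le> N \<and> K a \<noteq> 0}"
    \<comment> \<open>Every multi-index in the support contributes at least 1 to the total length
      \<open>N\<close>, so the support has at most \<open>N\<close> elements.\<close>
    have "card ?S = (\<Sum>a\<in>?S. 1)" by simp
    also have "\<dots> \<le> (\<Sum>a\<in>?S. mabs (K a) * mabs a)"
    proof (rule sum_mono)
      fix a assume "a \<in> ?S"
      then have "mabs (K a) \<noteq> 0" "mabs a \<noteq> 0" by auto
      then show "1 \<le> mabs (K a) * mabs a" by (metis One_nat_def Suc_leI mult_pos_pos neq0_conv)
    qed
    also have "\<dots> \<le> (\<Sum>a\<in>A \<beta>. mabs (K a) * mabs a)"
      by (rule sum_mono2) (auto simp: A_def N_def intro: finite_subset[OF _ finite_mabs_le[of "mabs \<beta>"]])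
    also have "\<dots> = mabs (\<Sum>a\<in>A \<beta>. mabs (K a) *s a)"
      by (simp add: mabs_sum) (simp add: mabs_def sum_distrib_left)
    also have "\<dots> = N" using K by (simp add: Q_def N_def)
    finally obtain k l where "faa_lists N k l K" using faa_lists_exists by blast
    then show ?thesis unfolding h_def by (intro someI[of "\<lambda>p. faa_lists N (fst p) (snd p) K" "(k, l)"]) simp
  qed
  have "bij_betw h Q (faa_indices \<beta> \<mu>)"
    unfolding bij_betw_def
  proof
    show "inj_on h Q"
    proof (rule inj_onI)
      fix K K' assume K: "K \<in> Q" "K' \<in> Q" "h K = h K'"
      then have "faa_lists N (fst (h K)) (snd (h K)) K'" using h[OF K(2)] by simp
      with h[OF K(1)] show "K = K'"
        by (rule faa_lists_determine) (use K(1,2) in \<open>simp_all add: Q_def msplits_def A_def N_def\<close>)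
    qed
    show "h ` Q = faa_indices \<beta> \<mu>"
    proof (intro equalityI subsetI)
      fix p assume "p \<in> h ` Q"
      then obtain K where "K \<in> Q" "p = h K" by blast
      then show "p \<in> faa_indices \<beta> \<mu>"
        using h[of K] faa_indices_iff[OF False, of "fst p" "snd p" \<mu>] by (auto simp: Q_def A_def N_def)
    next
      fix p assume p: "p \<in> faa_indices \<beta> \<mu>"
      then obtain K where K: "K \<in> Q" "faa_lists N (fst p) (snd p) K"
        using faa_indices_iff[OF False, of "fst p" "snd p" \<mu>] by (auto simp: Q_def A_def N_def)
      then have "h K = p" using faa_lists_unique[OF h[OF K(1)] K(2)] by (simp add: prod_eq_iff)
      then show "p \<in> h ` Q" using K(1) by blast
    qed
  qed
  then have "(\<Sum>(k, l)\<in>faa_indices \<beta> \<mu>. \<Prod>j=1..mabs \<beta>. g (l j) (k j)) =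
    (\<Sum>K\<in>Q. case h K of (k, l) \<Rightarrow> \<Prod>j=1..mabs \<beta>. g (l j) (k j))"
    by (rule sum.reindex_bij_betw[symmetric])
  also have "\<dots> = (\<Sum>K\<in>Q. \<Prod>a\<in>A \<beta>. g a (K a))"
    using prod.faa_lists_reindex[OF h, of _ g] g by (intro sum.cong) (auto simp: split_beta A_def N_def)
  finally show ?thesis by (simp add: Q_def)
qed

section \<open>Derivatives of compositions and weighted compositions\<close>

theorem mderiv_compose:
  fixes f :: "real ^ 'd::{finite,linorder} \<Rightarrow> 'b::real_normed_vector" and \<theta> :: "real ^ 'd::_ \<Rightarrow> real ^ 'd::_"
  assumes f: "smooth f" and \<theta>: "smooth \<theta>"
  shows "mderiv \<beta> (\<lambda>y. f (\<theta> y)) x = (\<Sum>\<mu> | mabs \<mu> \<le> mabs \<beta>.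
    (\<Sum>(k, l)\<in>faa_indices \<beta> \<mu>. real (mfact \<beta>) *
       (\<Prod>j=1..mabs \<beta>. mpow (\<chi> i. mderiv (l j) (\<lambda>y. \<theta> y $ i) x) (k j) /
          (real (mfact (k j)) * real (mfact (l j)) ^ mabs (k j)))) *\<^sub>R mderiv \<mu> f (\<theta> x))"
proof -
  define N where "N = mabs \<beta>"
  define A where "A = {a :: nat ^ 'd::_. 0 < mabs a \<and> mabs a \<le> N}"
  define S where "S = {\<mu> :: nat ^ 'd::_. mabs \<mu> \<le> N}"
  define c where "c a = (1 / real (mfact a)) *\<^sub>R (\<chi> i. mderiv a (\<lambda>y. \<theta> y $ i) x)" for a
  \<comment> \<open>The Taylor polynomial of \<open>\<theta>\<close> with its constant term split
    off: the Taylor polynomial of \<open>f\<close> at \<open>\<theta> x\<close> sees only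
    \<open>\<Theta> y - \<theta> x\<close>, so \<open>A\<close> leaves out the index 0.\<close>
  define \<Theta> where "\<Theta> y = \<theta> x + (\<Sum>a\<in>A. mpow (y - x) a *\<^sub>R c a)" for y
  define T where "T = taylor N f (\<theta> x)"
  define e where "e K = (\<Sum>a\<in>A. mabs (K a) *s a)" for K :: "nat ^ 'd::_ \<Rightarrow> nat ^ 'd::_"
  define P where "P K = (\<Prod>a\<in>A. mpow (c a) (K a) / real (mfact (K a)))" for K
  have finA: "finite A" unfolding A_def by (rule finite_subset[OF _ finite_mabs_le[of N]]) auto
  have finS: "finite S" by (simp add: S_def)
  have S: "S = insert 0 A" by (auto simp: S_def A_def bot_nat_0.not_eq_extremum[symmetric])
  have smooth_\<theta>: "smooth (\<lambda>y. \<theta> y $ i)" for i by (rule smooth_nth[OF \<theta>])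
  have \<Theta>: "\<Theta> y $ i = taylor N (\<lambda>y. \<theta> y $ i) x y" for y i
  proof -
    have "taylor N (\<lambda>y. \<theta> y $ i) x y = (\<Sum>a\<in>insert 0 A. (mpow (y - x) a / real (mfact a)) *\<^sub>R mderiv a (\<lambda>y. \<theta> y $ i) x)"
      by (simp add: taylor_def S[symmetric] S_def)
    also have "\<dots> = \<theta> x $ i + (\<Sum>a\<in>A. (mpow (y - x) a / real (mfact a)) *\<^sub>R mderiv a (\<lambda>y. \<theta> y $ i) x)"
      by (subst sum.insert[OF finA]) (auto simp: A_def mfact_def)
    also have "\<dots> = \<Theta> y $ i" by (simp add: \<Theta>_def c_def)
    finally show ?thesis by simp
  qed
  have smooth_\<Theta>: "smooth (\<lambda>y. \<Theta> y $ i)" for i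
    unfolding \<Theta> by (rule smooth_taylor)
  have smooth_T: "smooth T" unfolding T_def by (rule smooth_taylor)
  have "mderiv \<beta> (\<lambda>y. f (\<theta> y)) x = mderiv \<beta> (\<lambda>y. T (\<theta> y)) x"
  proof (rule mderiv_eq_if_vanish[where N = N])
    show "smooth (\<lambda>y. f (\<theta> y))" "smooth (\<lambda>y. T (\<theta> y))"
      using smooth_compose[of f \<theta>] smooth_compose[of T \<theta>] f smooth_T smooth_\<theta> by auto
    show "vanish N (\<lambda>y. f (\<theta> y) - T (\<theta> y)) x"
      using vanish_compose[of \<theta> "\<lambda>z. f z - T z" N x] smooth_\<theta> f smooth_T
      by (auto simp: smooth_diff vanish_taylor T_def)
  qed (simp add: N_def)
  also have "\<dots> = mderiv \<beta> (\<lambda>y. T (\<Theta> y)) x"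
  proof (rule mderiv_eq_if_vanish[where N = N])
    show "smooth (\<lambda>y. T (\<Theta> y))" "smooth (\<lambda>y. T (\<theta> y))"
      using smooth_compose[of T \<Theta>] smooth_compose[of T \<theta>] smooth_\<Theta> smooth_T smooth_\<theta> by auto
    show "vanish N (\<lambda>y. T (\<theta> y) - T (\<Theta> y)) x"
      by (rule vanish_compose_diff[OF smooth_\<theta> smooth_\<Theta> smooth_T]) (simp add: \<Theta> vanish_taylor smooth_\<theta>)
  qed (simp add: N_def)
  also have "(\<lambda>y. T (\<Theta> y)) = (\<lambda>y. \<Sum>\<mu>\<in>S. \<Sum>K\<in>msplits A \<mu>. (mpow (y - x) (e K) / 1) *\<^sub>R (P K *\<^sub>R mderiv \<mu> f (\<theta> x)))"
  proof
    fix y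
    \<comment> \<open>The powers of \<open>y - x\<close> collect into one monomial of exponent
      \<open>e K\<close>; the rest, \<open>P K\<close>, does not depend on \<open>y\<close>.\<close>
    have "mpow (\<Theta> y - \<theta> x) \<mu> / real (mfact \<mu>) = (\<Sum>K\<in>msplits A \<mu>. mpow (y - x) (e K) * P K)" for \<mu>
    proof -
      have "mpow (\<Theta> y - \<theta> x) \<mu> / real (mfact \<mu>) = (\<Sum>K\<in>msplits A \<mu>.
          \<Prod>a\<in>A. mpow (mpow (y - x) a *\<^sub>R c a) (K a) / real (mfact (K a)))"
        using mpow_sum_multinomial[OF finA] by (simp add: \<Theta>_def)
      also have "\<dots> = (\<Sum>K\<in>msplits A \<mu>. (\<Prod>a\<in>A. mpow (y - x) a ^ mabs (K a)) * P K)"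
        by (simp add: mpow_scaleR P_def prod.distrib flip: times_divide_eq_right)
      also have "\<dots> = (\<Sum>K\<in>msplits A \<mu>. mpow (y - x) (e K) * P K)"
        by (simp add: e_def mpow_sum mpow_smult)
      finally show ?thesis .
    qed
    then show "T (\<Theta> y) = (\<Sum>\<mu>\<in>S. \<Sum>K\<in>msplits A \<mu>. (mpow (y - x) (e K) / 1) *\<^sub>R (P K *\<^sub>R mderiv \<mu> f (\<theta> x)))"
      by (simp add: T_def taylor_def S_def scaleR_sum_left)
  qed
  \<comment> \<open>The derivative at \<open>x\<close> keeps the \<open>K\<close> with
    \<open>e K = \<beta>\<close>, the second sum condition of \<open>faa_indices\<close>; the first
    one is membership in \<open>msplits A \<mu>\<close>.\<close>
  also have "mderiv \<beta> \<dots> x = (\<Sum>\<mu>\<in>S. \<Sum>K\<in>msplits A \<mu>. if \<beta> = e K then (real (mfact \<beta>) / 1) *\<^sub>R (P K *\<^sub>R mderiv \<mu> f (\<theta> x)) else 0)"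
  proof -
    have sm: "smooth (\<lambda>y. (mpow (y - x) (e K) / 1) *\<^sub>R (P K *\<^sub>R mderiv \<mu> f (\<theta> x)))" for K \<mu>
      by (rule smooth_mpow_scaleR)
    show ?thesis
      unfolding mderiv_sum[OF smooth_sum[OF sm]] mderiv_sum[OF sm] mderiv_mpow_scaleR ..
  qed
  also have "\<dots> = (\<Sum>\<mu>\<in>S. (real (mfact \<beta>) * (\<Sum>K | K \<in> msplits A \<mu> \<and> e K = \<beta>. P K)) *\<^sub>R mderiv \<mu> f (\<theta> x))"
  proof (rule sum.cong[OF refl])
    fix \<mu>
    have "(\<Sum>K\<in>msplits A \<mu>. if \<beta> = e K then (real (mfact \<beta>) / 1) *\<^sub>R (P K *\<^sub>R mderiv \<mu> f (\<theta> x)) else 0) =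
      (\<Sum>K | K \<in> msplits A \<mu> \<and> \<beta> = e K. (real (mfact \<beta>) * P K) *\<^sub>R mderiv \<mu> f (\<theta> x))"
      by (simp add: sum.If_cases[OF finite_msplits[OF finA]] Int_def)
    then show "(\<Sum>K\<in>msplits A \<mu>. if \<beta> = e K then (real (mfact \<beta>) / 1) *\<^sub>R (P K *\<^sub>R mderiv \<mu> f (\<theta> x)) else 0) =
      (real (mfact \<beta>) * (\<Sum>K | K \<in> msplits A \<mu> \<and> e K = \<beta>. P K)) *\<^sub>R mderiv \<mu> f (\<theta> x)"
      by (simp add: sum_distrib_left scaleR_sum_left eq_commute[of \<beta>])
  qed
  also have "\<dots> = (\<Sum>\<mu>\<in>S. (\<Sum>(k, l)\<in>faa_indices \<beta> \<mu>. real (mfact \<beta>) *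
       (\<Prod>j=1..mabs \<beta>. mpow (\<chi> i. mderiv (l j) (\<lambda>y. \<theta> y $ i) x) (k j) /
          (real (mfact (k j)) * real (mfact (l j)) ^ mabs (k j)))) *\<^sub>R mderiv \<mu> f (\<theta> x))"
  proof (rule sum.cong[OF refl], rule arg_cong[where f = "\<lambda>r. r *\<^sub>R _"])
    fix \<mu>
    have eq1: "(\<Sum>K | K \<in> msplits A \<mu> \<and> e K = \<beta>. P K) =
      (\<Sum>(k, l)\<in>faa_indices \<beta> \<mu>. \<Prod>j=1..mabs \<beta>. mpow (c (l j)) (k j) / real (mfact (k j)))"
      unfolding P_def e_def A_def N_def
      by (rule sum_faa_indices[symmetric, where g = "\<lambda>a \<kappa>. mpow (c a) \<kappa> / real (mfact \<kappa>)"]) (simp add: mfact_def)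
    \<comment> \<open>The factorials of \<open>l j\<close> in the formula stem from the Taylor
      coefficients \<open>c\<close>; homogeneity raises them to the power
      \<open>mabs \<kappa>\<close>.\<close>
    have eq2: "mpow (c a) \<kappa> / real (mfact \<kappa>) = mpow (\<chi> i. mderiv a (\<lambda>y. \<theta> y $ i) x) \<kappa> /
          (real (mfact \<kappa>) * real (mfact a) ^ mabs \<kappa>)" for a \<kappa>
      unfolding c_def mpow_scaleR by (simp add: power_divide)
    show "real (mfact \<beta>) * (\<Sum>K | K \<in> msplits A \<mu> \<and> e K = \<beta>. P K) =
      (\<Sum>(k, l)\<in>faa_indices \<beta> \<mu>. real (mfact \<beta>) *
       (\<Prod>j=1..mabs \<beta>. mpow (\<chi> i. mderiv (l j) (\<lambda>y. \<theta> y $ i) x) (k j) /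
          (real (mfact (k j)) * real (mfact (l j)) ^ mabs (k j))))"
      unfolding eq1 eq2 by (simp add: sum_distrib_left split_beta)
  qed
  finally show ?thesis by (simp add: S_def N_def)
qed

lemma mindex_le_mabs: "\<beta> \<le> \<alpha> \<Longrightarrow> mabs \<beta> \<le> mabs \<alpha>"
  by (simp add: mabs_def less_eq_vec_def sum_mono)

theorem mderiv_weighted_compose:
  fixes f \<eta> :: "real ^ 'd::{finite,linorder} \<Rightarrow> complex" and \<theta> :: "real ^ 'd::_ \<Rightarrow> real ^ 'd::_"
  assumes f: "smooth f" and \<theta>: "smooth \<theta>" and \<eta>: "smooth \<eta>"
  shows "mderiv \<alpha> (\<lambda>y. \<eta> y * f (\<theta> y)) x = (\<Sum>\<mu> | mabs \<mu> \<le> mabs \<alpha>. faa_coeff \<alpha> \<mu> \<theta> \<eta> x * mderiv \<mu> f (\<theta> x))"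
proof -
  define B where "B \<beta> \<mu> = (\<Sum>(k, l)\<in>faa_indices \<beta> \<mu>. real (mfact \<beta>) *
       (\<Prod>j=1..mabs \<beta>. mpow (\<chi> i. mderiv (l j) (\<lambda>y. \<theta> y $ i) x) (k j) /
          (real (mfact (k j)) * real (mfact (l j)) ^ mabs (k j))))" for \<beta> \<mu>
  define C where "C \<beta> \<mu> = of_nat (mchoose \<alpha> \<beta>) * mderiv (\<alpha> - \<beta>) \<eta> x * complex_of_real (B \<beta> \<mu>)" for \<beta> \<mu>
  let ?D = "\<lambda>\<mu>. mderiv \<mu> f (\<theta> x)"
  have "smooth (\<lambda>y. f (\<theta> y))" using smooth_compose[OF f] smooth_nth[OF \<theta>] by blast
  then have "mderiv \<alpha> (\<lambda>y. \<eta> y * f (\<theta> y)) x =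
    (\<Sum>\<beta> | \<beta> \<le> \<alpha>. real (mchoose \<alpha> \<beta>) *\<^sub>R (mderiv (\<alpha> - \<beta>) \<eta> x * mderiv \<beta> (\<lambda>y. f (\<theta> y)) x))"
    by (rule mderiv_bilinear[OF bounded_bilinear_mult \<eta>])
  also have "\<dots> = (\<Sum>\<beta> | \<beta> \<le> \<alpha>. \<Sum>\<mu> | mabs \<mu> \<le> mabs \<beta>. C \<beta> \<mu> * ?D \<mu>)"
    unfolding mderiv_compose[OF f \<theta>] B_def[symmetric]
    by (simp add: C_def sum_distrib_left scaleR_conv_of_real mult_ac)
  \<comment> \<open>The inner range becomes a restriction of a set independent of
    \<open>\<beta>\<close>, as the exchange of the sums requires; the restriction reappears in
    \<open>faa_coeff\<close>.\<close>
  also have "\<dots> = (\<Sum>\<beta> | \<beta> \<le> \<alpha>. \<Sum>\<mu> | \<mu> \<in> {\<mu>. mabs \<mu> \<le> mabs \<alpha>} \<and> mabs \<mu> \<le> mabs \<beta>. C \<beta> \<mu> * ?D \<mu>)"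
    by (intro sum.cong) (auto intro: order_trans[OF _ mindex_le_mabs])
  also have "\<dots> = (\<Sum>\<mu> | mabs \<mu> \<le> mabs \<alpha>. \<Sum>\<beta> | \<beta> \<in> {\<beta>. \<beta> \<le> \<alpha>} \<and> mabs \<mu> \<le> mabs \<beta>. C \<beta> \<mu> * ?D \<mu>)"
    by (rule sum.swap_restrict) auto
  also have "\<dots> = (\<Sum>\<mu> | mabs \<mu> \<le> mabs \<alpha>. faa_coeff \<alpha> \<mu> \<theta> \<eta> x * ?D \<mu>)"
    by (simp add: faa_coeff_def C_def B_def sum_distrib_right)
  finally show ?thesis .
qed

section \<open>The topology of the Schwartz space\<close>

lemma schwartz_smooth: "f \<in> schwartz \<Longrightarrow> smooth f"
  by (simp add: schwartz_def)

lemma le_schwartz_norm: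
  "f \<in> schwartz \<Longrightarrow> 0 < p \<Longrightarrow> (1 + norm x) powr p * cmod (mderiv \<alpha> f x) \<le> schwartz_norm p \<alpha> f"
  unfolding schwartz_norm_def by (rule cSUP_upper) (auto simp: schwartz_def)

lemma schwartz_norm_leI:
  "(\<And>x. (1 + norm x) powr p * cmod (mderiv \<alpha> f x) \<le> C) \<Longrightarrow> schwartz_norm p \<alpha> f \<le> C"
  unfolding schwartz_norm_def by (rule cSUP_least) auto

lemma schwartzI:
  "smooth f \<Longrightarrow> (\<And>p \<alpha>. 0 < p \<Longrightarrow> \<exists>C. \<forall>x. (1 + norm x) powr p * cmod (mderiv \<alpha> f x) \<le> C) \<Longrightarrow> f \<in> schwartz"
  by (auto simp: schwartz_def bdd_above_def)

lemma schwartz_norm_nonneg: 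
  assumes "f \<in> schwartz" "0 < p"
  shows "0 \<le> schwartz_norm p \<alpha> f"
  using le_schwartz_norm[OF assms, of 0 \<alpha>] by (rule order_trans[rotated]) simp

lemma mderiv_plus_fun:
  "f \<in> schwartz \<Longrightarrow> g \<in> schwartz \<Longrightarrow> mderiv \<alpha> (f + g) x = mderiv \<alpha> f x + mderiv \<alpha> g x"
  by (simp add: plus_fun_def mderiv_add schwartz_smooth)

lemma mderiv_fscale: "f \<in> schwartz \<Longrightarrow> mderiv \<alpha> (fscale c f) x = c * mderiv \<alpha> f x"
  by (simp add: fscale_def mderiv_linear[OF bounded_linear_mult_right] schwartz_smooth)

lemma weighted_mderiv_add_le:
  assumes "f \<in> schwartz" "g \<in> schwartz" "0 < p"
  shows "(1 + norm x) powr p * cmod (mderiv \<alpha> (f + g) x) \<le> schwartz_norm p \<alpha> f + schwartz_norm p \<alpha> g"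
proof -
  have "(1 + norm x) powr p * cmod (mderiv \<alpha> (f + g) x) \<le>
     (1 + norm x) powr p * (cmod (mderiv \<alpha> f x) + cmod (mderiv \<alpha> g x))"
    using assms by (intro mult_left_mono) (auto simp: mderiv_plus_fun norm_triangle_ineq)
  also have "\<dots> \<le> schwartz_norm p \<alpha> f + schwartz_norm p \<alpha> g"
    using le_schwartz_norm[OF assms(1,3), of x \<alpha>] le_schwartz_norm[OF assms(2,3), of x \<alpha>]
    by (simp add: distrib_left)
  finally show ?thesis .
qed

lemma weighted_mderiv_fscale_le:
  assumes "f \<in> schwartz" "0 < p"
  shows "(1 + norm x) powr p * cmod (mderiv \<alpha> (fscale c f) x) \<le> cmod c * schwartz_norm p \<alpha> f"
  using mult_left_mono[OF le_schwartz_norm[OF assms, of x \<alpha>], of "cmod c"]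
  by (simp add: mderiv_fscale assms norm_mult mult_ac)

lemma schwartz_add: "f \<in> schwartz \<Longrightarrow> g \<in> schwartz \<Longrightarrow> f + g \<in> schwartz"
  using weighted_mderiv_add_le by (intro schwartzI) (auto simp: plus_fun_def smooth_add schwartz_smooth, blast)

lemma schwartz_fscale: "f \<in> schwartz \<Longrightarrow> fscale c f \<in> schwartz"
  using weighted_mderiv_fscale_le
  by (intro schwartzI) (auto simp: fscale_def smooth_linear[OF bounded_linear_mult_right] schwartz_smooth, blast)

lemma schwartz_zero: "0 \<in> schwartz"
  by (rule schwartzI) (auto simp: zero_fun_def smooth_const)

lemma diff_eq_fscale: "g - f = g + fscale (- 1) f"
  by (simp add: fun_eq_iff fscale_def)

lemma schwartz_diff: "f \<in> schwartz \<Longrightarrow> g \<in> schwartz \<Longrightarrow> f - g \<in> schwartz"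
  unfolding diff_eq_fscale by (intro schwartz_add schwartz_fscale)

lemma schwartz_norm_add:
  "f \<in> schwartz \<Longrightarrow> g \<in> schwartz \<Longrightarrow> 0 < p \<Longrightarrow> schwartz_norm p \<alpha> (f + g) \<le> schwartz_norm p \<alpha> f + schwartz_norm p \<alpha> g"
  by (intro schwartz_norm_leI weighted_mderiv_add_le)

lemma schwartz_norm_fscale:
  assumes f: "f \<in> schwartz" and p: "0 < p"
  shows "schwartz_norm p \<alpha> (fscale c f) = cmod c * schwartz_norm p \<alpha> f"
proof (rule antisym)
  show *: "schwartz_norm p \<alpha> (fscale c f) \<le> cmod c * schwartz_norm p \<alpha> f"
    by (intro schwartz_norm_leI weighted_mderiv_fscale_le f p)
  show "cmod c * schwartz_norm p \<alpha> f \<le> schwartz_norm p \<alpha> (fscale c f)"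
  proof (cases "c = 0")
    case True
    then show ?thesis using schwartz_norm_nonneg[OF schwartz_fscale[OF f] p] by simp
  next
    case False
    have "schwartz_norm p \<alpha> (fscale (inverse c) (fscale c f)) \<le> cmod (inverse c) * schwartz_norm p \<alpha> (fscale c f)"
      by (intro schwartz_norm_leI weighted_mderiv_fscale_le schwartz_fscale f p)
    moreover have "fscale (inverse c) (fscale c f) = f" using False by (simp add: fscale_def fun_eq_iff flip: mult.assoc)
    ultimately show ?thesis using False by (simp add: norm_inverse norm_divide field_simps)
  qed
qed

text \<open>Finite sums of the norms are directed: their balls around a point form a neighbourhood
  basis, whereas the balls of single norms only generate the topology.\<close>

definition fin_norm :: "(real \<times> (nat ^ 'd::{finite,linorder})) set \<Rightarrow> (real ^ 'd::_ \<Rightarrow> complex) \<Rightarrow> real" where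
  "fin_norm F f = (\<Sum>(p, \<alpha>)\<in>F. schwartz_norm p \<alpha> f)"

definition norm_index :: "(real \<times> (nat ^ 'd::{finite,linorder})) set \<Rightarrow> bool" where
  "norm_index F \<longleftrightarrow> finite F \<and> (\<forall>(p, \<alpha>)\<in>F. 0 < p)"

lemma norm_index_Un: "norm_index F \<Longrightarrow> norm_index G \<Longrightarrow> norm_index (F \<union> G)"
  by (auto simp: norm_index_def)

lemma norm_index_singleton: "0 < p \<Longrightarrow> norm_index {(p, \<alpha>)}"
  by (simp add: norm_index_def)

lemma fin_norm_nonneg: "norm_index F \<Longrightarrow> f \<in> schwartz \<Longrightarrow> 0 \<le> fin_norm F f"
  unfolding fin_norm_def norm_index_def by (intro sum_nonneg) (auto simp: schwartz_norm_nonneg)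

lemma fin_norm_mono:
  "norm_index G \<Longrightarrow> F \<subseteq> G \<Longrightarrow> f \<in> schwartz \<Longrightarrow> fin_norm F f \<le> fin_norm G f"
  unfolding fin_norm_def norm_index_def by (intro sum_mono2) (auto simp: schwartz_norm_nonneg)

lemma fin_norm_fscale:
  "norm_index F \<Longrightarrow> f \<in> schwartz \<Longrightarrow> fin_norm F (fscale c f) = cmod c * fin_norm F f"
  unfolding fin_norm_def norm_index_def sum_distrib_left by (intro sum.cong) (auto simp: schwartz_norm_fscale)

lemma fin_norm_add:
  assumes "norm_index F" "f \<in> schwartz" "g \<in> schwartz"
  shows "fin_norm F (f + g) \<le> fin_norm F f + fin_norm F g"
proof -
  have "fin_norm F (f + g) \<le> (\<Sum>pa\<in>F. (case pa of (p, \<alpha>) \<Rightarrow> schwartz_norm p \<alpha> f) + (case pa of (p, \<alpha>) \<Rightarrow> schwartz_norm p \<alpha> g))"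
    unfolding fin_norm_def using assms by (intro sum_mono) (auto simp: norm_index_def schwartz_norm_add)
  then show ?thesis by (simp add: fin_norm_def sum.distrib)
qed

lemma fin_norm_diff_triangle:
  assumes "norm_index F" "f \<in> schwartz" "g \<in> schwartz" "h \<in> schwartz"
  shows "fin_norm F (f - h) \<le> fin_norm F (f - g) + fin_norm F (g - h)"
  using fin_norm_add[OF assms(1) schwartz_diff[OF assms(2,3)] schwartz_diff[OF assms(3,4)]] by simp

lemma fin_norm_diff_commute:
  assumes "norm_index F" "f \<in> schwartz" "g \<in> schwartz"
  shows "fin_norm F (f - g) = fin_norm F (g - f)"
proof -
  have "f - g = fscale (- 1) (g - f)" by (simp add: fscale_def fun_eq_iff)
  then show ?thesis using fin_norm_fscale[OF assms(1) schwartz_diff[OF assms(3,2)], of "- 1"] by simp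
qed

text \<open>Induction over the generation of the topology; at an intersection the two index sets are
  united and the smaller radius is taken.\<close>

lemma openin_schwartz_ball:
  assumes "openin schwartz_topology U" "f \<in> U"
  shows "\<exists>F e. norm_index F \<and> 0 < e \<and> (\<forall>g\<in>schwartz. fin_norm F (g - f) < e \<longrightarrow> g \<in> U)"
proof -
  have "generate_topology_on {{g \<in> schwartz. schwartz_norm p \<alpha> (g - f) < e} | f p \<alpha> e. f \<in> schwartz \<and> 0 < p \<and> 0 < e} U"
    using assms(1) unfolding schwartz_topology_def by (simp add: openin_topology_generated_by_iff)
  moreover have "f \<in> schwartz"
    using openin_subset[OF assms(1)] assms(2) by auto
  ultimately show ?thesis using assms(2)
  proof (induction arbitrary: f rule: generate_topology_on.induct)
    case (Int a b)
    obtain F e where F: "norm_index F" "0 < e" "\<forall>g\<in>schwartz. fin_norm F (g - f) < e \<longrightarrow> g \<in> a"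
      using Int.IH(1) Int.prems by blast
    obtain G d where G: "norm_index G" "0 < d" "\<forall>g\<in>schwartz. fin_norm G (g - f) < d \<longrightarrow> g \<in> b"
      using Int.IH(2) Int.prems by blast
    note * = F G
    note fs = \<open>f \<in> schwartz\<close>
    show ?case
    proof (intro exI conjI ballI impI)
      show "norm_index (F \<union> G)" using * norm_index_Un by blast
      show "0 < min e d" using * by simp
      fix g assume g: "g \<in> schwartz" "fin_norm (F \<union> G) (g - f) < min e d"
      then show "g \<in> a \<inter> b"
        using *(3,6) fin_norm_mono[OF \<open>norm_index (F \<union> G)\<close>, of F "g - f"] fin_norm_mono[OF \<open>norm_index (F \<union> G)\<close>, of G "g - f"] schwartz_diff[OF g(1) fs]
        by auto
    qed
  next
    case (UN K)
    then obtain k where "k \<in> K" "f \<in> k" by blast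
    with UN.IH[OF \<open>k \<in> K\<close> UN.prems(1)] show ?case by blast
  next
    case (Basis s)
    then obtain f0 p \<alpha> e where s: "s = {g \<in> schwartz. schwartz_norm p \<alpha> (g - f0) < e}" "f0 \<in> schwartz" "0 < p" "0 < e"
      by blast
    have f: "f \<in> schwartz" "schwartz_norm p \<alpha> (f - f0) < e" using Basis.prems s(1) by auto
    show ?case
    proof (intro exI conjI ballI impI)
      show "norm_index {(p, \<alpha>)}" using s norm_index_singleton by blast
      \<comment> \<open>A generating ball may be centred elsewhere, at \<open>f0\<close>; the
        triangle inequality leaves this radius around \<open>f\<close>.\<close>
      show "0 < e - schwartz_norm p \<alpha> (f - f0)" using f by simp
      fix g assume g: "g \<in> schwartz" "fin_norm {(p, \<alpha>)} (g - f) < e - schwartz_norm p \<alpha> (f - f0)"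
      then have "schwartz_norm p \<alpha> (g - f0) < e"
        using fin_norm_diff_triangle[OF norm_index_singleton[OF s(3)] g(1) f(1) s(2), of \<alpha>] by (simp add: fin_norm_def)
      then show "g \<in> s" using g(1) s(1) by simp
    qed
  qed simp
qed

lemma openin_schwartzI:
  assumes "U \<subseteq> schwartz"
    and ball: "\<And>f. f \<in> U \<Longrightarrow> \<exists>F e. norm_index F \<and> 0 < e \<and> (\<forall>g\<in>schwartz. fin_norm F (g - f) < e \<longrightarrow> g \<in> U)"
  shows "openin schwartz_topology U"
proof (subst openin_subopen, rule ballI)
  fix f assume f: "f \<in> U"
  then have fs: "f \<in> schwartz" using assms(1) by blast
  obtain F e where F: "norm_index F" "0 < e" "\<forall>g\<in>schwartz. fin_norm F (g - f) < e \<longrightarrow> g \<in> U"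
    using ball[OF f] by blast
  \<comment> \<open>With \<open>card F + 1\<close> in the denominator, \<open>card F\<close> norms
    below \<open>d\<close> add up to strictly less than \<open>e\<close>, also for empty
    \<open>F\<close>.\<close>
  define d where "d = e / (real (card F) + 1)"
  have d: "0 < d" using F(2) by (simp add: d_def)
  define V where "V G = {g \<in> schwartz. \<forall>(p, \<alpha>)\<in>G. schwartz_norm p \<alpha> (g - f) < d}" for G
  have "openin schwartz_topology (V G)" if "finite G" "\<forall>(p, \<alpha>)\<in>G. 0 < p" for G
    using that
  proof (induction G rule: finite_induct)
    case empty
    have "V {} = topspace schwartz_topology" by (simp add: V_def)
    then show ?case by (metis openin_topspace)
  next
    case (insert pa G)
    obtain p \<alpha> where pa: "pa = (p, \<alpha>)" by (cases pa)
    have "V (insert pa G) = {g \<in> schwartz. schwartz_norm p \<alpha> (g - f) < d} \<inter> V G"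
      by (auto simp: V_def pa)
    moreover have "openin schwartz_topology {g \<in> schwartz. schwartz_norm p \<alpha> (g - f) < d}"
      unfolding schwartz_topology_def
      by (rule topology_generated_by_Basis) (use fs d insert.prems pa in blast)
    ultimately show ?case using insert by (simp add: openin_Int)
  qed
  then have "openin schwartz_topology (V F)" using F(1) by (simp add: norm_index_def)
  moreover have "f \<in> V F"
    using fs d by (auto simp: V_def schwartz_norm_def zero_fun_def)
  moreover have "V F \<subseteq> U"
  proof
    fix g assume g: "g \<in> V F"
    have "fin_norm F (g - f) \<le> (\<Sum>pa\<in>F. d)"
      unfolding fin_norm_def by (rule sum_mono) (use g in \<open>fastforce simp: V_def\<close>)
    also have "\<dots> < e" using F(2) by (simp add: d_def field_simps)
    finally show "g \<in> U" using F(3) g by (simp add: V_def)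
  qed
  ultimately show "\<exists>T. openin schwartz_topology T \<and> f \<in> T \<and> T \<subseteq> U" by blast
qed

lemma continuous_seminorm_fin_norm:
  assumes F: "norm_index F" and C: "0 \<le> C"
  shows "continuous_seminorm fscale schwartz_topology (\<lambda>f. C * fin_norm F f)"
  unfolding continuous_seminorm_def
proof (intro conjI)
  show "continuous_map schwartz_topology euclideanreal (\<lambda>f. C * fin_norm F f)"
    unfolding continuous_map_def
  proof (intro conjI allI impI)
    fix U assume U: "openin euclideanreal U"
    show "openin schwartz_topology {x \<in> topspace schwartz_topology. C * fin_norm F x \<in> U}"
    proof (rule openin_schwartzI)
      fix f assume "f \<in> {x \<in> topspace schwartz_topology. C * fin_norm F x \<in> U}"
      then have f: "f \<in> schwartz" "C * fin_norm F f \<in> U" by auto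
      then obtain e where e: "0 < e" "\<And>y. dist y (C * fin_norm F f) < e \<Longrightarrow> y \<in> U"
        using U by (auto simp: open_dist)
      show "\<exists>G d. norm_index G \<and> 0 < d \<and> (\<forall>g\<in>schwartz. fin_norm G (g - f) < d \<longrightarrow>
          g \<in> {x \<in> topspace schwartz_topology. C * fin_norm F x \<in> U})"
      proof (intro exI conjI ballI impI)
        show "norm_index F" by (rule F)
        \<comment> \<open>\<open>C + 1\<close> instead of \<open>C\<close> covers the case
          \<open>C = 0\<close>.\<close>
        show "0 < e / (C + 1)" using e C by simp
        fix g assume g: "g \<in> schwartz" "fin_norm F (g - f) < e / (C + 1)"
        have "fin_norm F g \<le> fin_norm F (g - f) + fin_norm F f"
          using fin_norm_add[OF F schwartz_diff[OF g(1) f(1)] f(1)] by simp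
        moreover have "fin_norm F f \<le> fin_norm F (g - f) + fin_norm F g"
          using fin_norm_add[OF F schwartz_diff[OF f(1) g(1)] g(1)] fin_norm_diff_commute[OF F f(1) g(1)] by simp
        ultimately have "\<bar>fin_norm F g - fin_norm F f\<bar> \<le> fin_norm F (g - f)" by simp
        then have "C * \<bar>fin_norm F g - fin_norm F f\<bar> \<le> C * fin_norm F (g - f)" using C by (rule mult_left_mono)
        also have "\<dots> \<le> (C + 1) * fin_norm F (g - f)"
          using fin_norm_nonneg[OF F schwartz_diff[OF g(1) f(1)]] by (simp add: distrib_right)
        also have "\<dots> < e" using g(2) C by (simp add: field_simps)
        finally have "dist (C * fin_norm F g) (C * fin_norm F f) < e"
          using C by (simp add: dist_real_def abs_mult flip: right_diff_distrib)
        then show "g \<in> {x \<in> topspace schwartz_topology. C * fin_norm F x \<in> U}"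
          using e(2) g(1) by simp
      qed
    qed auto
  qed simp
qed (use assms in \<open>auto simp: fin_norm_nonneg fin_norm_fscale fin_norm_add mult_left_mono simp flip: distrib_left\<close>)

text \<open>Homogeneity: \<open>r\<close> is below 1 on some ball around 0, and a violation of the
  estimate would, after division by \<open>r f\<close>, give an element of that ball on which
  \<open>r\<close> equals 1.\<close>

lemma continuous_seminorm_bound:
  assumes r: "continuous_seminorm fscale schwartz_topology r"
  shows "\<exists>F C. norm_index F \<and> 0 < C \<and> (\<forall>f\<in>schwartz. r f \<le> C * fin_norm F f)"
proof -
  have r_scale: "r (fscale c f) = cmod c * r f" if "f \<in> schwartz" for c f
    using r that by (simp add: continuous_seminorm_def)
  have r_nonneg: "0 \<le> r f" if "f \<in> schwartz" for f
    using r that by (simp add: continuous_seminorm_def)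
  have "fscale 0 0 = (0 :: real ^ 'a::_ \<Rightarrow> complex)" by (simp add: fscale_def fun_eq_iff)
  then have r0: "r 0 = 0" using r_scale[OF schwartz_zero, of 0] by simp
  have "openin schwartz_topology {f \<in> topspace schwartz_topology. r f \<in> {..<1}}"
    using r by (intro openin_continuous_map_preimage[of _ euclideanreal]) (auto simp: continuous_seminorm_def)
  moreover have "0 \<in> {f \<in> topspace schwartz_topology. r f \<in> {..<1}}"
    by (simp add: r0 schwartz_zero)
  ultimately obtain F e where F: "norm_index F" and e: "0 < e"
    and ball: "\<forall>g\<in>schwartz. fin_norm F (g - 0) < e \<longrightarrow> g \<in> {f \<in> topspace schwartz_topology. r f \<in> {..<1}}"
    using openin_schwartz_ball by blast
  have small: "r g < 1" if "g \<in> schwartz" "fin_norm F g < e" for g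
    using ball that by simp
  have "r f \<le> 2 / e * fin_norm F f" if f: "f \<in> schwartz" for f
  proof (rule ccontr)
    assume "\<not> r f \<le> 2 / e * fin_norm F f"
    then have less: "2 / e * fin_norm F f < r f" by simp
    then have pos: "0 < r f"
      using fin_norm_nonneg[OF F f] e by (smt (verit) divide_nonneg_nonneg mult_nonneg_nonneg)
    have "fin_norm F (fscale (complex_of_real (1 / r f)) f) = fin_norm F f / r f"
      using pos by (simp add: fin_norm_fscale[OF F f] norm_divide)
    also have "\<dots> < e" using less pos e fin_norm_nonneg[OF F f] by (simp add: field_simps)
    finally have "r (fscale (complex_of_real (1 / r f)) f) < 1"
      by (intro small schwartz_fscale f)
    then show False using pos by (simp add: r_scale[OF f] norm_divide)
  qed
  then show ?thesis using F e by (intro exI[of _ F] exI[of _ "2 / e"]) auto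
qed

text \<open>Each norm in the sum has its own rate. Directedness of \<open>W\<close> provides a
  common one, and the constants are collected in \<open>K\<close>, separately from the rate.\<close>

lemma fin_norm_combine:
  fixes T :: "nat \<Rightarrow> (real ^ 'd::{finite,linorder} \<Rightarrow> complex) \<Rightarrow> real ^ 'd::_ \<Rightarrow> complex"
  assumes max: "\<And>a b. a \<in> W \<Longrightarrow> b \<in> W \<Longrightarrow> \<exists>c\<in>W. \<forall>n\<ge>1. a n \<le> c n \<and> b n \<le> c n"
    and "W \<noteq> {}" and pos: "\<And>a n. a \<in> W \<Longrightarrow> 1 \<le> n \<Longrightarrow> 0 < a n"
    and single: "\<And>p \<alpha>. 0 < p \<Longrightarrow> \<exists>F a. norm_index F \<and> a \<in> W \<and>
      (\<forall>n\<ge>1. \<forall>f\<in>schwartz. schwartz_norm p \<alpha> (T n f) \<le> a n * fin_norm F f)"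
    and "norm_index G"
  shows "\<exists>F a. norm_index F \<and> a \<in> W \<and> (\<exists>K\<ge>0. \<forall>n\<ge>1. \<forall>f\<in>schwartz. fin_norm G (T n f) \<le> K * a n * fin_norm F f)"
proof -
  have "finite G" "\<forall>(p, \<alpha>)\<in>G. 0 < p" using assms(5) by (auto simp: norm_index_def)
  then show ?thesis
  proof (induction G rule: finite_induct)
    case empty
    obtain a where "a \<in> W" using \<open>W \<noteq> {}\<close> by blast
    then show ?case by (intro exI[of _ "{}"] exI[of _ a]) (auto simp: norm_index_def fin_norm_def)
  next
    case (insert pa G)
    obtain p \<alpha> where pa: "pa = (p, \<alpha>)" by (cases pa)
    have "0 < p" using insert.prems pa by auto
    then obtain F1 a where F1: "norm_index F1" "a \<in> W"
      "\<forall>n\<ge>1. \<forall>f\<in>schwartz. schwartz_norm p \<alpha> (T n f) \<le> a n * fin_norm F1 f"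
      using single by blast
    obtain F2 b K where F2: "norm_index F2" "b \<in> W" "0 \<le> K"
      "\<forall>n\<ge>1. \<forall>f\<in>schwartz. fin_norm G (T n f) \<le> K * b n * fin_norm F2 f"
      using insert by auto
    obtain c where c: "c \<in> W" "\<forall>n\<ge>1. a n \<le> c n \<and> b n \<le> c n" using max F1(2) F2(2) by blast
    have F: "norm_index (F1 \<union> F2)" using F1 F2 norm_index_Un by blast
    have "fin_norm (insert pa G) (T n f) \<le> (1 + K) * c n * fin_norm (F1 \<union> F2) f"
      if n: "1 \<le> n" and f: "f \<in> schwartz" for n f
    proof -
      have cn: "0 < c n" using pos c(1) n by blast
      have "fin_norm (insert pa G) (T n f) = schwartz_norm p \<alpha> (T n f) + fin_norm G (T n f)"
        using insert.hyps by (simp add: fin_norm_def pa)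
      also have "\<dots> \<le> a n * fin_norm F1 f + K * b n * fin_norm F2 f"
        using F1(3) F2(4) n f by (intro add_mono) auto
      also have "\<dots> \<le> c n * fin_norm (F1 \<union> F2) f + K * c n * fin_norm (F1 \<union> F2) f"
        using c(2) n cn F2(3) pos[OF F1(2) n] pos[OF F2(2) n] fin_norm_nonneg[OF F1(1) f] fin_norm_nonneg[OF F2(1) f]
          fin_norm_mono[OF F, of F1 f] fin_norm_mono[OF F, of F2 f] f
        by (intro add_mono mult_mono) (auto intro: mult_left_mono)
      finally show ?thesis by (simp add: algebra_simps)
    qed
    then show ?case using F c(1) F2(3)
      by (intro exI[of _ "F1 \<union> F2"] exI[of _ c]) (auto intro!: exI[of _ "1 + K"])
  qed
qed

lemma continuous_linear_operatorI:
  fixes T :: "(real ^ 'd::{finite,linorder} \<Rightarrow> complex) \<Rightarrow> real ^ 'd::_ \<Rightarrow> complex"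
  assumes maps: "\<And>f. f \<in> schwartz \<Longrightarrow> T f \<in> schwartz"
    and add: "\<And>f g. T (f + g) = T f + T g" and scale: "\<And>c f. T (fscale c f) = fscale c (T f)"
    and bound: "\<And>G. norm_index G \<Longrightarrow> \<exists>F C. norm_index F \<and> 0 \<le> C \<and> (\<forall>f\<in>schwartz. fin_norm G (T f) \<le> C * fin_norm F f)"
  shows "continuous_linear_operator fscale schwartz_topology T"
  unfolding continuous_linear_operator_def
proof (intro conjI ballI allI add scale)
  show "continuous_map schwartz_topology schwartz_topology T"
    unfolding continuous_map_def
  proof (intro conjI allI impI)
    show "T \<in> topspace schwartz_topology \<rightarrow> topspace schwartz_topology" using maps by simp
    fix U :: "(real ^ 'd::_ \<Rightarrow> complex) set" assume U: "openin schwartz_topology U"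
    show "openin schwartz_topology {f \<in> topspace schwartz_topology. T f \<in> U}"
    proof (rule openin_schwartzI)
      fix f assume "f \<in> {f \<in> topspace schwartz_topology. T f \<in> U}"
      then have f: "f \<in> schwartz" "T f \<in> U" by auto
      obtain G e where G: "norm_index G" "0 < e" "\<forall>g\<in>schwartz. fin_norm G (g - T f) < e \<longrightarrow> g \<in> U"
        using openin_schwartz_ball[OF U f(2)] by blast
      obtain F C where F: "norm_index F" "0 \<le> C" "\<forall>f\<in>schwartz. fin_norm G (T f) \<le> C * fin_norm F f"
        using bound[OF G(1)] by blast
      show "\<exists>F d. norm_index F \<and> 0 < d \<and> (\<forall>g\<in>schwartz. fin_norm F (g - f) < d \<longrightarrow>
          g \<in> {f \<in> topspace schwartz_topology. T f \<in> U})"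
      proof (intro exI conjI ballI impI)
        show "norm_index F" "0 < e / (C + 1)" using F G by auto
        fix g assume g: "g \<in> schwartz" "fin_norm F (g - f) < e / (C + 1)"
        have "T (g - f) = T g - T f"
          unfolding diff_eq_fscale by (simp only: add scale)
        then have "fin_norm G (T g - T f) \<le> C * fin_norm F (g - f)"
          using F(3) schwartz_diff[OF g(1) f(1)] by metis
        also have "\<dots> \<le> (C + 1) * fin_norm F (g - f)"
          using fin_norm_nonneg[OF F(1) schwartz_diff[OF g(1) f(1)]] by (simp add: distrib_right)
        also have "\<dots> < e" using g(2) F(2) by (simp add: field_simps)
        finally show "g \<in> {f \<in> topspace schwartz_topology. T f \<in> U}"
          using G(3) maps g(1) by simp
      qed
    qed auto
  qed
qed

section \<open>Test functions\<close>

definition gauss :: "real poly \<Rightarrow> real \<Rightarrow> real" where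
  "gauss P t = poly P t * exp (- (t ^ 2))"

text \<open>Differentiating the Gaussian contributes the factor -2t, where 2t is
  \<open>[:0, 2:]\<close>; hence derivatives never leave the class of functions
  \<open>gauss P\<close>.\<close>

definition gauss_deriv :: "real poly \<Rightarrow> real poly" where
  "gauss_deriv P = pderiv P - [:0, 2:] * P"

lemma gauss_has_derivative: "(gauss P has_real_derivative gauss (gauss_deriv P) t) (at t)"
  unfolding gauss_def gauss_deriv_def
  by (auto intro!: derivative_eq_intros simp: algebra_simps)

text \<open>Comparison with the exponential: \<open>n ^ n\<close> comes from
  \<open>u \<le> exp u\<close> at \<open>u = (1 + \<bar>t\<bar>) / n\<close>, raised to the power
  \<open>n\<close>, and \<open>exp 2\<close> from
  \<open>1 + \<bar>t\<bar> \<le> 2 + t ^ 2\<close>.\<close>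

lemma power_mult_gauss_le: "(1 + \<bar>t\<bar>) ^ n * exp (- (t ^ 2)) \<le> real n ^ n * exp (2 :: real)"
proof -
  have *: "(1 + \<bar>t\<bar>) ^ n \<le> real n ^ n * exp (1 + \<bar>t\<bar>)"
  proof (cases "n = 0")
    case False
    have "((1 + \<bar>t\<bar>) / n) ^ n \<le> exp ((1 + \<bar>t\<bar>) / n) ^ n"
      using exp_ge_add_one_self[of "(1 + \<bar>t\<bar>) / n"] by (intro power_mono) (linarith, simp)
    also have "\<dots> = exp (1 + \<bar>t\<bar>)" using False by (simp flip: exp_of_nat_mult)
    finally show ?thesis using False by (simp add: power_divide field_simps)
  qed simp
  have "0 \<le> (\<bar>t\<bar> - 1 / 2) ^ 2" by simp
  then have "1 + \<bar>t\<bar> \<le> 2 + t ^ 2" by (simp add: power2_eq_square algebra_simps)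
  then have "exp (1 + \<bar>t\<bar>) \<le> exp 2 * exp (t ^ 2)" by (simp flip: exp_add)
  then have "real n ^ n * exp (1 + \<bar>t\<bar>) \<le> real n ^ n * (exp 2 * exp (t ^ 2))" by (intro mult_left_mono) auto
  with * have "(1 + \<bar>t\<bar>) ^ n \<le> real n ^ n * exp 2 * exp (t ^ 2)" by simp
  then show ?thesis by (simp add: exp_minus field_simps)
qed

lemma poly_growth: "\<exists>C k. 0 \<le> C \<and> (\<forall>t. \<bar>poly P t\<bar> \<le> C * (1 + \<bar>t :: real\<bar>) ^ k)"
proof (induction P)
  case 0
  show ?case by (intro exI[of _ 0]) simp
next
  case (pCons a P)
  then obtain C k where C: "0 \<le> C" "\<And>t. \<bar>poly P t\<bar> \<le> C * (1 + \<bar>t\<bar>) ^ k" by blast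
  have "\<bar>poly (pCons a P) t\<bar> \<le> (\<bar>a\<bar> + C) * (1 + \<bar>t\<bar>) ^ Suc k" for t
  proof -
    have "\<bar>poly (pCons a P) t\<bar> \<le> \<bar>a\<bar> + \<bar>t\<bar> * \<bar>poly P t\<bar>"
      by (simp add: abs_triangle_ineq[THEN order_trans] abs_mult)
    also have "\<dots> \<le> \<bar>a\<bar> * (1 + \<bar>t\<bar>) ^ Suc k + (1 + \<bar>t\<bar>) * (C * (1 + \<bar>t\<bar>) ^ k)"
    proof (rule add_mono)
      show "\<bar>a\<bar> \<le> \<bar>a\<bar> * (1 + \<bar>t\<bar>) ^ Suc k"
        using mult_left_mono[OF one_le_power[of "1 + \<bar>t\<bar>" "Suc k"], of "\<bar>a\<bar>"] by simp
      show "\<bar>t\<bar> * \<bar>poly P t\<bar> \<le> (1 + \<bar>t\<bar>) * (C * (1 + \<bar>t\<bar>) ^ k)"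
        using C by (intro mult_mono) auto
    qed
    finally show ?thesis by (simp add: algebra_simps)
  qed
  then show ?case using C(1) by (intro exI[of _ "\<bar>a\<bar> + C"] exI[of _ "Suc k"]) auto
qed

lemma gauss_decay: "\<exists>C. \<forall>t. (1 + \<bar>t\<bar>) ^ m * \<bar>gauss P t\<bar> \<le> C"
proof -
  obtain C k where C: "0 \<le> C" "\<And>t. \<bar>poly P t\<bar> \<le> C * (1 + \<bar>t\<bar>) ^ k" using poly_growth by blast
  have "(1 + \<bar>t\<bar>) ^ m * \<bar>gauss P t\<bar> \<le> C * (real (m + k) ^ (m + k) * exp 2)" for t
  proof -
    have "(1 + \<bar>t\<bar>) ^ m * \<bar>gauss P t\<bar> \<le> (1 + \<bar>t\<bar>) ^ m * (C * (1 + \<bar>t\<bar>) ^ k * exp (- (t ^ 2)))"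
      unfolding gauss_def abs_mult using C(2) by (intro mult_left_mono) (auto intro: mult_right_mono)
    also have "\<dots> = C * ((1 + \<bar>t\<bar>) ^ (m + k) * exp (- (t ^ 2)))" by (simp add: power_add mult_ac)
    also have "\<dots> \<le> C * (real (m + k) ^ (m + k) * exp 2)"
      by (rule mult_left_mono[OF power_mult_gauss_le C(1)])
    finally show ?thesis .
  qed
  then show ?thesis by blast
qed

text \<open>Reduces decay in the norm to decay in each coordinate, because the weight is then
  dominated by a product over the coordinates.\<close>

lemma one_add_sum_le_prod: "(\<And>i. i \<in> I \<Longrightarrow> 0 \<le> f i) \<Longrightarrow> 1 + (\<Sum>i\<in>I. f i) \<le> (\<Prod>i\<in>I. 1 + (f i :: real))"
proof (induction I rule: infinite_finite_induct)
  case (insert j I)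
  have "1 + (\<Sum>i\<in>insert j I. f i) \<le> (1 + f j) * (1 + (\<Sum>i\<in>I. f i))"
    using insert by (simp add: algebra_simps sum_nonneg)
  also have "\<dots> \<le> (1 + f j) * (\<Prod>i\<in>I. 1 + f i)"
    using insert by (intro mult_left_mono) auto
  finally show ?case using insert by simp
qed auto

definition gauss_prod :: "('d \<Rightarrow> real poly) \<Rightarrow> real ^ 'd::{finite,linorder} \<Rightarrow> real ^ 'd::_ \<Rightarrow> complex" where
  "gauss_prod u a y = complex_of_real (\<Prod>i\<in>UNIV. gauss (u i) (y $ i - a $ i))"

lemma smooth_gauss_prod: "smooth (gauss_prod u a)"
  unfolding gauss_prod_def[abs_def]
  by (rule smooth_linear[OF bounded_linear_of_real separable_smooth[of gauss gauss_deriv, OF gauss_has_derivative]])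

lemma mderiv_gauss_prod: "mderiv \<gamma> (gauss_prod u a) = gauss_prod (\<lambda>i. (gauss_deriv ^^ (\<gamma> $ i)) (u i)) a"
  unfolding gauss_prod_def[abs_def]
    mderiv_linear[OF bounded_linear_of_real separable_smooth[of gauss gauss_deriv, OF gauss_has_derivative]]
    separable_mderiv[of gauss gauss_deriv, OF gauss_has_derivative] ..

text \<open>The constant is uniform in the base point: translation reduces the claim to
  \<open>a = 0\<close>, at the price of the factor from Peetre's inequality
  \<open>1 + norm y \<le> (1 + norm a) * (1 + norm (y - a))\<close>.\<close>

lemma gauss_prod_decay: "\<exists>C. \<forall>a y. (1 + norm y) powr q * cmod (gauss_prod u a y) \<le> C * (1 + norm a) powr q"
  if "0 < q"
proof -
  \<comment> \<open>An integer exponent lets the one-variable bounds with powers be multiplied over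
    the coordinates.\<close>
  define m where "m = nat \<lceil>q\<rceil>"
  have m: "q \<le> real m" by (simp add: m_def) linarith
  have "\<exists>C. \<forall>t. (1 + \<bar>t\<bar>) ^ m * \<bar>gauss (u i) t\<bar> \<le> C" for i by (rule gauss_decay)
  then obtain C where C: "\<And>i t. (1 + \<bar>t\<bar>) ^ m * \<bar>gauss (u i) t\<bar> \<le> C i" by metis
  have *: "(1 + norm z) powr q * \<bar>\<Prod>i\<in>UNIV. gauss (u i) (z $ i)\<bar> \<le> (\<Prod>i\<in>UNIV. C i)" for z
  proof -
    have "1 + norm z \<le> 1 + (\<Sum>i\<in>UNIV. \<bar>z $ i\<bar>)" using norm_le_l1_cart[of z] by simp
    also have "\<dots> \<le> (\<Prod>i\<in>UNIV. 1 + \<bar>z $ i\<bar>)" by (rule one_add_sum_le_prod) simp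
    finally have "(1 + norm z) ^ m \<le> (\<Prod>i\<in>UNIV. 1 + \<bar>z $ i\<bar>) ^ m" by (intro power_mono) auto
    moreover have "(1 + norm z) powr q \<le> (1 + norm z) ^ m"
      using m powr_mono[of q "real m" "1 + norm z"] by (simp add: powr_realpow add_pos_nonneg)
    ultimately have "(1 + norm z) powr q * \<bar>\<Prod>i\<in>UNIV. gauss (u i) (z $ i)\<bar> \<le>
       (\<Prod>i\<in>UNIV. 1 + \<bar>z $ i\<bar>) ^ m * \<bar>\<Prod>i\<in>UNIV. gauss (u i) (z $ i)\<bar>"
      by (intro mult_right_mono) auto
    also have "\<dots> = (\<Prod>i\<in>UNIV. (1 + \<bar>z $ i\<bar>) ^ m * \<bar>gauss (u i) (z $ i)\<bar>)"
      by (simp add: prod.distrib prod_power_distrib abs_prod)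
    also have "\<dots> \<le> (\<Prod>i\<in>UNIV. C i)" by (rule prod_mono) (simp add: C)
    finally show ?thesis .
  qed
  have "(1 + norm y) powr q * cmod (gauss_prod u a y) \<le> (\<Prod>i\<in>UNIV. C i) * (1 + norm a) powr q" for a y
  proof -
    have "norm y \<le> norm a + norm (y - a)" by (metis add.commute diff_add_cancel norm_triangle_ineq)
    moreover have "(1 + norm a) * (1 + norm (y - a)) = 1 + norm a + norm (y - a) + norm a * norm (y - a)"
      by (simp add: algebra_simps)
    moreover have "0 \<le> norm a * norm (y - a)" by simp
    ultimately have "1 + norm y \<le> (1 + norm a) * (1 + norm (y - a))" by linarith
    then have "(1 + norm y) powr q \<le> ((1 + norm a) * (1 + norm (y - a))) powr q"
      using that by (intro powr_mono2) auto
    also have "\<dots> = (1 + norm a) powr q * (1 + norm (y - a)) powr q"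
      by (rule powr_mult)
    finally have "(1 + norm y) powr q * cmod (gauss_prod u a y) \<le>
      (1 + norm a) powr q * (1 + norm (y - a)) powr q * cmod (gauss_prod u a y)" by (rule mult_right_mono) simp
    also have "\<dots> = (1 + norm a) powr q * ((1 + norm (y - a)) powr q * \<bar>\<Prod>i\<in>UNIV. gauss (u i) ((y - a) $ i)\<bar>)"
      by (simp add: gauss_prod_def del: of_real_prod)
    also have "\<dots> \<le> (1 + norm a) powr q * (\<Prod>i\<in>UNIV. C i)"
      by (intro mult_left_mono *) simp
    finally show ?thesis by (simp add: mult.commute)
  qed
  then show ?thesis by blast
qed

lemma gauss_prod_schwartz: "gauss_prod u a \<in> schwartz"
proof (rule schwartzI[OF smooth_gauss_prod])
  fix p :: real and \<alpha> assume p: "0 < p"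
  show "\<exists>C. \<forall>x. (1 + norm x) powr p * cmod (mderiv \<alpha> (gauss_prod u a) x) \<le> C"
    using gauss_prod_decay[OF p] unfolding mderiv_gauss_prod by meson
qed

lemma schwartz_norm_gauss_prod:
  assumes "0 < q"
  shows "\<exists>C. \<forall>a. schwartz_norm q \<alpha> (gauss_prod u a) \<le> C * (1 + norm a) powr q"
proof -
  obtain C where "\<And>a y. (1 + norm y) powr q * cmod (mderiv \<alpha> (gauss_prod u a) y) \<le> C * (1 + norm a) powr q"
    using gauss_prod_decay[OF assms] unfolding mderiv_gauss_prod by metis
  then show ?thesis using schwartz_norm_leI by blast
qed

text \<open>The exponent depends on \<open>F\<close> but not on \<open>a\<close>; it becomes the
  \<open>q\<close> in \<open>faa_bounded_if_topologizable\<close>.\<close>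

lemma fin_norm_gauss_prod:
  assumes "norm_index F"
  shows "\<exists>C q. 0 < q \<and> 0 \<le> C \<and> (\<forall>a. fin_norm F (gauss_prod u a) \<le> C * (1 + norm a) powr q)"
proof -
  have "finite F" "\<forall>(p, \<alpha>)\<in>F. 0 < p" using assms by (auto simp: norm_index_def)
  then show ?thesis
  proof (induction F rule: finite_induct)
    case empty
    show ?case by (intro exI[of _ 0] exI[of _ 1]) (simp add: fin_norm_def)
  next
    case (insert pa F)
    obtain p \<alpha> where pa: "pa = (p, \<alpha>)" by (cases pa)
    have p: "0 < p" using insert.prems pa by auto
    obtain C q where C: "0 < q" "0 \<le> C" "\<And>a. fin_norm F (gauss_prod u a) \<le> C * (1 + norm a) powr q"
      using insert by auto
    obtain D where D: "\<And>a. schwartz_norm p \<alpha> (gauss_prod u a) \<le> D * (1 + norm a) powr p"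
      using schwartz_norm_gauss_prod[OF p] by metis
    have "fin_norm (insert pa F) (gauss_prod u a) \<le> (\<bar>D\<bar> + C) * (1 + norm a) powr max p q" for a
    proof -
      have "fin_norm (insert pa F) (gauss_prod u a) = schwartz_norm p \<alpha> (gauss_prod u a) + fin_norm F (gauss_prod u a)"
        using insert.hyps by (simp add: fin_norm_def pa)
      also have "\<dots> \<le> D * (1 + norm a) powr p + C * (1 + norm a) powr q" using C D by (intro add_mono)
      also have "\<dots> \<le> \<bar>D\<bar> * (1 + norm a) powr max p q + C * (1 + norm a) powr max p q"
        using C(2) by (intro add_mono mult_mono powr_mono) auto
      finally show ?thesis by (simp add: distrib_right)
    qed
    then show ?case using C p by (intro exI[of _ "\<bar>D\<bar> + C"] exI[of _ "max p q"]) auto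
  qed
qed

text \<open>\<open>pderiv P\<close> lowers the order of the zero at 0 by one, while multiplication
  by \<open>[:0, 2:]\<close> raises it, so nothing cancels in the lowest coefficient.\<close>

lemma gauss_deriv_lowest_coeff:
  assumes "\<forall>i<j. coeff P i = 0" "coeff P j \<noteq> 0" "k \<le> j"
  shows "(\<forall>i<j - k. coeff ((gauss_deriv ^^ k) P) i = 0) \<and> coeff ((gauss_deriv ^^ k) P) (j - k) \<noteq> 0"
  using assms(3)
proof (induction k)
  case (Suc k)
  then obtain m where m: "j - k = Suc m" by (metis Suc_diff_Suc Suc_le_eq)
  then have "j - Suc k = m" by simp
  with Suc m show ?case
    by (auto simp: gauss_deriv_def coeff_pderiv coeff_pCons split: nat.split)
qed (use assms in auto)

lemma gauss_deriv_add_smult: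
  "(gauss_deriv ^^ k) (P + smult c Q) = (gauss_deriv ^^ k) P + smult c ((gauss_deriv ^^ k) Q)"
proof (induction k)
  case (Suc k)
  have "gauss_deriv (P + smult c Q) = gauss_deriv P + smult c (gauss_deriv Q)" for P Q
    by (simp add: gauss_deriv_def pderiv_add pderiv_smult algebra_simps smult_diff_right smult_add_right)
  with Suc show ?case by simp
qed simp

text \<open>A triangular system, solved by induction on \<open>N\<close>: adding a multiple of the
  monomial of degree \<open>N\<close> leaves the derivatives at 0 of order below \<open>N\<close>
  unchanged and adjusts the one of order \<open>N\<close>.\<close>

lemma gauss_jet: "\<exists>P. \<forall>k<N. gauss ((gauss_deriv ^^ k) P) 0 = (if k = m then 1 else 0)"
proof (induction N)
  case (Suc N)
  then obtain P where P: "\<And>k. k < N \<Longrightarrow> coeff ((gauss_deriv ^^ k) P) 0 = (if k = m then 1 else 0)"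
    by (auto simp: gauss_def poly_0_coeff_0)
  define Q where "Q = monom (1::real) N"
  have Q: "\<forall>i<N. coeff Q i = 0" "coeff Q N \<noteq> 0" by (auto simp: Q_def)
  have Q0: "coeff ((gauss_deriv ^^ k) Q) 0 = 0" if "k < N" for k
    using gauss_deriv_lowest_coeff[OF Q, of k] that by auto
  have QN: "coeff ((gauss_deriv ^^ N) Q) 0 \<noteq> 0"
    using gauss_deriv_lowest_coeff[OF Q, of N] by auto
  define c where "c = ((if N = m then 1 else 0) - coeff ((gauss_deriv ^^ N) P) 0) / coeff ((gauss_deriv ^^ N) Q) 0"
  have "coeff ((gauss_deriv ^^ k) (P + smult c Q)) 0 = (if k = m then 1 else 0)" if "k < Suc N" for k
    unfolding gauss_deriv_add_smult using that P[of k] Q0[of k] QN by (cases "k = N") (auto simp: c_def)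
  then show ?case by (auto simp: gauss_def poly_0_coeff_0 intro!: exI[of _ "P + smult c Q"])
qed simp

text \<open>The order of quantifiers matters: \<open>u\<close> is chosen before \<open>a\<close>, so
  the functions for different base points are translates of one another.\<close>

lemma exists_gauss_prod_jet:
  fixes \<mu> :: "nat ^ 'd::{finite,linorder}"
  shows "\<exists>u. \<forall>a \<gamma>. mabs \<gamma> \<le> N \<longrightarrow> mderiv \<gamma> (gauss_prod u a) a = (if \<gamma> = \<mu> then 1 else 0)"
proof -
  have "\<exists>P. \<forall>k<Suc N. gauss ((gauss_deriv ^^ k) P) 0 = (if k = \<mu> $ i then 1 else 0)" for i
    by (rule gauss_jet)
  then obtain u where u: "\<And>i k. k < Suc N \<Longrightarrow> gauss ((gauss_deriv ^^ k) (u i)) 0 = (if k = \<mu> $ i then 1 else 0)"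
    by metis
  have "mderiv \<gamma> (gauss_prod u a) a = (if \<gamma> = \<mu> then 1 else 0)" if "mabs \<gamma> \<le> N" for a \<gamma>
  proof -
    have "\<gamma> $ i < Suc N" for i using nth_le_mabs[of \<gamma> i] that by simp
    then have "mderiv \<gamma> (gauss_prod u a) a = complex_of_real (\<Prod>i\<in>UNIV. if \<gamma> $ i = \<mu> $ i then 1 else 0)"
      unfolding mderiv_gauss_prod by (simp add: gauss_prod_def u del: of_real_prod)
    also have "\<dots> = (if \<gamma> = \<mu> then 1 else 0)" by (auto simp: vec_eq_iff)
    finally show ?thesis .
  qed
  then show ?thesis by blast
qed

section \<open>Topologizable weighted composition operators\<close>

lemma funpow_wcomp: "(wcomp \<psi> \<phi> ^^ n) f = (\<lambda>x. iter_weight \<psi> \<phi> n x * f ((\<phi> ^^ n) x))"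
proof (induction n arbitrary: f)
  case (Suc n)
  \<comment> \<open>Peeling off the innermost application puts the new weight factor at the last
    iterate, as in \<open>iter_weight\<close>.\<close>
  have "(wcomp \<psi> \<phi> ^^ Suc n) f = (wcomp \<psi> \<phi> ^^ n) (wcomp \<psi> \<phi> f)" by (simp add: funpow_swap1)
  also have "\<dots> = (\<lambda>x. iter_weight \<psi> \<phi> n x * wcomp \<psi> \<phi> f ((\<phi> ^^ n) x))" by (rule Suc)
  also have "\<dots> = (\<lambda>x. iter_weight \<psi> \<phi> (Suc n) x * f ((\<phi> ^^ Suc n) x))"
    by (simp add: wcomp_def iter_weight_def mult.assoc)
  finally show ?case .
qed (simp add: iter_weight_def)

lemma smooth_bounded_linear:
  fixes L :: "real ^ 'd \<Rightarrow> 'b::real_normed_vector"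
  assumes "bounded_linear L"
  shows "smooth L"
proof -
  have L: "(L has_derivative L) (at x)" for x by (rule bounded_linear_imp_has_derivative[OF assms])
  then have "L differentiable (at x)" for x by (auto simp: differentiable_def)
  moreover have "pderiv_at i L = (\<lambda>_. L (axis i 1))" for i by (rule ext, rule pderiv_at_eq[OF L])
  ultimately show ?thesis using smooth_iff smooth_const by metis
qed

lemma smooth_funpow: "smooth \<phi> \<Longrightarrow> smooth (\<phi> ^^ n)" for \<phi> :: "real ^ 'd \<Rightarrow> real ^ 'd"
proof (induction n)
  case 0
  show ?case using smooth_bounded_linear[OF bounded_linear_ident] by (simp add: id_def)
next
  case (Suc n)
  then show ?case using smooth_compose[of \<phi> "\<phi> ^^ n"] smooth_nth[of "\<phi> ^^ n"] by (simp add: o_def)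
qed

lemma smooth_iter_weight:
  assumes "smooth \<phi>" "smooth \<psi>"
  shows "smooth (iter_weight \<psi> \<phi> n)"
proof (induction n)
  case 0
  have "iter_weight \<psi> \<phi> 0 = (\<lambda>_. 1)" by (simp add: fun_eq_iff iter_weight_def)
  then show ?case by (simp add: smooth_const)
next
  case (Suc n)
  have "iter_weight \<psi> \<phi> (Suc n) = (\<lambda>x. iter_weight \<psi> \<phi> n x * \<psi> ((\<phi> ^^ n) x))"
    by (simp add: fun_eq_iff iter_weight_def)
  moreover have "smooth (\<lambda>x. \<psi> ((\<phi> ^^ n) x))"
    using smooth_compose[OF assms(2)] smooth_nth[OF smooth_funpow[OF assms(1)]] by blast
  ultimately show ?case using smooth_bilinear[OF bounded_bilinear_mult Suc] by simp
qed

lemma wcomp_add: "wcomp \<psi> \<phi> (f + g) = wcomp \<psi> \<phi> f + wcomp \<psi> \<phi> g"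
  by (simp add: wcomp_def fun_eq_iff distrib_left)

lemma wcomp_fscale: "wcomp \<psi> \<phi> (fscale c f) = fscale c (wcomp \<psi> \<phi> f)"
  by (simp add: wcomp_def fscale_def fun_eq_iff mult_ac)

text \<open>Both parts of the theorem are instances of one equivalence, for a class of admissible growth rates:
  all positive sequences for topologizability, the geometric ones for \<open>m\<close>-topologizability.\<close>

definition growth_class :: "(nat \<Rightarrow> real) set \<Rightarrow> bool" where
  "growth_class W \<longleftrightarrow> W \<noteq> {} \<and> (\<forall>a\<in>W. \<forall>n\<ge>1. 0 < a n) \<and>
     (\<forall>a\<in>W. \<forall>b\<in>W. \<exists>c\<in>W. \<forall>n\<ge>1. a n \<le> c n \<and> b n \<le> c n) \<and>
     (\<forall>a\<in>W. \<forall>K. \<exists>c\<in>W. \<forall>n\<ge>1. K * a n < c n)"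

text \<open>The rate stands on the right-hand side, so its terms are the reciprocals of the
  \<open>a n\<close> in \<open>topologizable\<close>; the two classes in use are closed under
  reciprocals.\<close>

definition topologizable_with ::
  "(nat \<Rightarrow> real) set \<Rightarrow> ((real ^ 'd::{finite,linorder} \<Rightarrow> complex) \<Rightarrow> real ^ 'd::_ \<Rightarrow> complex) \<Rightarrow> bool" where
  "topologizable_with W T \<longleftrightarrow> continuous_linear_operator fscale schwartz_topology T \<and>
     (\<forall>r. continuous_seminorm fscale schwartz_topology r \<longrightarrow>
       (\<exists>s. \<exists>a\<in>W. continuous_seminorm fscale schwartz_topology s \<and>
         (\<forall>n\<ge>1. \<forall>f\<in>schwartz. r ((T ^^ n) f) \<le> a n * s f)))"

definition faa_bounded_with ::
  "(nat \<Rightarrow> real) set \<Rightarrow> (real ^ 'd::{finite,linorder} \<Rightarrow> real ^ 'd::_) \<Rightarrow> (real ^ 'd::_ \<Rightarrow> complex) \<Rightarrow> bool" where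
  "faa_bounded_with W \<phi> \<psi> \<longleftrightarrow> (\<forall>\<alpha> \<mu>. mabs \<mu> \<le> mabs \<alpha> \<longrightarrow> (\<forall>p>0. \<exists>q>0. \<exists>a\<in>W. \<forall>n\<ge>1. \<forall>x.
     (1 + norm x) powr p / (1 + norm ((\<phi> ^^ n) x)) powr q *
       cmod (faa_coeff \<alpha> \<mu> (\<phi> ^^ n) (iter_weight \<psi> \<phi> n) x) \<le> a n))"

lemma growth_class_upper_bound:
  assumes "growth_class W" "finite I" "\<And>i. i \<in> I \<Longrightarrow> a i \<in> W"
  shows "\<exists>c\<in>W. \<forall>i\<in>I. \<forall>n\<ge>1. a i n \<le> c n"
  using assms(2,3)
proof (induction I rule: finite_induct)
  case empty
  then show ?case using assms(1) by (auto simp: growth_class_def)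
next
  case (insert j I)
  then obtain c where c: "c \<in> W" "\<forall>i\<in>I. \<forall>n\<ge>1. a i n \<le> c n" by auto
  have "a j \<in> W" using insert.prems by simp
  then obtain d where d: "d \<in> W" "\<forall>n\<ge>1. a j n \<le> d n \<and> c n \<le> d n"
    using assms(1) c(1) unfolding growth_class_def by blast
  have "\<forall>i\<in>insert j I. \<forall>n\<ge>1. a i n \<le> d n"
    using c(2) d(2) by (auto intro: order_trans)
  then show ?case using d(1) by blast
qed

text \<open>Pointwise rather than in terms of \<open>schwartz_norm\<close>, because
  \<open>(wcomp \<psi> \<phi> ^^ n) f\<close> is not yet known to lie in \<open>schwartz\<close>;
  the case \<open>n = 1\<close> is what shows that the operator acts.\<close>

lemma schwartz_bound_if_faa_bounded:
  fixes \<phi> :: "real ^ 'd::{finite,linorder} \<Rightarrow> real ^ 'd::_"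
  assumes W: "growth_class W" and \<phi>: "smooth \<phi>" and \<psi>: "smooth \<psi>"
    and bounded: "faa_bounded_with W \<phi> \<psi>" and p: "0 < p"
  shows "\<exists>F a. norm_index F \<and> a \<in> W \<and> (\<forall>n\<ge>1. \<forall>f\<in>schwartz. \<forall>x.
    (1 + norm x) powr p * cmod (mderiv \<alpha> ((wcomp \<psi> \<phi> ^^ n) f) x) \<le> a n * fin_norm F f)"
proof -
  let ?S = "{\<mu> :: nat ^ 'd::_. mabs \<mu> \<le> mabs \<alpha>}"
  let ?F = "\<lambda>\<mu> n x. faa_coeff \<alpha> \<mu> (\<phi> ^^ n) (iter_weight \<psi> \<phi> n) x"
  have "\<forall>\<mu>\<in>?S. \<exists>q a. 0 < q \<and> a \<in> W \<and> (\<forall>n\<ge>1. \<forall>x.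
     (1 + norm x) powr p / (1 + norm ((\<phi> ^^ n) x)) powr q * cmod (?F \<mu> n x) \<le> a n)"
    using bounded p unfolding faa_bounded_with_def by blast
  then obtain q a where qa: "\<And>\<mu>. \<mu> \<in> ?S \<Longrightarrow> 0 < q \<mu>" "\<And>\<mu>. \<mu> \<in> ?S \<Longrightarrow> a \<mu> \<in> W"
    "\<And>\<mu> n x. \<mu> \<in> ?S \<Longrightarrow> 1 \<le> n \<Longrightarrow>
     (1 + norm x) powr p / (1 + norm ((\<phi> ^^ n) x)) powr q \<mu> * cmod (?F \<mu> n x) \<le> a \<mu> n"
    by metis
  have "\<exists>c\<in>W. \<forall>\<mu>\<in>?S. \<forall>n\<ge>1. a \<mu> n \<le> c n"
    by (rule growth_class_upper_bound[OF W finite_mabs_le qa(2)])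
  then obtain c where c: "c \<in> W" "\<forall>\<mu>\<in>?S. \<forall>n\<ge>1. a \<mu> n \<le> c n" by blast
  \<comment> \<open>The weight exponent belonging to the coefficient of index \<open>\<mu>\<close>
    becomes the order of the norm that measures the derivative of index
    \<open>\<mu>\<close>.\<close>
  define F where "F = (\<lambda>\<mu>. (q \<mu>, \<mu>)) ` ?S"
  have F: "norm_index F" using qa(1) by (auto simp: F_def norm_index_def)
  have fin_norm_F: "fin_norm F f = (\<Sum>\<mu>\<in>?S. schwartz_norm (q \<mu>) \<mu> f)" for f
    unfolding fin_norm_def F_def by (subst sum.reindex) (auto simp: inj_on_def)
  have "(1 + norm x) powr p * cmod (mderiv \<alpha> ((wcomp \<psi> \<phi> ^^ n) f) x) \<le> c n * fin_norm F f"
    if n: "1 \<le> n" and f: "f \<in> schwartz" for n f x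
  proof -
    have term_le: "(1 + norm x) powr p * cmod (?F \<mu> n x * mderiv \<mu> f ((\<phi> ^^ n) x)) \<le> c n * schwartz_norm (q \<mu>) \<mu> f"
      if \<mu>: "\<mu> \<in> ?S" for \<mu>
    proof -
      let ?w = "(1 + norm ((\<phi> ^^ n) x)) powr q \<mu>"
      have w: "0 < ?w" unfolding powr_gt_zero using norm_ge_zero[of "(\<phi> ^^ n) x"] by linarith
      \<comment> \<open>The weight at \<open>(\<phi> ^^ n) x\<close> is inserted and divided out:
        one factor is bounded by the hypothesis on the coefficients, the other by a norm of
        \<open>f\<close>.\<close>
      have "(1 + norm x) powr p * cmod (?F \<mu> n x * mderiv \<mu> f ((\<phi> ^^ n) x)) =
        ((1 + norm x) powr p / ?w * cmod (?F \<mu> n x)) * (?w * cmod (mderiv \<mu> f ((\<phi> ^^ n) x)))"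
        using w by (simp add: norm_mult)
      also have "\<dots> \<le> c n * schwartz_norm (q \<mu>) \<mu> f"
      proof (rule mult_mono)
        show "(1 + norm x) powr p / ?w * cmod (?F \<mu> n x) \<le> c n"
          using qa(3)[OF \<mu> n, of x] c(2) \<mu> n by (auto intro: order_trans)
        show "?w * cmod (mderiv \<mu> f ((\<phi> ^^ n) x)) \<le> schwartz_norm (q \<mu>) \<mu> f"
          by (rule le_schwartz_norm[OF f qa(1)[OF \<mu>]])
        show "0 \<le> c n" using W c(1) n by (auto simp: growth_class_def intro: less_imp_le)
      qed simp
      finally show ?thesis .
    qed
    have "mderiv \<alpha> ((wcomp \<psi> \<phi> ^^ n) f) x = (\<Sum>\<mu>\<in>?S. ?F \<mu> n x * mderiv \<mu> f ((\<phi> ^^ n) x))"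
      unfolding funpow_wcomp
      by (rule mderiv_weighted_compose[OF schwartz_smooth[OF f] smooth_funpow[OF \<phi>] smooth_iter_weight[OF \<phi> \<psi>]])
    then have "(1 + norm x) powr p * cmod (mderiv \<alpha> ((wcomp \<psi> \<phi> ^^ n) f) x) \<le>
      (1 + norm x) powr p * (\<Sum>\<mu>\<in>?S. cmod (?F \<mu> n x * mderiv \<mu> f ((\<phi> ^^ n) x)))"
      by (simp only: mult_left_mono norm_sum powr_ge_zero)
    also have "\<dots> \<le> (\<Sum>\<mu>\<in>?S. c n * schwartz_norm (q \<mu>) \<mu> f)"
      unfolding sum_distrib_left by (rule sum_mono) (rule term_le)
    also have "\<dots> = c n * fin_norm F f" by (simp only: fin_norm_F sum_distrib_left)
    finally show ?thesis .
  qed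
  then show ?thesis using F c(1) by blast
qed

lemma smooth_funpow_wcomp:
  assumes "smooth \<phi>" "smooth \<psi>" "smooth f"
  shows "smooth ((wcomp \<psi> \<phi> ^^ n) f)"
proof -
  have "smooth (\<lambda>x. f ((\<phi> ^^ n) x))"
    using smooth_compose[OF assms(3)] smooth_nth[OF smooth_funpow[OF assms(1)]] by blast
  then show ?thesis
    unfolding funpow_wcomp using smooth_bilinear[OF bounded_bilinear_mult smooth_iter_weight[OF assms(1,2)]] by blast
qed

lemma topologizable_if_faa_bounded:
  fixes \<phi> :: "real ^ 'd::{finite,linorder} \<Rightarrow> real ^ 'd::_"
  assumes W: "growth_class W" and \<phi>: "smooth \<phi>" and \<psi>: "smooth \<psi>"
    and bounded: "faa_bounded_with W \<phi> \<psi>"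
  shows "acts_on_schwartz \<psi> \<phi> \<and> topologizable_with W (wcomp \<psi> \<phi>)"
proof -
  let ?T = "wcomp \<psi> \<phi>"
  note bound = schwartz_bound_if_faa_bounded[OF W \<phi> \<psi> bounded]
  have acts: "?T f \<in> schwartz" if f: "f \<in> schwartz" for f
  proof (rule schwartzI)
    show "smooth (?T f)" using smooth_funpow_wcomp[OF \<phi> \<psi> schwartz_smooth[OF f], of 1] by simp
    fix p :: real and \<alpha> assume p: "0 < p"
    obtain F a where "\<forall>n\<ge>1. \<forall>f\<in>schwartz. \<forall>x.
      (1 + norm x) powr p * cmod (mderiv \<alpha> ((?T ^^ n) f) x) \<le> a n * fin_norm F f"
      using bound[OF p] by blast
    then have "\<forall>x. (1 + norm x) powr p * cmod (mderiv \<alpha> ((?T ^^ 1) f) x) \<le> a 1 * fin_norm F f"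
      using f by blast
    then show "\<exists>C. \<forall>x. (1 + norm x) powr p * cmod (mderiv \<alpha> (?T f) x) \<le> C" by auto
  qed
  have norm_bound: "\<exists>F a. norm_index F \<and> a \<in> W \<and>
      (\<forall>n\<ge>1. \<forall>f\<in>schwartz. schwartz_norm p \<alpha> ((?T ^^ n) f) \<le> a n * fin_norm F f)" if "0 < p" for p \<alpha>
    using bound[OF that, of \<alpha>] schwartz_norm_leI by metis
  have combined: "\<exists>F a. norm_index F \<and> a \<in> W \<and>
      (\<exists>K\<ge>0. \<forall>n\<ge>1. \<forall>f\<in>schwartz. fin_norm G ((?T ^^ n) f) \<le> K * a n * fin_norm F f)" if "norm_index G" for G
    by (rule fin_norm_combine[OF _ _ _ norm_bound that]) (use W in \<open>simp_all add: growth_class_def\<close>)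
  have "continuous_linear_operator fscale schwartz_topology ?T"
  proof (rule continuous_linear_operatorI[OF acts wcomp_add wcomp_fscale])
    fix G :: "(real \<times> (nat ^ 'd::_)) set" assume "norm_index G"
    then obtain F a K where *: "norm_index F" "a \<in> W" "0 \<le> K"
      "\<forall>n\<ge>1. \<forall>f\<in>schwartz. fin_norm G ((?T ^^ n) f) \<le> K * a n * fin_norm F f"
      using combined by blast
    \<comment> \<open>Continuity of the operator is the estimate for \<open>n = 1\<close>.\<close>
    have "\<forall>f\<in>schwartz. fin_norm G ((?T ^^ 1) f) \<le> K * a 1 * fin_norm F f" using *(4) by blast
    moreover have "0 < a 1" using W *(2) by (simp add: growth_class_def)
    ultimately show "\<exists>F C. norm_index F \<and> 0 \<le> C \<and> (\<forall>f\<in>schwartz. fin_norm G (?T f) \<le> C * fin_norm F f)"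
      using *(1,3) by (intro exI[of _ F] exI[of _ "K * a 1"]) auto
  qed
  moreover have "\<exists>s. \<exists>a\<in>W. continuous_seminorm fscale schwartz_topology s \<and>
         (\<forall>n\<ge>1. \<forall>f\<in>schwartz. r ((?T ^^ n) f) \<le> a n * s f)"
    if r: "continuous_seminorm fscale schwartz_topology r" for r
  proof -
    obtain G C where G: "norm_index G" "0 < C" "\<forall>f\<in>schwartz. r f \<le> C * fin_norm G f"
      using continuous_seminorm_bound[OF r] by blast
    obtain F a K where F: "norm_index F" "a \<in> W" "0 \<le> K"
      "\<forall>n\<ge>1. \<forall>f\<in>schwartz. fin_norm G ((?T ^^ n) f) \<le> K * a n * fin_norm F f"
      using combined[OF G(1)] by blast
    have "r ((?T ^^ n) f) \<le> a n * (C * K * fin_norm F f)" if "1 \<le> n" "f \<in> schwartz" for n f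
    proof -
      have "(?T ^^ n) f \<in> schwartz" using that(2) by (induction n) (auto intro: acts)
      then have "r ((?T ^^ n) f) \<le> C * fin_norm G ((?T ^^ n) f)" using G(3) by blast
      also have "\<dots> \<le> C * (K * a n * fin_norm F f)" using F(4) that G(2) by (intro mult_left_mono) auto
      finally show ?thesis by (simp add: mult_ac)
    qed
    moreover have "continuous_seminorm fscale schwartz_topology (\<lambda>f. C * K * fin_norm F f)"
      using F(1,3) G(2) by (intro continuous_seminorm_fin_norm) auto
    ultimately show ?thesis using F(2) by blast
  qed
  ultimately show ?thesis using acts by (simp add: acts_on_schwartz_def topologizable_with_def)
qed

lemma faa_bounded_if_topologizable:
  fixes \<phi> :: "real ^ 'd::{finite,linorder} \<Rightarrow> real ^ 'd::_"
  assumes W: "growth_class W" and \<phi>: "smooth \<phi>" and \<psi>: "smooth \<psi>"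
    and acts: "acts_on_schwartz \<psi> \<phi>" and top: "topologizable_with W (wcomp \<psi> \<phi>)"
  shows "faa_bounded_with W \<phi> \<psi>"
  unfolding faa_bounded_with_def
proof (intro allI impI)
  fix \<alpha> \<mu> :: "nat ^ 'd::_" and p :: real
  assume \<mu>: "mabs \<mu> \<le> mabs \<alpha>" and p: "0 < p"
  let ?T = "wcomp \<psi> \<phi>"
  let ?F = "\<lambda>\<mu> n x. faa_coeff \<alpha> \<mu> (\<phi> ^^ n) (iter_weight \<psi> \<phi> n) x"
  have "continuous_seminorm fscale schwartz_topology (\<lambda>f. 1 * fin_norm {(p, \<alpha>)} f)"
    by (intro continuous_seminorm_fin_norm norm_index_singleton p) simp
  then obtain s a where a: "a \<in> W" and s: "continuous_seminorm fscale schwartz_topology s"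
    and sa: "\<forall>n\<ge>1. \<forall>f\<in>schwartz. 1 * fin_norm {(p, \<alpha>)} ((?T ^^ n) f) \<le> a n * s f"
    using top unfolding topologizable_with_def by blast
  obtain G C where G: "norm_index G" "0 < C" "\<forall>f\<in>schwartz. s f \<le> C * fin_norm G f"
    using continuous_seminorm_bound[OF s] by blast
  \<comment> \<open>\<open>u\<close> depends only on \<open>\<alpha>\<close> and
    \<open>\<mu>\<close>, hence \<open>D\<close> and \<open>q\<close> below serve all
    \<open>n\<close> and \<open>x\<close>.\<close>
  obtain u where u: "\<And>a \<gamma>. mabs \<gamma> \<le> mabs \<alpha> \<Longrightarrow> mderiv \<gamma> (gauss_prod u a) a = (if \<gamma> = \<mu> then 1 else 0)"
    using exists_gauss_prod_jet by blast
  obtain D q where D: "0 < q" "0 \<le> D" "\<And>a. fin_norm G (gauss_prod u a) \<le> D * (1 + norm a) powr q"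
    using fin_norm_gauss_prod[OF G(1)] by blast
  \<comment> \<open>The constants from the seminorm bound and from the growth of the test functions
    are absorbed into the rate.\<close>
  obtain c where c: "c \<in> W" "\<forall>n\<ge>1. (C * D) * a n < c n"
    using W a unfolding growth_class_def by blast
  have "(1 + norm x) powr p / (1 + norm ((\<phi> ^^ n) x)) powr q * cmod (?F \<mu> n x) \<le> c n"
    if n: "1 \<le> n" for n x
  proof -
    define y where "y = (\<phi> ^^ n) x"
    define f where "f = gauss_prod u y"
    have f: "f \<in> schwartz" by (simp add: f_def gauss_prod_schwartz)
    have w: "0 < (1 + norm y) powr q" unfolding powr_gt_zero using norm_ge_zero[of y] by linarith
    have an: "0 < a n" using W a n by (simp add: growth_class_def)
    have "mderiv \<alpha> ((?T ^^ n) f) x = (\<Sum>\<nu> | mabs \<nu> \<le> mabs \<alpha>. ?F \<nu> n x * mderiv \<nu> f y)"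
      unfolding funpow_wcomp y_def
      by (rule mderiv_weighted_compose[OF schwartz_smooth[OF f] smooth_funpow[OF \<phi>] smooth_iter_weight[OF \<phi> \<psi>]])
    also have "\<dots> = (\<Sum>\<nu> | mabs \<nu> \<le> mabs \<alpha>. if \<nu> = \<mu> then ?F \<nu> n x else 0)"
      by (intro sum.cong) (auto simp: f_def u)
    also have "\<dots> = ?F \<mu> n x" using \<mu> by simp
    finally have F: "mderiv \<alpha> ((?T ^^ n) f) x = ?F \<mu> n x" .
    have "(?T ^^ n) f \<in> schwartz"
      using f acts by (induction n) (auto simp: acts_on_schwartz_def)
    then have "(1 + norm x) powr p * cmod (?F \<mu> n x) \<le> schwartz_norm p \<alpha> ((?T ^^ n) f)"
      unfolding F[symmetric] by (rule le_schwartz_norm[OF _ p])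
    also have "\<dots> \<le> a n * s f" using sa n f by (simp add: fin_norm_def)
    also have "\<dots> \<le> a n * (C * (D * (1 + norm y) powr q))"
    proof (rule mult_left_mono)
      have "s f \<le> C * fin_norm G f" using G(3) f by blast
      also have "\<dots> \<le> C * (D * (1 + norm y) powr q)"
        using D(3)[of y] G(2) by (simp add: f_def)
      finally show "s f \<le> C * (D * (1 + norm y) powr q)" .
    qed (use an in simp)
    also have "\<dots> = (C * D) * a n * (1 + norm y) powr q" by (simp add: mult_ac)
    also have "\<dots> \<le> c n * (1 + norm y) powr q"
      using c(2) n w by (intro mult_right_mono) (auto intro: less_imp_le)
    finally have "(1 + norm x) powr p * cmod (?F \<mu> n x) / (1 + norm y) powr q \<le> c n"
      by (simp only: pos_divide_le_eq[OF w])
    then show ?thesis by (simp add: y_def)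
  qed
  then show "\<exists>q>0. \<exists>a\<in>W. \<forall>n\<ge>1. \<forall>x. (1 + norm x) powr p / (1 + norm ((\<phi> ^^ n) x)) powr q * cmod (?F \<mu> n x) \<le> a n"
    using D(1) c(1) by blast
qed

theorem topologizable_with_iff:
  fixes \<phi> :: "real ^ 'd::{finite,linorder} \<Rightarrow> real ^ 'd::_"
  assumes "growth_class W" "smooth \<phi>" "smooth \<psi>"
  shows "acts_on_schwartz \<psi> \<phi> \<and> topologizable_with W (wcomp \<psi> \<phi>) \<longleftrightarrow> faa_bounded_with W \<phi> \<psi>"
  using topologizable_if_faa_bounded faa_bounded_if_topologizable assms by blast

section \<open>The two growth classes\<close>

lemma growth_class_positive: "growth_class {a. \<forall>n\<ge>1. 0 < a n}" (is "growth_class ?W")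
  unfolding growth_class_def
proof (intro conjI ballI allI)
  show "?W \<noteq> {}"
    unfolding ex_in_conv[symmetric] by (rule exI[of _ "\<lambda>_. 1"]) simp
  fix a b :: "nat \<Rightarrow> real" and K :: real
  assume a: "a \<in> ?W"
  then show "1 \<le> n \<longrightarrow> 0 < a n" for n by simp
  have "0 < \<bar>K * a n\<bar> + 1 \<and> K * a n < \<bar>K * a n\<bar> + 1" for n by linarith
  then show "\<exists>c\<in>?W. \<forall>n\<ge>1. K * a n < c n"
    by (intro bexI[of _ "\<lambda>n. \<bar>K * a n\<bar> + 1"]) simp_all
  have "0 < max (a n) (b n) \<and> a n \<le> max (a n) (b n) \<and> b n \<le> max (a n) (b n)" if "1 \<le> n" for n
    using a that by (auto simp: less_max_iff_disj)
  then show "\<exists>c\<in>?W. \<forall>n\<ge>1. a n \<le> c n \<and> b n \<le> c n"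
    by (intro bexI[of _ "\<lambda>n. max (a n) (b n)"]) simp_all
qed

lemma growth_class_geometric: "growth_class {\<lambda>n. M ^ n | M. 0 < M}" (is "growth_class ?W")
  unfolding growth_class_def
proof (intro conjI ballI allI)
  have mem: "(\<lambda>n. L ^ n) \<in> ?W" if "0 < L" for L using that by blast
  show "?W \<noteq> {}"
    unfolding ex_in_conv[symmetric] by (rule exI[of _ "\<lambda>n. 1 ^ n"]) (rule mem, simp)
  fix a b :: "nat \<Rightarrow> real" and K :: real
  assume "a \<in> ?W"
  then obtain M where M: "0 < M" "a = (\<lambda>n. M ^ n)" by blast
  then show "1 \<le> n \<longrightarrow> 0 < a n" for n by simp
  \<comment> \<open>For \<open>n \<ge> 1\<close> a constant factor is absorbed by enlarging the
    base: \<open>\<bar>K\<bar> + 1\<close> is at least 1, so its powers stay above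
    \<open>K\<close>.\<close>
  have "K * a n < ((\<bar>K\<bar> + 1) * M) ^ n" if n: "1 \<le> n" for n
  proof -
    have "K < \<bar>K\<bar> + 1" by simp
    also have "\<dots> \<le> (\<bar>K\<bar> + 1) ^ n" using n by (intro self_le_power) auto
    finally show ?thesis using M by (simp add: power_mult_distrib)
  qed
  moreover have "0 < (\<bar>K\<bar> + 1) * M" using M(1) by (intro mult_pos_pos) auto
  ultimately show "\<exists>c\<in>?W. \<forall>n\<ge>1. K * a n < c n"
    by (intro bexI[of _ "\<lambda>n. ((\<bar>K\<bar> + 1) * M) ^ n"] mem) auto
  assume "b \<in> ?W"
  then obtain L where L: "0 < L" "b = (\<lambda>n. L ^ n)" by blast
  have "a n \<le> max M L ^ n \<and> b n \<le> max M L ^ n" for n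
    using M L by (auto intro!: power_mono)
  moreover have "0 < max M L" using M(1) by simp
  ultimately show "\<exists>c\<in>?W. \<forall>n\<ge>1. a n \<le> c n \<and> b n \<le> c n"
    by (intro bexI[of _ "\<lambda>n. max M L ^ n"] mem) auto
qed

lemma scaled_seminorm_le_iff:
  assumes r: "continuous_seminorm fscale schwartz_topology r" and T: "continuous_linear_operator fscale schwartz_topology T"
    and "f \<in> schwartz" "0 < a"
  shows "r (fscale (complex_of_real a) ((T ^^ n) f)) \<le> s f \<longleftrightarrow> r ((T ^^ n) f) \<le> inverse a * s f"
proof -
  have "(T ^^ n) f \<in> schwartz"
    using T assms(3) by (induction n) (auto simp: continuous_linear_operator_def continuous_map_def)
  then have "r (fscale (complex_of_real a) ((T ^^ n) f)) = a * r ((T ^^ n) f)"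
    using r assms(4) by (simp add: continuous_seminorm_def)
  then show ?thesis using assms(4) by (simp add: field_simps)
qed

lemma topologizable_iff: "topologizable fscale schwartz_topology T \<longleftrightarrow> topologizable_with {a. \<forall>n\<ge>1. 0 < a n} T"
proof (cases "continuous_linear_operator fscale schwartz_topology T")
  case T: True
  have "(\<exists>s a. continuous_seminorm fscale schwartz_topology s \<and> (\<forall>n\<ge>1. 0 < a n) \<and>
      (\<forall>n\<ge>1. \<forall>f\<in>schwartz. r (fscale (complex_of_real (a n)) ((T ^^ n) f)) \<le> s f)) \<longleftrightarrow>
    (\<exists>s. \<exists>a\<in>{a. \<forall>n\<ge>1. 0 < a n}. continuous_seminorm fscale schwartz_topology s \<and>
      (\<forall>n\<ge>1. \<forall>f\<in>schwartz. r ((T ^^ n) f) \<le> a n * s f))"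
    (is "?L \<longleftrightarrow> ?R") if r: "continuous_seminorm fscale schwartz_topology r" for r
  proof
    assume ?L
    then obtain s a where "continuous_seminorm fscale schwartz_topology s" "\<forall>n\<ge>1. 0 < a n"
      "\<forall>n\<ge>1. \<forall>f\<in>schwartz. r (fscale (complex_of_real (a n)) ((T ^^ n) f)) \<le> s f" by blast
    then show ?R using scaled_seminorm_le_iff[OF r T, of _ _ _ s]
      by (intro exI[of _ s] bexI[of _ "\<lambda>n. inverse (a n)"]) auto
  next
    assume ?R
    then obtain s a where sa: "continuous_seminorm fscale schwartz_topology s" "\<forall>n\<ge>1. 0 < a n"
      "\<forall>n\<ge>1. \<forall>f\<in>schwartz. r ((T ^^ n) f) \<le> a n * s f" by blast
    have "r (fscale (complex_of_real (inverse (a n))) ((T ^^ n) f)) \<le> s f" if "1 \<le> n" "f \<in> schwartz" for n f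
      using sa that by (subst scaled_seminorm_le_iff[OF r T]) auto
    moreover have "\<forall>n\<ge>1. 0 < inverse (a n)" using sa(2) by simp
    ultimately show ?L using sa(1) by (intro exI[of _ s] exI[of _ "\<lambda>n. inverse (a n)"]) auto
  qed
  then show ?thesis by (simp add: topologizable_def topologizable_with_def)
qed (simp add: topologizable_def topologizable_with_def)

lemma m_topologizable_iff: "m_topologizable fscale schwartz_topology T \<longleftrightarrow> topologizable_with {\<lambda>n. M ^ n | M. 0 < M} T"
proof (cases "continuous_linear_operator fscale schwartz_topology T")
  case T: True
  have "(\<exists>s M. continuous_seminorm fscale schwartz_topology s \<and> 0 < M \<and>
      (\<forall>n\<ge>1. \<forall>f\<in>schwartz. r (fscale (complex_of_real (M ^ n)) ((T ^^ n) f)) \<le> s f)) \<longleftrightarrow>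
    (\<exists>s. \<exists>a\<in>{\<lambda>n. M ^ n | M. 0 < M}. continuous_seminorm fscale schwartz_topology s \<and>
      (\<forall>n\<ge>1. \<forall>f\<in>schwartz. r ((T ^^ n) f) \<le> a n * s f))"
    (is "?L \<longleftrightarrow> ?R") if r: "continuous_seminorm fscale schwartz_topology r" for r
  proof
    assume ?L
    then obtain s M where s: "continuous_seminorm fscale schwartz_topology s" and M: "0 < M"
      "\<forall>n\<ge>1. \<forall>f\<in>schwartz. r (fscale (complex_of_real (M ^ n)) ((T ^^ n) f)) \<le> s f" by blast
    have "(\<lambda>n. inverse M ^ n) \<in> {\<lambda>n. M ^ n | M. 0 < M}" using M(1) by (auto intro!: exI[of _ "inverse M"])
    moreover have "r ((T ^^ n) f) \<le> inverse M ^ n * s f" if "1 \<le> n" "f \<in> schwartz" for n f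
      using scaled_seminorm_le_iff[OF r T that(2), of "M ^ n" n s] M that by (simp add: power_inverse)
    ultimately show ?R using s by blast
  next
    assume ?R
    then obtain s M where s: "continuous_seminorm fscale schwartz_topology s" and M: "0 < M"
      "\<forall>n\<ge>1. \<forall>f\<in>schwartz. r ((T ^^ n) f) \<le> M ^ n * s f" by blast
    have "r (fscale (complex_of_real (inverse M ^ n)) ((T ^^ n) f)) \<le> s f" if "1 \<le> n" "f \<in> schwartz" for n f
      using scaled_seminorm_le_iff[OF r T that(2), of "inverse M ^ n" n s] M that by (simp add: power_inverse)
    then show ?L using s M(1) by (intro exI[of _ s] exI[of _ "inverse M"]) auto
  qed
  then show ?thesis by (simp add: m_topologizable_def topologizable_with_def)
qed (simp add: m_topologizable_def topologizable_with_def)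

section \<open>Suprema in the extended reals and pointwise bounds\<close>

lemma SUP_ereal_less_infinity_iff: "(SUP x. ereal (g x)) < \<infinity> \<longleftrightarrow> (\<exists>C>0. \<forall>x. g x \<le> C)"
proof
  assume *: "(SUP x. ereal (g x)) < \<infinity>"
  then obtain C where C: "(SUP x. ereal (g x)) \<le> ereal C"
    by (cases "SUP x. ereal (g x)") auto
  have "g x \<le> \<bar>C\<bar> + 1" for x using order_trans[OF SUP_upper C, of x] by simp
  then show "\<exists>C>0. \<forall>x. g x \<le> C" by (intro exI[of _ "\<bar>C\<bar> + 1"]) auto
next
  assume "\<exists>C>0. \<forall>x. g x \<le> C"
  then obtain C where "\<And>x. g x \<le> C" by blast
  then have "(SUP x. ereal (g x)) \<le> ereal C" by (intro SUP_least) simp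
  then show "(SUP x. ereal (g x)) < \<infinity>" by (rule le_less_trans) simp
qed

text \<open>Positive sequences impose no link between different \<open>n\<close>, so a bound can be
  chosen for each \<open>n\<close> separately.\<close>

lemma bounded_positive_iff:
  "(\<exists>a\<in>{a. \<forall>n\<ge>1. 0 < a n}. \<forall>n\<ge>1. \<forall>x. g n x \<le> a n) \<longleftrightarrow> (\<forall>n\<ge>1::nat. (SUP x. ereal (g n x)) < \<infinity>)"
proof
  assume "\<exists>a\<in>{a. \<forall>n\<ge>1. 0 < a n}. \<forall>n\<ge>1. \<forall>x. g n x \<le> a n"
  then show "\<forall>n\<ge>1. (SUP x. ereal (g n x)) < \<infinity>" unfolding SUP_ereal_less_infinity_iff by blast
next
  assume "\<forall>n\<ge>1. (SUP x. ereal (g n x)) < \<infinity>"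
  then have "\<forall>n. \<exists>C. 1 \<le> n \<longrightarrow> 0 < C \<and> (\<forall>x. g n x \<le> C)" unfolding SUP_ereal_less_infinity_iff by blast
  then obtain a where "\<forall>n. 1 \<le> n \<longrightarrow> 0 < a n \<and> (\<forall>x. g n x \<le> a n)" by metis
  then show "\<exists>a\<in>{a. \<forall>n\<ge>1. 0 < a n}. \<forall>n\<ge>1. \<forall>x. g n x \<le> a n" by (intro bexI[of _ a]) auto
qed

text \<open>Pointwise bounds by \<open>a n\<close> give a supremum of at most \<open>a n\<close>;
  strictness comes from a second geometric sequence strictly above the first, by absorption of the
  factor 1.\<close>

lemma bounded_geometric_iff:
  "(\<exists>a\<in>{\<lambda>n. M ^ n | M. 0 < M}. \<forall>n\<ge>1. \<forall>x. g n x \<le> a n) \<longleftrightarrow>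
    (\<exists>M>0. \<forall>n\<ge>1. (SUP x. ereal (g n x)) < ereal (M ^ n))" (is "?L \<longleftrightarrow> ?R")
proof
  assume ?L
  then obtain a where a: "a \<in> {\<lambda>n. M ^ n | M. 0 < M}" "\<forall>n\<ge>1. \<forall>x. g n x \<le> a n" by blast
  obtain c where "c \<in> {\<lambda>n. M ^ n | M. 0 < M}" and c: "\<forall>n\<ge>1. 1 * a n < c n"
    using growth_class_geometric a(1) unfolding growth_class_def by meson
  then obtain M where M: "0 < M" "c = (\<lambda>n. M ^ n)" by blast
  have "(SUP x. ereal (g n x)) < ereal (M ^ n)" if n: "1 \<le> n" for n
  proof -
    have "(SUP x. ereal (g n x)) \<le> ereal (a n)" using a(2) n by (intro SUP_least) simp
    also have "\<dots> < ereal (M ^ n)" using c n M by simp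
    finally show ?thesis .
  qed
  then show ?R using M(1) by blast
next
  assume ?R
  then obtain M where M: "0 < M" "\<And>n. 1 \<le> n \<Longrightarrow> (SUP x. ereal (g n x)) < ereal (M ^ n)" by blast
  have "g n x \<le> M ^ n" if "1 \<le> n" for n x
    using order_trans[OF SUP_upper less_imp_le[OF M(2)[OF that]], of x] by simp
  then show ?L using M(1) by (intro bexI[of _ "\<lambda>n. M ^ n"]) auto
qed

lemma faa_bounded_positive_iff:
  "faa_bounded_with {a. \<forall>n\<ge>1. 0 < a n} \<phi> \<psi> \<longleftrightarrow>
    (\<forall>\<alpha> \<mu>. mabs \<mu> \<le> mabs \<alpha> \<longrightarrow> (\<forall>p::real>0. \<exists>q::real>0. \<forall>n::nat\<ge>1.
        (SUP x. ereal ((1 + norm x) powr p / (1 + norm ((\<phi> ^^ n) x)) powr q *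
           cmod (faa_coeff \<alpha> \<mu> (\<phi> ^^ n) (iter_weight \<psi> \<phi> n) x))) < \<infinity>))"
  unfolding faa_bounded_with_def bounded_positive_iff ..

lemma faa_bounded_geometric_iff:
  "faa_bounded_with {\<lambda>n. M ^ n | M. 0 < M} \<phi> \<psi> \<longleftrightarrow>
    (\<forall>\<alpha> \<mu>. mabs \<mu> \<le> mabs \<alpha> \<longrightarrow> (\<forall>p::real>0. \<exists>q::real>0. \<exists>M::real>0. \<forall>n::nat\<ge>1.
        (SUP x. ereal ((1 + norm x) powr p / (1 + norm ((\<phi> ^^ n) x)) powr q *
           cmod (faa_coeff \<alpha> \<mu> (\<phi> ^^ n) (iter_weight \<psi> \<phi> n) x))) < ereal (M ^ n)))"
  unfolding faa_bounded_with_def bounded_geometric_iff ..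

theorem proposition4p10:
  fixes \<phi> :: "real ^ 'd::{finite,linorder} \<Rightarrow> real ^ 'd::_"
    and \<psi> :: "real ^ 'd::_ \<Rightarrow> complex"
  assumes "smooth \<phi>" and "smooth \<psi>"
  shows
    "(acts_on_schwartz \<psi> \<phi> \<and> topologizable fscale schwartz_topology (wcomp \<psi> \<phi>) \<longleftrightarrow>
      (\<forall>\<alpha> \<mu>. mabs \<mu> \<le> mabs \<alpha> \<longrightarrow> (\<forall>p::real>0. \<exists>q::real>0. \<forall>n::nat\<ge>1.
        (SUP x. ereal ((1 + norm x) powr p / (1 + norm ((\<phi> ^^ n) x)) powr q *
           cmod (faa_coeff \<alpha> \<mu> (\<phi> ^^ n) (iter_weight \<psi> \<phi> n) x))) < \<infinity>)))
     \<and>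
     (acts_on_schwartz \<psi> \<phi> \<and> m_topologizable fscale schwartz_topology (wcomp \<psi> \<phi>) \<longleftrightarrow>
      (\<forall>\<alpha> \<mu>. mabs \<mu> \<le> mabs \<alpha> \<longrightarrow> (\<forall>p::real>0. \<exists>q::real>0. \<exists>M::real>0. \<forall>n::nat\<ge>1.
        (SUP x. ereal ((1 + norm x) powr p / (1 + norm ((\<phi> ^^ n) x)) powr q *
           cmod (faa_coeff \<alpha> \<mu> (\<phi> ^^ n) (iter_weight \<psi> \<phi> n) x))) < ereal (M ^ n))))"
  unfolding topologizable_iff m_topologizable_iff faa_bounded_positive_iff[symmetric] faa_bounded_geometric_iff[symmetric]
  using topologizable_with_iff[OF growth_class_positive assms] topologizable_with_iff[OF growth_class_geometric assms]
  by blast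

end
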